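(* (Finite order weights.) Let $\psi$ satisfy the integrability condition (I) of the context for $p=1$ (hence for every $p\in[1,\infty]$). Let $r\ge1$ be a fixed integer and $\omega>0$, and for every $d\in\mathbb N$ let $\boldsymbol\gamma^{[d]}=(\gamma_{d,\mathfrak u})_{\mathfrak u\subseteq[1:d]}$ be given by $\gamma_{d,\mathfrak u}=\omega^{|\mathfrak u|}$ if $|\mathfrak u|\le r$ and $\gamma_{d,\mathfrak u}=0$ if $|\mathfrak u|>r$. Then for all $p,q\in[1,\infty]$ (with $1/\infty=0$), as $d\to\infty$, $$\|\imath_{p,q,\psi,\boldsymbol\gamma^{[d]}}\|=O\left(d^{\,r(1-1/q)}\right)\quad\text{and}\quad\|\imath_{p,q,\psi,\boldsymbol\gamma^{[d]}}\|=\Omega\left(d^{\,r(1-1/q)}\right).$$ Hence the weighted anchored and ANOVA norms are polynomially equivalent with exponent precisely $r(1-1/q)$, and for $q=1$ they are uniformly equivalent.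
   Context: Setting. $D$ is an interval, either $D=[0,T)$ with $T\in(0,\infty]$ or $D=[0,T]$ with $T\in(0,\infty)$; $\psi:D\to[0,\infty)$ is a probability density function (with respect to Lebesgue measure) that is positive almost everywhere. $d$ is a positive integer, $[1:d]=\{1,\dots,d\}$, and $\mathfrak u$ denotes subsets of $[1:d]$. For $\mathfrak u\neq\emptyset$, $D^{\mathfrak u}$ is the set of points $\boldsymbol x_{\mathfrak u}=(x_j)_{j\in\mathfrak u}$ with $x_j\in D$; functions on $D^{\mathfrak u}$ are identified with functions on $D^d$ depending only on the variables with indices in $\mathfrak u$. For $1\le p\le\infty$, $p'$ is the conjugate index, $1/p+1/p'=1$. $L_{p,\psi}(D^{\mathfrak u})$ is the Banach space of (classes of) real-valued functions with norm $\|g\|_{L_{p,\psi}(D^{\mathfrak u})}=\left(\int_{D^{\mathfrak u}}|g(\boldsymbol t_{\mathfrak u})|^p\prod_{j\in\mathfrak u}\psi(t_j)\,d\boldsymbol t_{\mathfrak u}\right)^{1/p}$ for $p<\infty$ and the essential supremum norm for $p=\infty$. $L_p^{\mathrm{loc}}(D)$ is the set of functions on $D$ whose restriction to $[0,x)$ is in $L_p([0,x))$ for all $x\in D$. Put $\overline\psi(t)=\int_t^T\psi(y)\,dy$. Integrability condition (I) for $p$ and $\psi$: either $p=\infty$ and $\overline\psi\in L_1(D)$; or $p<\infty$, $\psi^{-1/p}\in L_{p'}^{\mathrm{loc}}(D)$ and $\overline\psi\cdot\psi^{-1/p}\in L_{p'}(D)$. If (I) holds for $p=1$ then it holds for all $p\in[1,\infty]$.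 Kernels: $K_\pitchfork(x,t)=1_{[0,x)}(t)$, $K_A(x,t)=1_{[0,x)}(t)-\overline\psi(t)$ for $x,t\in D$, and $K_{\star,\mathfrak u}(\boldsymbol x_{\mathfrak u},\boldsymbol t_{\mathfrak u})=\prod_{j\in\mathfrak u}K_\star(x_j,t_j)$ for $\star\in\{\pitchfork,A\}$. For $\mathfrak u\ne\emptyset$ and $g_{\mathfrak u}\in L_{p,\psi}(D^{\mathfrak u})$ put $T_{\star,\mathfrak u}(g_{\mathfrak u})=\int_{D^{\mathfrak u}}g_{\mathfrak u}(\boldsymbol t_{\mathfrak u})K_{\star,\mathfrak u}(\cdot_{\mathfrak u},\boldsymbol t_{\mathfrak u})\,d\boldsymbol t_{\mathfrak u}$. For $\mathfrak u=\emptyset$, $L_{p,\psi}(D^\emptyset)=\mathbb R$ with norm $|\cdot|$ and $T_{\star,\emptyset}(c)$ is the constant function $c$. Let $F_{\star,p,\psi,\mathfrak u}=T_{\star,\mathfrak u}(L_{p,\psi}(D^{\mathfrak u}))$; the maps $T_{\star,\mathfrak u}$ are one-to-one, and $\|T_{\star,\mathfrak u}(g)\|_{F_{\star,p,\psi,\mathfrak u}}:=\|g\|_{L_{p,\psi}(D^{\mathfrak u})}$. The sum of the spaces $F_{\star,p,\psi,\mathfrak u}$ over $\mathfrak u\subseteq[1:d]$ (inside the continuous functions on $D^d$) is direct. For weights $\boldsymbol\gamma=(\gamma_{\mathfrak u})_{\mathfrak u\subseteq[1:d]}$ let $\mathfrak U_{\boldsymbol\gamma}=\{\mathfrak u\subseteq[1:d]:\gamma_{\mathfrak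 u}>0\}$. For $\star\in\{\pitchfork,A\}$ and $1\le q\le\infty$, $W_{\star,p,q,\psi,\boldsymbol\gamma}=\bigoplus_{\mathfrak u\in\mathfrak U_{\boldsymbol\gamma}}F_{\star,p,\psi,\mathfrak u}$, a space of functions $f=\sum_{\mathfrak u\in\mathfrak U_{\boldsymbol\gamma}}T_{\star,\mathfrak u}(g_{\star,\mathfrak u})$ on $D^d$, with norm $\|f\|_{W_{\star,p,q,\psi,\boldsymbol\gamma}}=\left(\sum_{\mathfrak u\in\mathfrak U_{\boldsymbol\gamma}}(\|g_{\star,\mathfrak u}\|_{L_{p,\psi}(D^{\mathfrak u})}/\gamma_{\mathfrak u})^q\right)^{1/q}$ for $q<\infty$ and the maximum over $\mathfrak u\in\mathfrak U_{\boldsymbol\gamma}$ for $q=\infty$. ($\star=\pitchfork$: anchored; $\star=A$: ANOVA.) If $\gamma_{\mathfrak w}>0$ implies $\gamma_{\mathfrak u}>0$ for all $\mathfrak u\subseteq\mathfrak w$ (as is the case here), the two spaces coincide as vector spaces; $\imath_{p,q,\psi,\boldsymbol\gamma}$ is the identity map from $W_{A,p,q,\psi,\boldsymbol\gamma}$ to $W_{\pitchfork,p,q,\psi,\boldsymbol\gamma}$, and $\|\imath_{p,q,\psi,\boldsymbol\gamma}\|=\|\imath_{p,q,\psi,\boldsymbol\gamma}^{-1}\|$ is its operator norm. For a family of weights $(\boldsymbol\gamma^{[d]})_{d\in\mathbb N}$ the weighted anchored and ANOVA norms are uniformly equivalent if $\sup_{d\in\mathbb N}\|\imath_{p,q,\psi,\boldsymbol\gamma^{[d]}}\|<\infty$,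 and polynomially equivalent if there is $\tau>0$ with $\|\imath_{p,q,\psi,\boldsymbol\gamma^{[d]}}\|=O(d^\tau)$; the infimum of such $\tau$ is the exponent of polynomial equivalence. *)

theory Defs
  imports "HOL-Probability.Essential_Supremum" "HOL-Library.Landau_Symbols"
begin

text \<open>Exponents in \<open>[1, \<infinity>]\<close> are elements of \<^typ>\<open>ennreal\<close>; there \<open>1 / \<infinity> = 0\<close> and \<open>1 / 0 = \<infinity>\<close>.\<close>

definition conj_index :: "ennreal \<Rightarrow> ennreal" where
  "conj_index p = 1 / (1 - 1 / p)"

lemma conj_index_eq: "1 \<le> p \<Longrightarrow> 1 / p + 1 / conj_index p = 1"
proof -
  assume "1 \<le> p"
  have inv: "inverse (inverse x) = x" for x :: ennreal
    by (cases x; cases "x = 0") (auto simp: inverse_ennreal less_le)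
  from \<open>1 \<le> p\<close> have le: "1 / p \<le> 1"
    by (intro divide_le_posI_ennreal) (auto intro: less_le_trans[OF zero_less_one])
  have "1 / conj_index p = 1 - 1 / p"
    unfolding conj_index_def divide_ennreal_def by (simp add: inv)
  with le show ?thesis by (simp add: add_diff_inverse_ennreal)
qed

definition domain_interval :: "real set \<Rightarrow> bool" where
  "domain_interval D \<longleftrightarrow>
     (\<exists>T::ereal. 0 < T \<and> D = {x. 0 \<le> x \<and> ereal x < T}) \<or>
     (\<exists>T::real. 0 < T \<and> D = {0..T})"

definition positive_pdf :: "real set \<Rightarrow> (real \<Rightarrow> real) \<Rightarrow> bool" where
  "positive_pdf D \<psi> \<longleftrightarrow>
     \<psi> \<in> borel_measurable (lebesgue_on D) \<and>
     (\<forall>x\<in>D. 0 \<le> \<psi> x) \<and>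
     (\<integral>\<^sup>+x. ennreal (\<psi> x) \<partial>lebesgue_on D) = 1 \<and>
     (AE x in lebesgue_on D. 0 < \<psi> x)"

text \<open>Weighted Lebesgue spaces. Elements are representatives rather than classes modulo
  equality almost everywhere. As usual, the weight \<open>w\<close> does not enter for \<open>p = \<infinity>\<close>.\<close>

definition Lp_space :: "'a measure \<Rightarrow> ('a \<Rightarrow> real) \<Rightarrow> ennreal \<Rightarrow> ('a \<Rightarrow> real) set" where
  "Lp_space M w p = {g \<in> borel_measurable M.
     if p = \<infinity> then esssup M (\<lambda>t. ennreal \<bar>g t\<bar>) < \<infinity>
     else integrable M (\<lambda>t. \<bar>g t\<bar> powr enn2real p * w t)}"

definition Lp_norm :: "'a measure \<Rightarrow> ('a \<Rightarrow> real) \<Rightarrow> ennreal \<Rightarrow> ('a \<Rightarrow> real) \<Rightarrow> real" where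
  "Lp_norm M w p g =
     (if p = \<infinity> then enn2real (esssup M (\<lambda>t. ennreal \<bar>g t\<bar>))
      else (LINT t|M. \<bar>g t\<bar> powr enn2real p * w t) powr (1 / enn2real p))"

definition Lp_loc :: "real set \<Rightarrow> ennreal \<Rightarrow> (real \<Rightarrow> real) set" where
  "Lp_loc D p = {f. \<forall>x\<in>D. f \<in> Lp_space (lebesgue_on {0..<x}) (\<lambda>_. 1) p}"

definition psi_bar :: "real set \<Rightarrow> (real \<Rightarrow> real) \<Rightarrow> real \<Rightarrow> real" where
  "psi_bar D \<psi> t = (LINT y:{t..}|lebesgue_on D. \<psi> y)"

definition integrability_cond :: "real set \<Rightarrow> (real \<Rightarrow> real) \<Rightarrow> ennreal \<Rightarrow> bool" where
  "integrability_cond D \<psi> p \<longleftrightarrow>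
     (p = \<infinity> \<and> psi_bar D \<psi> \<in> Lp_space (lebesgue_on D) (\<lambda>_. 1) 1) \<or>
     (p < \<infinity> \<and>
      (\<lambda>t. \<psi> t powr (- 1 / enn2real p)) \<in> Lp_loc D (conj_index p) \<and>
      (\<lambda>t. psi_bar D \<psi> t * \<psi> t powr (- 1 / enn2real p))
        \<in> Lp_space (lebesgue_on D) (\<lambda>_. 1) (conj_index p))"

datatype kind = Anchored | ANOVA

fun kernel :: "real set \<Rightarrow> (real \<Rightarrow> real) \<Rightarrow> kind \<Rightarrow> real \<Rightarrow> real \<Rightarrow> real" where
  "kernel D \<psi> Anchored x t = indicat_real {0..<x} t"
| "kernel D \<psi> ANOVA x t = indicat_real {0..<x} t - psi_bar D \<psi> t"

definition kernel_prod ::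
    "real set \<Rightarrow> (real \<Rightarrow> real) \<Rightarrow> kind \<Rightarrow> nat set \<Rightarrow> (nat \<Rightarrow> real) \<Rightarrow> (nat \<Rightarrow> real) \<Rightarrow> real" where
  "kernel_prod D \<psi> k u x t = (\<Prod>j\<in>u. kernel D \<psi> k (x j) (t j))"

text \<open>Lebesgue measure on \<open>D\<^sup>u\<close>. For \<open>u = {}\<close> this is the unit mass on a single point, so that
  the space \<open>L_psi\<close> below becomes \<open>\<real>\<close> with the absolute value and \<open>T_op\<close> maps \<open>c\<close> to the
  constant function \<open>c\<close>; see the lemmas following the definitions.\<close>

definition leb_pow :: "real set \<Rightarrow> nat set \<Rightarrow> (nat \<Rightarrow> real) measure" where
  "leb_pow D u = PiM u (\<lambda>_. lebesgue_on D)"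

definition L_psi :: "real set \<Rightarrow> (real \<Rightarrow> real) \<Rightarrow> ennreal \<Rightarrow> nat set \<Rightarrow> ((nat \<Rightarrow> real) \<Rightarrow> real) set" where
  "L_psi D \<psi> p u = Lp_space (leb_pow D u) (\<lambda>t. \<Prod>j\<in>u. \<psi> (t j)) p"

definition L_psi_norm :: "real set \<Rightarrow> (real \<Rightarrow> real) \<Rightarrow> ennreal \<Rightarrow> nat set \<Rightarrow> ((nat \<Rightarrow> real) \<Rightarrow> real) \<Rightarrow> real" where
  "L_psi_norm D \<psi> p u g = Lp_norm (leb_pow D u) (\<lambda>t. \<Prod>j\<in>u. \<psi> (t j)) p g"

definition cube :: "real set \<Rightarrow> nat \<Rightarrow> (nat \<Rightarrow> real) set" where
  "cube D d = {1..d} \<rightarrow>\<^sub>E D"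

text \<open>Functions on \<open>D\<^sup>d\<close> are represented by extensional functions on \<^const>\<open>cube\<close>. Since
  \<^const>\<open>kernel_prod\<close> reads only the coordinates of \<open>x\<close> with index in \<open>u\<close>, the function below is
  already regarded as a function on \<open>D\<^sup>d\<close> that depends only on these coordinates.\<close>

definition T_op ::
    "real set \<Rightarrow> (real \<Rightarrow> real) \<Rightarrow> kind \<Rightarrow> nat \<Rightarrow> nat set \<Rightarrow> ((nat \<Rightarrow> real) \<Rightarrow> real) \<Rightarrow> (nat \<Rightarrow> real) \<Rightarrow> real" where
  "T_op D \<psi> k d u g = (\<lambda>x\<in>cube D d. LINT t|leb_pow D u. g t * kernel_prod D \<psi> k u x t)"

lemma T_op_empty: "x \<in> cube D d \<Longrightarrow> T_op D \<psi> k d {} g x = g (\<lambda>_. undefined)"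
  by (simp add: T_op_def leb_pow_def kernel_prod_def PiM_empty lebesgue_integral_count_space_finite)

lemma L_psi_empty: "L_psi D \<psi> p {} = UNIV"
proof -
  have [simp]: "integrable (count_space {\<lambda>_. undefined :: real}) f" for f :: "(nat \<Rightarrow> real) \<Rightarrow> real"
    by (simp add: integrable_count_space)
  have "esssup (count_space {\<lambda>_. undefined}) (\<lambda>t. ennreal \<bar>g t\<bar>) < \<infinity>"
    for g :: "(nat \<Rightarrow> real) \<Rightarrow> real"
    by (rule le_less_trans[OF esssup_I[where c = "ennreal \<bar>g (\<lambda>_. undefined)\<bar>"]])
      (auto simp: AE_count_space)
  then show ?thesis
    by (auto simp: L_psi_def Lp_space_def leb_pow_def PiM_empty)
qed

lemma L_psi_norm_empty:
  assumes "1 \<le> p"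
  shows "L_psi_norm D \<psi> p {} g = \<bar>g (\<lambda>_. undefined)\<bar>"
proof (cases "p = \<infinity>")
  case True
  let ?M = "count_space {\<lambda>_::nat. undefined :: real}"
  have le: "esssup ?M (\<lambda>t. ennreal \<bar>g t\<bar>) \<le> ennreal \<bar>g (\<lambda>_. undefined)\<bar>"
    by (intro esssup_I) (auto simp: AE_count_space)
  have ge: "ennreal \<bar>g (\<lambda>_. undefined)\<bar> \<le> esssup ?M (\<lambda>t. ennreal \<bar>g t\<bar>)"
    using esssup_AE[of "\<lambda>t. ennreal \<bar>g t\<bar>" ?M] by (simp add: AE_count_space)
  show ?thesis
    using True antisym[OF le ge] by (simp add: L_psi_norm_def Lp_norm_def leb_pow_def PiM_empty)
next
  case False
  then have "0 < enn2real p"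
    using assms by (metis enn2real_positive_iff less_le_trans top.not_eq_extremum infinity_ennreal_def zero_less_one)
  with False show ?thesis
    by (simp add: L_psi_norm_def Lp_norm_def leb_pow_def PiM_empty
        lebesgue_integral_count_space_finite powr_powr)
qed

definition F_space :: "real set \<Rightarrow> (real \<Rightarrow> real) \<Rightarrow> kind \<Rightarrow> ennreal \<Rightarrow> nat \<Rightarrow> nat set \<Rightarrow> ((nat \<Rightarrow> real) \<Rightarrow> real) set" where
  "F_space D \<psi> k p d u = T_op D \<psi> k d u ` L_psi D \<psi> p u"

definition active :: "nat \<Rightarrow> (nat set \<Rightarrow> real) \<Rightarrow> nat set set" where
  "active d \<gamma> = {u. u \<subseteq> {1..d} \<and> 0 < \<gamma> u}"

definition W_space ::
    "real set \<Rightarrow> (real \<Rightarrow> real) \<Rightarrow> kind \<Rightarrow> ennreal \<Rightarrow> nat \<Rightarrow> (nat set \<Rightarrow> real) \<Rightarrow> ((nat \<Rightarrow> real) \<Rightarrow> real) set" where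
  "W_space D \<psi> k p d \<gamma> =
     {f. \<exists>h. (\<forall>u\<in>active d \<gamma>. h u \<in> F_space D \<psi> k p d u) \<and>
             f = (\<lambda>x\<in>cube D d. \<Sum>u\<in>active d \<gamma>. h u x)}"

definition lq_norm :: "ennreal \<Rightarrow> 'i set \<Rightarrow> ('i \<Rightarrow> real) \<Rightarrow> real" where
  "lq_norm q I a =
     (if q = \<infinity> then Max ((\<lambda>i. \<bar>a i\<bar>) ` I)
      else (\<Sum>i\<in>I. \<bar>a i\<bar> powr enn2real q) powr (1 / enn2real q))"

text \<open>The description below is definite because the operators \<^const>\<open>T_op\<close> are one-to-one
  (modulo equality almost everywhere) and the sum of the spaces \<^const>\<open>F_space\<close> is direct.\<close>

definition W_norm ::
    "real set \<Rightarrow> (real \<Rightarrow> real) \<Rightarrow> kind \<Rightarrow> ennreal \<Rightarrow> ennreal \<Rightarrow> nat \<Rightarrow> (nat set \<Rightarrow> real) \<Rightarrow> ((nat \<Rightarrow> real) \<Rightarrow> real) \<Rightarrow> real" where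
  "W_norm D \<psi> k p q d \<gamma> f =
     (THE n. \<exists>g. (\<forall>u\<in>active d \<gamma>. g u \<in> L_psi D \<psi> p u) \<and>
                 f = (\<lambda>x\<in>cube D d. \<Sum>u\<in>active d \<gamma>. T_op D \<psi> k d u (g u) x) \<and>
                 n = lq_norm q (active d \<gamma>) (\<lambda>u. L_psi_norm D \<psi> p u (g u) / \<gamma> u))"

text \<open>Operator norm of \<open>L\<close> from \<open>(V, nV)\<close> to \<open>(W, nW)\<close>. It lives in \<^typ>\<open>ennreal\<close>, with value \<open>\<infinity>\<close>
  for an unbounded \<open>L\<close> and for an \<open>L\<close> that does not map \<open>V\<close> into \<open>W\<close>. The zero vector contributes
  \<open>0 / 0 = 0\<close> to the supremum.\<close>

definition op_norm :: "'a set \<Rightarrow> ('a \<Rightarrow> real) \<Rightarrow> 'b set \<Rightarrow> ('b \<Rightarrow> real) \<Rightarrow> ('a \<Rightarrow> 'b) \<Rightarrow> ennreal" where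
  "op_norm V nV W nW L =
     (if L ` V \<subseteq> W then (SUP v\<in>V. ennreal (nW (L v) / nV v)) else \<infinity>)"

definition iota_norm ::
    "real set \<Rightarrow> (real \<Rightarrow> real) \<Rightarrow> ennreal \<Rightarrow> ennreal \<Rightarrow> nat \<Rightarrow> (nat set \<Rightarrow> real) \<Rightarrow> ennreal" where
  "iota_norm D \<psi> p q d \<gamma> =
     op_norm (W_space D \<psi> ANOVA p d \<gamma>) (W_norm D \<psi> ANOVA p q d \<gamma>)
             (W_space D \<psi> Anchored p d \<gamma>) (W_norm D \<psi> Anchored p q d \<gamma>) id"

text \<open>In the following, \<open>\<gamma> d\<close> is the family of weights for dimension \<open>d \<ge> 1\<close>. As
  \<^const>\<open>enn2real\<close> sends \<open>\<infinity>\<close> to \<open>0\<close>, finiteness of the operator norms is required separately.\<close>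

definition iota_norm_bigo ::
    "real set \<Rightarrow> (real \<Rightarrow> real) \<Rightarrow> ennreal \<Rightarrow> ennreal \<Rightarrow> (nat \<Rightarrow> nat set \<Rightarrow> real) \<Rightarrow> real \<Rightarrow> bool" where
  "iota_norm_bigo D \<psi> p q \<gamma> \<tau> \<longleftrightarrow>
     (\<forall>d\<ge>1. iota_norm D \<psi> p q d (\<gamma> d) < \<infinity>) \<and>
     (\<lambda>d. enn2real (iota_norm D \<psi> p q d (\<gamma> d))) \<in> O(\<lambda>d. real d powr \<tau>)"

definition uniformly_equivalent ::
    "real set \<Rightarrow> (real \<Rightarrow> real) \<Rightarrow> ennreal \<Rightarrow> ennreal \<Rightarrow> (nat \<Rightarrow> nat set \<Rightarrow> real) \<Rightarrow> bool" where
  "uniformly_equivalent D \<psi> p q \<gamma> \<longleftrightarrow> (SUP d\<in>{1..}. iota_norm D \<psi> p q d (\<gamma> d)) < \<infinity>"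

definition polynomially_equivalent ::
    "real set \<Rightarrow> (real \<Rightarrow> real) \<Rightarrow> ennreal \<Rightarrow> ennreal \<Rightarrow> (nat \<Rightarrow> nat set \<Rightarrow> real) \<Rightarrow> bool" where
  "polynomially_equivalent D \<psi> p q \<gamma> \<longleftrightarrow> (\<exists>\<tau>>0. iota_norm_bigo D \<psi> p q \<gamma> \<tau>)"

definition poly_equiv_exponent ::
    "real set \<Rightarrow> (real \<Rightarrow> real) \<Rightarrow> ennreal \<Rightarrow> ennreal \<Rightarrow> (nat \<Rightarrow> nat set \<Rightarrow> real) \<Rightarrow> real" where
  "poly_equiv_exponent D \<psi> p q \<gamma> = Inf {\<tau>. 0 < \<tau> \<and> iota_norm_bigo D \<psi> p q \<gamma> \<tau>}"

end

(* Expanding the product of the factors 1_[0,x)(t) - psi_bar(t) turns an ANOVA representation (g_w)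
   into the anchored one h_u = sum over w >= u of (-1)^|w-u| * integral of g_w * prod psi_bar over
   the variables in w - u. Since psi_bar <= m * psi almost everywhere and psi is a probability
   density, each integration costs at most a factor m in every L_{p,psi} norm. Hence the identity is
   dominated by a nonnegative matrix indexed by the sets of size at most r whose column sums are
   bounded in d and whose row sums are O(d^r); interpolation gives O(d^(r(1-1/q))). For the lower
   bound take g_w = 1 for all |w| = r: the (d choose r) contributions to h_{} have the same sign.

   All integrals are rewritten over powers of the probability measure psi(t) dt, with kernels divided
   by psi; condition (I) for p = 1 says precisely that these kernels are essentially bounded. *)

theory Submission
  imports Defs "HOL-Probability.Probability"
begin

section \<open>Norm bounds in weighted Lebesgue spaces\<close>

text \<open>\<open>W_norm\<close> is a definite description, so no norm can be computed before
  representations are known to be unique up to null sets. For the anchored kernels this rests on two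
  facts: a kernel vanishes once a coordinate in its index set is 0, so inserting zeros isolates one
  set \<open>u\<close>; and in one variable an integrable function orthogonal to all
  \<open>\<kappa> x\<close> with rational \<open>x\<close> in \<open>D\<close> is null. For the
  ANOVA kernels the passage to anchored components is triangular with respect to inclusion, with the
  identity on the diagonal, so uniqueness is inherited by working down from the largest sets.
  Rational endpoints are used because the exceptional null set depends on \<open>x\<close>, and only
  countably many may be united when variables are separated one at a time. The kernels divided by
  \<open>\<psi>\<close> are truncated at their essential bounds; the bounds then hold at every point
  and pass to products without discussing null sets. A quotient with denominator 0 counts as 0 in
  the operator norm, so the lower bound must also show that the ANOVA norm of the test function is
  positive; this follows from the upper bound.\<close>

lemma convex_on_abs_powr:
  assumes "1 \<le> p"
  shows "convex_on UNIV (\<lambda>x::real. \<bar>x\<bar> powr p)"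
proof (rule convex_onI)
  fix s x y :: real assume s: "0 < s" "s < 1"
  \<comment> \<open>Covers the case where one endpoint is zero; for two nonzero endpoints convexity
    of \<open>powr\<close> is applied to the absolute values.\<close>
  have small: "(c * \<bar>z\<bar>) powr p \<le> c * \<bar>z\<bar> powr p" if "0 < c" "c < 1" for c z :: real
  proof -
    have "c powr p \<le> c powr 1" using that assms by (intro powr_mono') auto
    then show ?thesis using that by (simp add: powr_mult mult_right_mono)
  qed
  have "\<bar>(1 - s) *\<^sub>R x + s *\<^sub>R y\<bar> powr p \<le> ((1 - s) * \<bar>x\<bar> + s * \<bar>y\<bar>) powr p"
  proof (rule powr_mono2)
    show "\<bar>(1 - s) *\<^sub>R x + s *\<^sub>R y\<bar> \<le> (1 - s) * \<bar>x\<bar> + s * \<bar>y\<bar>"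
      using abs_triangle_ineq[of "(1 - s) * x" "s * y"] s by (simp add: abs_mult)
  qed (use assms in auto)
  also have "\<dots> \<le> (1 - s) * \<bar>x\<bar> powr p + s * \<bar>y\<bar> powr p"
  proof (cases "x = 0 \<or> y = 0")
    case True
    then show ?thesis using small[of "1 - s" x] small[of s y] s by auto
  next
    case False
    then show ?thesis
      using convex_onD[OF powr_convex[OF assms], of s "\<bar>x\<bar>" "\<bar>y\<bar>"] s by auto
  qed
  finally show "\<bar>(1 - s) *\<^sub>R x + s *\<^sub>R y\<bar> powr p \<le> (1 - s) * \<bar>x\<bar> powr p + s * \<bar>y\<bar> powr p" .
qed simp

text \<open>Jensen's inequality in a form that asks for no integrability: if \<open>X\<close> is not
  integrable its Bochner integral is 0 by convention, and if the right-hand side is infinite nothing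
  is claimed.\<close>

lemma (in prob_space) abs_expectation_powr_le:
  assumes "1 \<le> p" and [measurable]: "X \<in> borel_measurable M"
  shows "ennreal (\<bar>expectation X\<bar> powr p) \<le> (\<integral>\<^sup>+t. ennreal (\<bar>X t\<bar> powr p) \<partial>M)"
proof (cases "integrable M X \<and> (\<integral>\<^sup>+t. ennreal (\<bar>X t\<bar> powr p) \<partial>M) < \<infinity>")
  case True
  then have int: "integrable M (\<lambda>t. \<bar>X t\<bar> powr p)"
    by (auto simp: integrable_iff_bounded)
  have "\<bar>expectation X\<bar> powr p \<le> expectation (\<lambda>t. \<bar>X t\<bar> powr p)"
    by (rule jensens_inequality[where I = UNIV]) (use True int convex_on_abs_powr[OF assms(1)] in auto)
  then show ?thesis
    using int by (simp add: nn_integral_eq_integral)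
next
  case False
  show ?thesis
  proof (cases "integrable M X")
    case True
    with False have "(\<integral>\<^sup>+t. ennreal (\<bar>X t\<bar> powr p) \<partial>M) = \<top>"
      by (metis infinity_ennreal_def top.not_eq_extremum)
    then show ?thesis by simp
  qed (use assms(1) in \<open>simp add: not_integrable_integral_eq\<close>)
qed

text \<open>Expresses that the norm of \<open>g\<close> is at most \<open>b\<close> for both kinds
  of exponent, without taking a p-th root. Since the bound is finite it also contains membership in
  the space, so one predicate carries integrability and estimate together.\<close>

definition Lp_bound :: "'a measure \<Rightarrow> ennreal \<Rightarrow> ('a \<Rightarrow> real) \<Rightarrow> real \<Rightarrow> bool" where
  "Lp_bound M p g b \<longleftrightarrow> g \<in> borel_measurable M \<and>
     (if p = \<infinity> then AE t in M. \<bar>g t\<bar> \<le> b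
      else (\<integral>\<^sup>+t. ennreal (\<bar>g t\<bar> powr enn2real p) \<partial>M) \<le> ennreal (b powr enn2real p))"

lemma enn2real_ge_1: "1 \<le> p \<Longrightarrow> p \<noteq> \<infinity> \<Longrightarrow> 1 \<le> enn2real p"
  by (cases p) (auto simp: ennreal_ge_1)

lemma Lp_bound_mono:
  assumes "Lp_bound M p g b" "0 \<le> b" "b \<le> c"
  shows "Lp_bound M p g c"
proof (cases "p = \<infinity>")
  case True
  then show ?thesis using assms by (auto simp: Lp_bound_def elim!: AE_mp)
next
  case False
  have "ennreal (b powr enn2real p) \<le> ennreal (c powr enn2real p)"
    using assms by (intro ennreal_leI powr_mono2) auto
  moreover have "(\<integral>\<^sup>+t. ennreal (\<bar>g t\<bar> powr enn2real p) \<partial>M) \<le> ennreal (b powr enn2real p)"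
    using assms False by (simp add: Lp_bound_def)
  ultimately have "(\<integral>\<^sup>+t. ennreal (\<bar>g t\<bar> powr enn2real p) \<partial>M) \<le> ennreal (c powr enn2real p)"
    by (rule order_trans[rotated])
  then show ?thesis using assms(1) False by (simp add: Lp_bound_def)
qed

lemma Lp_bound_cong_AE:
  assumes "AE t in M. g t = h t" "h \<in> borel_measurable M" "Lp_bound M p g b"
  shows "Lp_bound M p h b"
proof (cases "p = \<infinity>")
  case True
  then show ?thesis using assms by (auto simp: Lp_bound_def elim: AE_mp)
next
  case False
  have "(\<integral>\<^sup>+t. ennreal (\<bar>g t\<bar> powr enn2real p) \<partial>M) = (\<integral>\<^sup>+t. ennreal (\<bar>h t\<bar> powr enn2real p) \<partial>M)"
    by (rule nn_integral_cong_AE) (use assms(1) in auto)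
  then show ?thesis using assms False by (auto simp: Lp_bound_def)
qed

lemma Lp_bound_cmult:
  assumes "Lp_bound M p g b" "0 \<le> b"
  shows "Lp_bound M p (\<lambda>t. c * g t) (\<bar>c\<bar> * b)"
proof -
  have [measurable]: "g \<in> borel_measurable M" using assms by (simp add: Lp_bound_def)
  show ?thesis
  proof (cases "p = \<infinity>")
    case True
    then show ?thesis using assms
      by (auto simp: Lp_bound_def abs_mult intro!: mult_left_mono elim!: AE_mp)
  next
    case False
    have "(\<integral>\<^sup>+t. ennreal (\<bar>c * g t\<bar> powr enn2real p) \<partial>M)
        = ennreal (\<bar>c\<bar> powr enn2real p) * (\<integral>\<^sup>+t. ennreal (\<bar>g t\<bar> powr enn2real p) \<partial>M)"
      by (simp add: abs_mult powr_mult ennreal_mult nn_integral_cmult)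
    also have "\<dots> \<le> ennreal (\<bar>c\<bar> powr enn2real p) * ennreal (b powr enn2real p)"
      using assms False by (intro mult_left_mono) (auto simp: Lp_bound_def)
    also have "\<dots> = ennreal ((\<bar>c\<bar> * b) powr enn2real p)"
      using assms by (simp add: powr_mult ennreal_mult)
    finally show ?thesis using False by (simp add: Lp_bound_def)
  qed
qed

text \<open>Lets estimates be proved first for strictly positive constants, where division is
  possible. The slack runs through \<open>1 / real (Suc n)\<close>, a countable family, so the
  exceptional sets for p = \<infinity> can be united.\<close>

lemma Lp_bound_limit:
  assumes "\<And>e. 0 < e \<Longrightarrow> Lp_bound M p g (b + e)" "0 \<le> b" "1 \<le> p"
  shows "Lp_bound M p g b"
proof (cases "p = \<infinity>")
  case True
  have "AE t in M. \<forall>n. \<bar>g t\<bar> \<le> b + 1 / real (Suc n)"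
    using assms True by (auto simp: AE_all_countable Lp_bound_def)
  then have "AE t in M. \<bar>g t\<bar> \<le> b"
  proof eventually_elim
    case (elim t)
    have "(\<lambda>n. b + 1 / real (Suc n)) \<longlonglongrightarrow> b + 0"
      by (intro tendsto_add tendsto_const LIMSEQ_Suc[OF lim_1_over_n])
    from LIMSEQ_le_const[OF this] elim show ?case by auto
  qed
  then show ?thesis using assms(1)[of 1] True by (auto simp: Lp_bound_def)
next
  case False
  let ?p = "enn2real p"
  have "(\<lambda>n. ennreal ((b + 1 / real (Suc n)) powr ?p)) \<longlonglongrightarrow> ennreal ((b + 0) powr ?p)"
    using enn2real_ge_1[OF assms(3) False] assms(2)
    by (intro tendsto_ennrealI tendsto_powr' tendsto_add tendsto_const LIMSEQ_Suc[OF lim_1_over_n])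
       (auto intro!: always_eventually)
  from LIMSEQ_le_const[OF this, of "\<integral>\<^sup>+t. ennreal (\<bar>g t\<bar> powr ?p) \<partial>M"]
  show ?thesis using assms(1)[of "1 / real (Suc _)"] assms(1)[of 1] False
    by (auto simp: Lp_bound_def)
qed

text \<open>Minkowski's inequality by convexity: for positive bounds,
  \<open>(g + h) / (b + c)\<close> is the convex combination of \<open>g / b\<close> and
  \<open>h / c\<close> with weights \<open>b / (b + c)\<close> and \<open>c / (b + c)\<close>, and
  both functions have norm at most 1. Zero bounds are reached by splitting a slack \<open>e\<close>
  between the two.\<close>

lemma Lp_bound_add:
  assumes "1 \<le> p" "Lp_bound M p g b" "Lp_bound M p h c" "0 \<le> b" "0 \<le> c"
  shows "Lp_bound M p (\<lambda>t. g t + h t) (b + c)"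
proof (cases "p = \<infinity>")
  case True
  have "AE t in M. \<bar>g t\<bar> \<le> b" "AE t in M. \<bar>h t\<bar> \<le> c" using assms True by (auto simp: Lp_bound_def)
  then have "AE t in M. \<bar>g t + h t\<bar> \<le> b + c" by eventually_elim linarith
  then show ?thesis using assms True by (auto simp: Lp_bound_def)
next
  case False
  let ?p = "enn2real p"
  have p: "1 \<le> ?p" using False assms by (intro enn2real_ge_1)
  have [measurable]: "g \<in> borel_measurable M" "h \<in> borel_measurable M"
    using assms by (auto simp: Lp_bound_def)
  have pos: "Lp_bound M p (\<lambda>t. g t + h t) (b + c)"
    if b: "0 < b" and c: "0 < c" and g: "Lp_bound M p g b" and h: "Lp_bound M p h c" for b c
  proof -
    let ?s = "c / (b + c)"
    have s: "0 \<le> ?s" "?s \<le> 1" "1 - ?s = b / (b + c)" using b c by (auto simp: field_simps)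
    have pw: "\<bar>g t + h t\<bar> powr ?p \<le> (b + c) powr ?p *
        (b / (b + c) * b powr - ?p * \<bar>g t\<bar> powr ?p + c / (b + c) * c powr - ?p * \<bar>h t\<bar> powr ?p)" for t
    proof -
      have "\<bar>g t + h t\<bar> powr ?p = (b + c) powr ?p * (\<bar>(1 - ?s) *\<^sub>R (g t / b) + ?s *\<^sub>R (h t / c)\<bar> powr ?p)"
      proof -
        have "(1 - ?s) *\<^sub>R (g t / b) + ?s *\<^sub>R (h t / c) = (g t + h t) / (b + c)"
          using b c unfolding s(3) by (simp add: add_divide_distrib)
        then show ?thesis using b c by (simp add: powr_mult[symmetric])
      qed
      also have "\<dots> \<le> (b + c) powr ?p * ((1 - ?s) * \<bar>g t / b\<bar> powr ?p + ?s * \<bar>h t / c\<bar> powr ?p)"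
        by (intro mult_left_mono convex_onD[OF convex_on_abs_powr[OF p]] s) auto
      also have "\<dots> = (b + c) powr ?p *
        (b / (b + c) * b powr - ?p * \<bar>g t\<bar> powr ?p + c / (b + c) * c powr - ?p * \<bar>h t\<bar> powr ?p)"
        using b c unfolding s(3) by (simp add: powr_divide powr_minus_divide)
      finally show ?thesis .
    qed
    have "(\<integral>\<^sup>+t. ennreal (\<bar>g t + h t\<bar> powr ?p) \<partial>M) \<le> (\<integral>\<^sup>+t. ennreal ((b + c) powr ?p *
        (b / (b + c) * b powr - ?p * \<bar>g t\<bar> powr ?p + c / (b + c) * c powr - ?p * \<bar>h t\<bar> powr ?p)) \<partial>M)"
      by (intro nn_integral_mono ennreal_leI pw)
    also have "\<dots> = ennreal ((b + c) powr ?p) * (ennreal (b / (b + c) * b powr - ?p) * (\<integral>\<^sup>+t. ennreal (\<bar>g t\<bar> powr ?p) \<partial>M)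
        + ennreal (c / (b + c) * c powr - ?p) * (\<integral>\<^sup>+t. ennreal (\<bar>h t\<bar> powr ?p) \<partial>M))"
    proof -
      define \<alpha> \<beta> where "\<alpha> = b / (b + c) * b powr - ?p" and "\<beta> = c / (b + c) * c powr - ?p"
      then have "0 \<le> \<alpha>" "0 \<le> \<beta>" using b c by auto
      then show ?thesis unfolding \<alpha>_def[symmetric] \<beta>_def[symmetric]
        by (simp add: ennreal_mult nn_integral_cmult nn_integral_add)
    qed
    also have "\<dots> \<le> ennreal ((b + c) powr ?p) * (ennreal (b / (b + c) * b powr - ?p) * ennreal (b powr ?p)
        + ennreal (c / (b + c) * c powr - ?p) * ennreal (c powr ?p))"
      using g h False by (intro mult_left_mono add_mono) (auto simp: Lp_bound_def)
    also have "\<dots> = ennreal ((b + c) powr ?p * (b / (b + c) * (b powr - ?p * b powr ?p) + c / (b + c) * (c powr - ?p * c powr ?p)))"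
    proof -
      define \<alpha> \<beta> where "\<alpha> = b / (b + c)" and "\<beta> = c / (b + c)"
      then have "0 \<le> \<alpha>" "0 \<le> \<beta>" using b c by auto
      then show ?thesis unfolding \<alpha>_def[symmetric] \<beta>_def[symmetric]
        by (simp add: ennreal_mult[symmetric] ennreal_plus[symmetric] mult.assoc del: ennreal_plus)
    qed
    also have "(b + c) powr ?p * (b / (b + c) * (b powr - ?p * b powr ?p) + c / (b + c) * (c powr - ?p * c powr ?p)) = (b + c) powr ?p"
      using b c by (simp add: powr_add[symmetric] add_divide_distrib[symmetric])
    finally show ?thesis using False by (simp add: Lp_bound_def)
  qed
  show ?thesis
  proof (rule Lp_bound_limit)
    fix e :: real assume "0 < e"
    then have "Lp_bound M p (\<lambda>t. g t + h t) ((b + e / 2) + (c + e / 2))"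
      using assms
      by (intro pos Lp_bound_mono[OF \<open>Lp_bound M p g b\<close>] Lp_bound_mono[OF \<open>Lp_bound M p h c\<close>]) auto
    then show "Lp_bound M p (\<lambda>t. g t + h t) (b + c + e)" by (simp add: algebra_simps)
  qed (use assms in auto)
qed

lemma Lp_bound_zero: "1 \<le> p \<Longrightarrow> Lp_bound M p (\<lambda>_. 0) 0"
  by (auto simp: Lp_bound_def)

lemma Lp_bound_sum:
  assumes "1 \<le> p" "finite I" "\<And>i. i \<in> I \<Longrightarrow> Lp_bound M p (g i) (b i)" "\<And>i. i \<in> I \<Longrightarrow> 0 \<le> b i"
  shows "Lp_bound M p (\<lambda>t. \<Sum>i\<in>I. g i t) (\<Sum>i\<in>I. b i)"
  using assms(2-)
proof (induction I)
  case empty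
  then show ?case using Lp_bound_zero[OF assms(1)] by simp
next
  case (insert i I)
  then show ?case
    by (simp, intro Lp_bound_add assms(1) insert sum_nonneg) auto
qed

text \<open>For finite p, \<open>\<bar>g t\<bar>\<close> is at most 1 plus its p-th power, and the
  constant 1 has a finite integral over a probability space.\<close>

lemma (in prob_space) Lp_bound_integrable:
  assumes "1 \<le> p" "Lp_bound M p g b"
  shows "integrable M g"
proof (cases "p = \<infinity>")
  case True
  then show ?thesis using assms
    by (intro integrable_const_bound[of _ b]) (auto simp: Lp_bound_def)
next
  case False
  let ?p = "enn2real p"
  have p: "1 \<le> ?p" using False assms by (intro enn2real_ge_1)
  have [measurable]: "g \<in> borel_measurable M" using assms by (auto simp: Lp_bound_def)
  have "(\<integral>\<^sup>+t. ennreal (norm (g t)) \<partial>M) \<le> (\<integral>\<^sup>+t. 1 + ennreal (\<bar>g t\<bar> powr ?p) \<partial>M)"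
  proof (rule nn_integral_mono)
    fix t
    have "\<bar>g t\<bar> \<le> 1 + \<bar>g t\<bar> powr ?p"
    proof (cases "\<bar>g t\<bar> \<le> 1")
      case False
      then have "\<bar>g t\<bar> powr 1 \<le> \<bar>g t\<bar> powr ?p" using p by (intro powr_mono) auto
      then show ?thesis using False by simp
    qed (simp add: add_increasing2)
    then show "ennreal (norm (g t)) \<le> 1 + ennreal (\<bar>g t\<bar> powr ?p)"
      by (simp add: ennreal_plus[symmetric] ennreal_1[symmetric] del: ennreal_plus ennreal_1)
  qed
  also have "\<dots> = 1 + (\<integral>\<^sup>+t. ennreal (\<bar>g t\<bar> powr ?p) \<partial>M)"
    by (simp add: nn_integral_add emeasure_space_1)
  also have "\<dots> < \<infinity>" using assms False
    by (auto simp: Lp_bound_def ennreal_add_less_top intro: le_less_trans)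
  finally show ?thesis by (auto simp: integrable_iff_bounded)
qed

section \<open>Weighted norms and the measure with density \<open>w\<close>\<close>

context
  fixes M N :: "'a measure" and w :: "'a \<Rightarrow> real" and p :: ennreal
  assumes w [measurable]: "w \<in> borel_measurable M"
    and w_nonneg: "\<And>t. t \<in> space M \<Longrightarrow> 0 \<le> w t"
    and w_pos: "AE t in M. 0 < w t"
    and N: "N = density M w" and p: "1 \<le> p"
begin

text \<open>As \<open>w\<close> is positive almost everywhere, \<open>M\<close> and \<open>N\<close>
  have the same null sets. Hence the essential supremum, which ignores the weight, can be bounded
  over \<open>N\<close> as well.\<close>

lemma AE_density_pos: "(AE t in N. Q t) \<longleftrightarrow> (AE t in M. Q t)"
proof -
  have "(AE t in N. Q t) \<longleftrightarrow> (AE t in M. 0 < w t \<longrightarrow> Q t)"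
    unfolding N by (subst AE_density) auto
  also have "\<dots> \<longleftrightarrow> (AE t in M. Q t)"
    using w_pos by (auto elim: AE_mp)
  finally show ?thesis .
qed

lemma nn_integral_powr_density:
  assumes [measurable]: "g \<in> borel_measurable M"
  shows "(\<integral>\<^sup>+t. ennreal (\<bar>g t\<bar> powr q) \<partial>N) = (\<integral>\<^sup>+t. ennreal (\<bar>g t\<bar> powr q * w t) \<partial>M)"
  unfolding N using w_nonneg
  by (subst nn_integral_density) (auto intro!: nn_integral_cong simp: ennreal_mult mult.commute)

lemma Lp_bound_Lp_norm:
  assumes "g \<in> Lp_space M w p"
  shows "Lp_bound N p g (Lp_norm M w p g)"
proof -
  have g [measurable]: "g \<in> borel_measurable M" using assms by (simp add: Lp_space_def)
  have gN: "g \<in> borel_measurable N" by (simp add: N)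
  show ?thesis
  proof (cases "p = \<infinity>")
    case True
    let ?c = "esssup M (\<lambda>t. ennreal \<bar>g t\<bar>)"
    have fin: "?c < \<infinity>" using assms True by (simp add: Lp_space_def)
    have "AE t in M. ennreal \<bar>g t\<bar> \<le> ?c" by (rule esssup_AE)
    then have "AE t in M. \<bar>g t\<bar> \<le> enn2real ?c"
      by eventually_elim (use fin in \<open>auto simp: enn2real_mono le_ennreal_iff dest: enn2real_mono\<close>)
    then show ?thesis using gN True by (auto simp: Lp_bound_def Lp_norm_def AE_density_pos)
  next
    case False
    let ?p = "enn2real p"
    have p: "1 \<le> ?p" using False p by (intro enn2real_ge_1)
    have int: "integrable M (\<lambda>t. \<bar>g t\<bar> powr ?p * w t)" using assms False by (simp add: Lp_space_def)
    have nn: "AE t in M. 0 \<le> \<bar>g t\<bar> powr ?p * w t" using w_nonneg by (intro AE_I2) auto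
    have "(\<integral>\<^sup>+t. ennreal (\<bar>g t\<bar> powr ?p) \<partial>N) = ennreal (LINT t|M. \<bar>g t\<bar> powr ?p * w t)"
      unfolding nn_integral_powr_density[OF g] by (rule nn_integral_eq_integral[OF int nn])
    also have "\<dots> = ennreal (Lp_norm M w p g powr ?p)"
      using False p integral_nonneg_AE[OF nn] by (simp add: Lp_norm_def powr_powr)
    finally show ?thesis using gN False by (simp add: Lp_bound_def)
  qed
qed

lemma Lp_bound_imp_Lp_space:
  assumes "Lp_bound N p g b"
  shows "g \<in> Lp_space M w p"
proof -
  have gN: "g \<in> borel_measurable N" using assms by (simp add: Lp_bound_def)
  then have g [measurable]: "g \<in> borel_measurable M" by (simp add: N)
  show ?thesis
  proof (cases "p = \<infinity>")
    case True
    then have "AE t in M. ennreal \<bar>g t\<bar> \<le> ennreal b"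
      using assms by (auto simp: Lp_bound_def AE_density_pos elim!: AE_mp intro: ennreal_leI)
    then have "esssup M (\<lambda>t. ennreal \<bar>g t\<bar>) \<le> ennreal b" by (intro esssup_I) auto
    then show ?thesis using True by (auto simp: Lp_space_def intro: le_less_trans)
  next
    case False
    have "(\<integral>\<^sup>+t. ennreal (norm (\<bar>g t\<bar> powr enn2real p * w t)) \<partial>M) = (\<integral>\<^sup>+t. ennreal (\<bar>g t\<bar> powr enn2real p) \<partial>N)"
      unfolding nn_integral_powr_density[OF g] using w_nonneg by (intro nn_integral_cong) auto
    also have "\<dots> < \<infinity>" using assms False by (auto simp: Lp_bound_def intro: le_less_trans)
    finally show ?thesis using False by (auto simp: Lp_space_def integrable_iff_bounded)
  qed
qed

lemma Lp_norm_nonneg: "0 \<le> Lp_norm M w p g"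
  by (simp add: Lp_norm_def)

lemma Lp_norm_le:
  assumes "Lp_bound N p g b" "0 \<le> b"
  shows "Lp_norm M w p g \<le> b"
proof -
  have gN: "g \<in> borel_measurable N" using assms by (simp add: Lp_bound_def)
  then have g [measurable]: "g \<in> borel_measurable M" by (simp add: N)
  show ?thesis
  proof (cases "p = \<infinity>")
    case True
    then have "AE t in M. ennreal \<bar>g t\<bar> \<le> ennreal b"
      using assms by (auto simp: Lp_bound_def AE_density_pos elim!: AE_mp intro: ennreal_leI)
    then have "esssup M (\<lambda>t. ennreal \<bar>g t\<bar>) \<le> ennreal b" by (intro esssup_I) auto
    then show ?thesis using True assms by (auto simp: Lp_norm_def intro: enn2real_leI)
  next
    case False
    let ?p = "enn2real p"
    have p: "1 \<le> ?p" using False p by (intro enn2real_ge_1)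
    have sp: "g \<in> Lp_space M w p" using Lp_bound_imp_Lp_space[OF assms(1)] .
    have int: "integrable M (\<lambda>t. \<bar>g t\<bar> powr ?p * w t)" using sp False by (simp add: Lp_space_def)
    have nn: "AE t in M. 0 \<le> \<bar>g t\<bar> powr ?p * w t" using w_nonneg by (intro AE_I2) auto
    have "ennreal (LINT t|M. \<bar>g t\<bar> powr ?p * w t) = (\<integral>\<^sup>+t. ennreal (\<bar>g t\<bar> powr ?p) \<partial>N)"
      unfolding nn_integral_powr_density[OF g] by (rule nn_integral_eq_integral[OF int nn, symmetric])
    also have "\<dots> \<le> ennreal (b powr ?p)" using assms False by (simp add: Lp_bound_def)
    finally have "(LINT t|M. \<bar>g t\<bar> powr ?p * w t) \<le> b powr ?p" by (simp add: ennreal_le_iff)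
    then have "(LINT t|M. \<bar>g t\<bar> powr ?p * w t) powr (1 / ?p) \<le> (b powr ?p) powr (1 / ?p)"
      using integral_nonneg_AE[OF nn] p by (intro powr_mono2) auto
    then show ?thesis using False p assms by (simp add: Lp_norm_def powr_powr)
  qed
qed

lemma Lp_norm_cong_AE:
  assumes "AE t in N. g t = h t" "g \<in> Lp_space M w p" "h \<in> Lp_space M w p"
  shows "Lp_norm M w p g = Lp_norm M w p h"
proof (rule antisym)
  have gm: "g \<in> borel_measurable N" "h \<in> borel_measurable N" using assms by (auto simp: Lp_space_def N)
  show "Lp_norm M w p g \<le> Lp_norm M w p h"
    using assms gm by (intro Lp_norm_le Lp_norm_nonneg Lp_bound_cong_AE[OF _ _ Lp_bound_Lp_norm, of h]) (auto elim: AE_mp)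
  show "Lp_norm M w p h \<le> Lp_norm M w p g"
    using assms gm by (intro Lp_norm_le Lp_norm_nonneg Lp_bound_cong_AE[OF _ _ Lp_bound_Lp_norm, of g]) auto
qed

end

section \<open>Product kernels over a probability space\<close>

lemma integrable_mult_bounded:
  fixes f g :: "'a \<Rightarrow> real"
  assumes "integrable M g" "f \<in> borel_measurable M" "\<And>t. t \<in> space M \<Longrightarrow> \<bar>f t\<bar> \<le> B"
  shows "integrable M (\<lambda>t. g t * f t)"
proof (rule Bochner_Integration.integrable_bound)
  show "integrable M (\<lambda>t. \<bar>B\<bar> * g t)" using assms by simp
  show "(\<lambda>t. g t * f t) \<in> borel_measurable M" using assms by simp
  have "\<bar>g t\<bar> * \<bar>f t\<bar> \<le> \<bar>B\<bar> * \<bar>g t\<bar>" if "t \<in> space M" for t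
    using assms(3)[OF that] mult_right_mono[of "\<bar>f t\<bar>" "\<bar>B\<bar>" "\<bar>g t\<bar>"] by (simp add: mult.commute)
  then show "AE t in M. norm (g t * f t) \<le> norm (\<bar>B\<bar> * g t)"
    by (intro AE_I2) (auto simp: abs_mult)
qed

text \<open>Abstract form of the problem: \<open>\<phi>\<close> stands for psi_bar divided by psi
  and \<open>\<kappa> x\<close> for the indicator of [0,x) divided by psi. Bounds are demanded at
  every point so that products inherit them; \<open>Q\<close> is countable so that null sets
  belonging to different points of \<open>Q\<close> can be united.\<close>

locale kernel_setting = prob_space P for P :: "real measure" +
  fixes \<phi> :: "real \<Rightarrow> real" and m :: real and \<kappa> :: "real \<Rightarrow> real \<Rightarrow> real" and D Q :: "real set"
  assumes \<phi>_measurable [measurable]: "\<phi> \<in> borel_measurable P"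
    and \<phi>_nonneg: "\<And>t. 0 \<le> \<phi> t" and \<phi>_le: "\<And>t. \<phi> t \<le> m"
    and m_ge_1: "1 \<le> m"
    and \<kappa>_measurable [measurable]: "\<And>x. \<kappa> x \<in> borel_measurable P"
    and \<kappa>_bounded: "\<And>x. \<exists>B. \<forall>t. \<bar>\<kappa> x t\<bar> \<le> B"
    and \<kappa>_zero: "\<And>t. \<kappa> 0 t = 0"
    and zero_in_D: "0 \<in> D" and Q_subset: "Q \<subseteq> D" and Q_countable: "countable Q"
    and separating: "\<And>h. integrable P h \<Longrightarrow> (\<And>x. x \<in> Q \<Longrightarrow> (\<integral>t. h t * \<kappa> x t \<partial>P) = 0) \<Longrightarrow> AE t in P. h t = 0"
begin

abbreviation PP :: "nat set \<Rightarrow> (nat \<Rightarrow> real) measure" where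
  "PP u \<equiv> PiM u (\<lambda>_. P)"

sublocale PP: product_prob_space "\<lambda>_::nat. P"
  by unfold_locales

lemma prob_space_PP: "prob_space (PP u)"
  by (intro prob_space_PiM prob_space_axioms)

lemma pair_prob_space_PP: "pair_prob_space (PP u) (PP v)"
  by (simp add: pair_prob_space_def pair_sigma_finite_def prob_space_PP prob_space_imp_sigma_finite)

lemma m_nonneg: "0 \<le> m"
  using m_ge_1 by simp

definition TK :: "nat set \<Rightarrow> ((nat \<Rightarrow> real) \<Rightarrow> real) \<Rightarrow> (nat \<Rightarrow> real) \<Rightarrow> real" where
  "TK u g x = (\<integral>t. g t * (\<Prod>j\<in>u. \<kappa> (x j) (t j)) \<partial>PP u)"

definition TA :: "nat set \<Rightarrow> ((nat \<Rightarrow> real) \<Rightarrow> real) \<Rightarrow> (nat \<Rightarrow> real) \<Rightarrow> real" where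
  "TA u g x = (\<integral>t. g t * (\<Prod>j\<in>u. \<kappa> (x j) (t j) - \<phi> (t j)) \<partial>PP u)"

text \<open>The anchored component on \<open>u\<close> contributed by a function \<open>g\<close> on
  \<open>w\<close>, up to the sign \<open>(-1) ^ card (w - u)\<close>, which enters in
  \<open>anova_to_anchored\<close>.\<close>

definition marg :: "nat set \<Rightarrow> nat set \<Rightarrow> ((nat \<Rightarrow> real) \<Rightarrow> real) \<Rightarrow> (nat \<Rightarrow> real) \<Rightarrow> real" where
  "marg w u g s = (\<integral>t. g (merge u (w - u) (s, t)) * (\<Prod>j\<in>w - u. \<phi> (t j)) \<partial>PP (w - u))"

lemma measurable_prod_kernel [measurable]:
  "(\<lambda>t. \<Prod>j\<in>v. \<phi> (t j)) \<in> borel_measurable (PP v)"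
  "(\<lambda>t. \<Prod>j\<in>v. \<kappa> (x j) (t j)) \<in> borel_measurable (PP v)"
  "(\<lambda>t. \<Prod>j\<in>v. \<kappa> (x j) (t j) - \<phi> (t j)) \<in> borel_measurable (PP v)"
  by (intro borel_measurable_prod; measurable)+

lemma measurable_prod_subset [measurable]:
  assumes "v \<subseteq> w"
  shows "(\<lambda>t. \<Prod>j\<in>v. \<phi> (t j)) \<in> borel_measurable (PP w)"
    "(\<lambda>t. \<Prod>j\<in>v. \<kappa> (x j) (t j)) \<in> borel_measurable (PP w)"
  using assms by (auto intro!: borel_measurable_prod measurable_compose[OF measurable_component_singleton])

lemma prod_\<phi>_bound: "0 \<le> (\<Prod>j\<in>v. \<phi> (t j))" "(\<Prod>j\<in>v. \<phi> (t j)) \<le> m ^ card v"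
  using \<phi>_nonneg \<phi>_le by (auto intro!: prod_nonneg prod_le_power simp: m_ge_1)

lemma prod_abs_bounded:
  fixes f :: "'i \<Rightarrow> 'b \<Rightarrow> real"
  assumes "\<And>j. j \<in> v \<Longrightarrow> \<exists>B. \<forall>t. \<bar>f j t\<bar> \<le> B"
  shows "\<exists>B. \<forall>t. \<bar>\<Prod>j\<in>v. f j (t j)\<bar> \<le> B"
proof -
  obtain B where B: "\<And>j t. j \<in> v \<Longrightarrow> \<bar>f j t\<bar> \<le> B j" using assms by metis
  have "\<bar>\<Prod>j\<in>v. f j (t j)\<bar> \<le> (\<Prod>j\<in>v. B j)" for t
    unfolding abs_prod by (intro prod_mono) (auto intro: B)
  then show ?thesis by blast
qed

lemma prod_\<kappa>_bounded: "\<exists>B. \<forall>t. \<bar>\<Prod>j\<in>v. \<kappa> (x j) (t j)\<bar> \<le> B"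
  by (rule prod_abs_bounded) (rule \<kappa>_bounded)

lemma prod_\<kappa>_\<phi>_bounded: "\<exists>B. \<forall>t. \<bar>\<Prod>j\<in>v. \<kappa> (x j) (t j) - \<phi> (t j)\<bar> \<le> B"
proof (rule prod_abs_bounded)
  fix j
  obtain B where B: "\<And>t. \<bar>\<kappa> (x j) t\<bar> \<le> B" using \<kappa>_bounded by blast
  have "\<bar>\<kappa> (x j) t - \<phi> t\<bar> \<le> B + m" for t
    using B[of t] \<phi>_nonneg[of t] \<phi>_le[of t] by linarith
  then show "\<exists>B. \<forall>t. \<bar>\<kappa> (x j) t - \<phi> t\<bar> \<le> B" by blast
qed

lemma integrable_TK:
  assumes "integrable (PP u) g"
  shows "integrable (PP u) (\<lambda>t. g t * (\<Prod>j\<in>u. \<kappa> (x j) (t j)))"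
  using prod_\<kappa>_bounded[where v = u and x = x] integrable_mult_bounded[OF assms measurable_prod_kernel(2)] by blast

lemma integrable_TA:
  assumes "integrable (PP u) g"
  shows "integrable (PP u) (\<lambda>t. g t * (\<Prod>j\<in>u. \<kappa> (x j) (t j) - \<phi> (t j)))"
  using prod_\<kappa>_\<phi>_bounded[where v = u and x = x] integrable_mult_bounded[OF assms measurable_prod_kernel(3)] by blast

lemma TK_diff:
  "integrable (PP u) g \<Longrightarrow> integrable (PP u) h \<Longrightarrow> TK u (\<lambda>t. g t - h t) x = TK u g x - TK u h x"
  using integrable_TK[of u g x] integrable_TK[of u h x] by (simp add: TK_def left_diff_distrib)

lemma TA_diff:
  "integrable (PP u) g \<Longrightarrow> integrable (PP u) h \<Longrightarrow> TA u (\<lambda>t. g t - h t) x = TA u g x - TA u h x"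
  using integrable_TA[of u g x] integrable_TA[of u h x] by (simp add: TA_def left_diff_distrib)

lemma TK_sum:
  assumes "\<And>i. i \<in> S \<Longrightarrow> integrable (PP u) (g i)"
  shows "TK u (\<lambda>t. \<Sum>i\<in>S. c i * g i t) x = (\<Sum>i\<in>S. c i * TK u (g i) x)"
proof -
  have "TK u (\<lambda>t. \<Sum>i\<in>S. c i * g i t) x = (\<integral>t. (\<Sum>i\<in>S. c i * (g i t * (\<Prod>j\<in>u. \<kappa> (x j) (t j)))) \<partial>PP u)"
    by (simp add: TK_def sum_distrib_right mult.assoc)
  also have "\<dots> = (\<Sum>i\<in>S. c i * TK u (g i) x)"
    unfolding TK_def using assms integrable_TK by (subst Bochner_Integration.integral_sum) auto
  finally show ?thesis .
qed

lemma TK_cong: "(\<And>j. j \<in> u \<Longrightarrow> x j = y j) \<Longrightarrow> TK u g x = TK u g y"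
  by (simp add: TK_def)

lemma TK_cong_AE:
  assumes "AE t in PP u. g t = h t" "g \<in> borel_measurable (PP u)" "h \<in> borel_measurable (PP u)"
  shows "TK u g x = TK u h x"
  unfolding TK_def by (rule integral_cong_AE) (use assms in auto)

text \<open>The anchoring property. Evaluating a sum of anchored terms at points with many zero
  coordinates therefore isolates single terms.\<close>

lemma TK_zero:
  assumes "j \<in> u" "x j = 0" "finite u"
  shows "TK u g x = 0"
proof -
  have "(\<Prod>j\<in>u. \<kappa> (x j) (t j)) = 0" for t
    using assms \<kappa>_zero by (intro prod_zero bexI[of _ j]) auto
  then show ?thesis by (simp add: TK_def)
qed

lemma marg_measurable:
  assumes "u \<subseteq> w" "g \<in> borel_measurable (PP w)"
  shows "(\<lambda>st. g (merge u (w - u) st)) \<in> borel_measurable (PP u \<Otimes>\<^sub>M PP (w - u))"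
    "marg w u g \<in> borel_measurable (PP u)"
proof -
  interpret V: prob_space "PP (w - u)" by (rule prob_space_PP)
  have eq: "u \<union> (w - u) = w" using assms by auto
  have [measurable]: "merge u (w - u) \<in> PP u \<Otimes>\<^sub>M PP (w - u) \<rightarrow>\<^sub>M PP w"
    using measurable_merge[of u "w - u" "\<lambda>_. P"] using Un_absorb1[OF assms(1)] by simp
  note assms(2)[measurable]
  show 1: "(\<lambda>st. g (merge u (w - u) st)) \<in> borel_measurable (PP u \<Otimes>\<^sub>M PP (w - u))" by measurable
  note 1[measurable]
  show "marg w u g \<in> borel_measurable (PP u)"
    unfolding marg_def by measurable
qed

lemma distr_merge_subset:
  assumes "u \<subseteq> w" "finite w"
  shows "distr (PP u \<Otimes>\<^sub>M PP (w - u)) (PP w) (merge u (w - u)) = PP w"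
proof -
  have eq: "u \<union> (w - u) = w" using assms by auto
  show ?thesis
    using PP.distr_merge[of u "w - u"] assms Un_absorb1[OF assms(1)] by (auto simp: finite_subset)
qed

text \<open>The product of the \<open>\<phi>\<close> is at most \<open>m ^ card (w - u)\<close>, and
  the inner integral is an average over a probability measure. For finite p, Jensen moves the power
  inside and Tonelli reassembles the norm over \<open>PP w\<close>; for p = \<infinity>, the null
  set is carried through \<open>merge\<close> and sliced.\<close>

lemma Lp_bound_marg:
  assumes "u \<subseteq> w" "finite w" "1 \<le> p" "0 \<le> b" "Lp_bound (PP w) p g b"
  shows "Lp_bound (PP u) p (marg w u g) (m ^ card (w - u) * b)"
proof -
  let ?v = "w - u"
  interpret V: prob_space "PP ?v" by (rule prob_space_PP)
  interpret UV: pair_prob_space "PP u" "PP ?v" by (rule pair_prob_space_PP)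
  have g [measurable]: "g \<in> borel_measurable (PP w)" using assms by (simp add: Lp_bound_def)
  note meas [measurable] = marg_measurable[OF assms(1) g]
  have mm [measurable]: "merge u ?v \<in> PP u \<Otimes>\<^sub>M PP ?v \<rightarrow>\<^sub>M PP w"
    using measurable_merge[of u "w - u" "\<lambda>_. P"] Un_absorb1[OF assms(1)] by (simp only: Un_Diff_cancel)
  have le: "\<bar>g z * (\<Prod>j\<in>?v. \<phi> (t j))\<bar> \<le> m ^ card ?v * \<bar>g z\<bar>" for t z
    using prod_\<phi>_bound[where v = ?v and t = t] by (simp add: abs_mult mult.commute mult_left_mono)
  show ?thesis
  proof (cases "p = \<infinity>")
    case True
    have "AE z in distr (PP u \<Otimes>\<^sub>M PP ?v) (PP w) (merge u ?v). \<bar>g z\<bar> \<le> b"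
      unfolding distr_merge_subset[OF assms(1,2)] using assms(5) True by (simp add: Lp_bound_def)
    then have "AE z in PP u \<Otimes>\<^sub>M PP ?v. \<bar>g (merge u ?v z)\<bar> \<le> b"
      by (rule AE_distrD[OF mm])
    then have "AE s in PP u. AE t in PP ?v. \<bar>g (merge u ?v (s, t))\<bar> \<le> b"
      by (rule UV.AE_pair)
    then have "AE s in PP u. \<bar>marg w u g s\<bar> \<le> m ^ card ?v * b"
    proof (rule AE_mp, intro AE_I2 impI)
      fix s assume s: "s \<in> space (PP u)" and ae: "AE t in PP ?v. \<bar>g (merge u ?v (s, t))\<bar> \<le> b"
      let ?X = "\<lambda>t. g (merge u ?v (s, t)) * (\<Prod>j\<in>?v. \<phi> (t j))"
      have [measurable]: "(\<lambda>t. g (merge u ?v (s, t))) \<in> borel_measurable (PP ?v)"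
        using measurable_compose[OF measurable_Pair1'[OF s] meas(1)] by simp
      have X: "AE t in PP ?v. \<bar>?X t\<bar> \<le> m ^ card ?v * b"
        using ae
      proof eventually_elim
        case (elim t)
        have "m ^ card ?v * \<bar>g (merge u ?v (s, t))\<bar> \<le> m ^ card ?v * b"
          using elim m_nonneg by (intro mult_left_mono) auto
        with le show ?case by (rule order_trans)
      qed
      then have int: "integrable (PP ?v) ?X" by (intro V.integrable_const_bound) auto
      have "\<bar>marg w u g s\<bar> \<le> (\<integral>t. \<bar>?X t\<bar> \<partial>PP ?v)" unfolding marg_def by (rule integral_abs_bound)
      also have "\<dots> \<le> (\<integral>t. m ^ card ?v * b \<partial>PP ?v)"
        using int X by (intro integral_mono_AE) auto
      finally show "\<bar>marg w u g s\<bar> \<le> m ^ card ?v * b" by (simp add: V.prob_space)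
    qed
    then show ?thesis using True by (simp add: Lp_bound_def)
  next
    case False
    let ?p = "enn2real p"
    have p: "1 \<le> ?p" using False assms by (intro enn2real_ge_1)
    have "(\<integral>\<^sup>+s. ennreal (\<bar>marg w u g s\<bar> powr ?p) \<partial>PP u)
      \<le> (\<integral>\<^sup>+s. (\<integral>\<^sup>+t. ennreal (\<bar>g (merge u ?v (s, t)) * (\<Prod>j\<in>?v. \<phi> (t j))\<bar> powr ?p) \<partial>PP ?v) \<partial>PP u)"
      unfolding marg_def using p
      by (intro nn_integral_mono V.abs_expectation_powr_le borel_measurable_times
          measurable_compose[OF measurable_Pair1' meas(1)]) measurable
    also have "\<dots> \<le> (\<integral>\<^sup>+s. (\<integral>\<^sup>+t. ennreal ((m ^ card ?v) powr ?p * \<bar>g (merge u ?v (s, t))\<bar> powr ?p) \<partial>PP ?v) \<partial>PP u)"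
    proof (intro nn_integral_mono ennreal_leI)
      fix s t
      have "\<bar>g (merge u ?v (s, t)) * (\<Prod>j\<in>?v. \<phi> (t j))\<bar> powr ?p \<le> (m ^ card ?v * \<bar>g (merge u ?v (s, t))\<bar>) powr ?p"
        using le p by (intro powr_mono2) auto
      then show "\<bar>g (merge u ?v (s, t)) * (\<Prod>j\<in>?v. \<phi> (t j))\<bar> powr ?p
          \<le> (m ^ card ?v) powr ?p * \<bar>g (merge u ?v (s, t))\<bar> powr ?p"
        using m_nonneg by (simp add: powr_mult)
    qed
    also have "\<dots> = (\<integral>\<^sup>+z. ennreal ((m ^ card ?v) powr ?p * \<bar>g (merge u ?v z)\<bar> powr ?p) \<partial>(PP u \<Otimes>\<^sub>M PP ?v))"
      by (subst V.nn_integral_fst[symmetric]) auto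
    also have "\<dots> = ennreal ((m ^ card ?v) powr ?p) * (\<integral>\<^sup>+z. ennreal (\<bar>g (merge u ?v z)\<bar> powr ?p) \<partial>(PP u \<Otimes>\<^sub>M PP ?v))"
      by (simp add: ennreal_mult nn_integral_cmult)
    also have "(\<integral>\<^sup>+z. ennreal (\<bar>g (merge u ?v z)\<bar> powr ?p) \<partial>(PP u \<Otimes>\<^sub>M PP ?v))
        = (\<integral>\<^sup>+z. ennreal (\<bar>g z\<bar> powr ?p) \<partial>distr (PP u \<Otimes>\<^sub>M PP ?v) (PP w) (merge u ?v))"
      by (subst nn_integral_distr) auto
    also have "\<dots> = (\<integral>\<^sup>+z. ennreal (\<bar>g z\<bar> powr ?p) \<partial>PP w)"
      unfolding distr_merge_subset[OF assms(1,2)] ..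
    also have "ennreal ((m ^ card ?v) powr ?p) * \<dots> \<le> ennreal ((m ^ card ?v) powr ?p) * ennreal (b powr ?p)"
      using assms(5) False by (intro mult_left_mono) (auto simp: Lp_bound_def)
    also have "\<dots> = ennreal ((m ^ card ?v * b) powr ?p)"
      using m_nonneg assms by (simp add: powr_mult ennreal_mult)
    finally show ?thesis using False by (simp add: Lp_bound_def)
  qed
qed

text \<open>Integrability is the case p = 1 of the norm estimate for marginals.\<close>

lemma integrable_marg:
  assumes "u \<subseteq> w" "finite w" "integrable (PP w) g"
  shows "integrable (PP u) (marg w u g)"
proof -
  interpret U: prob_space "PP u" by (rule prob_space_PP)
  have "Lp_bound (PP w) 1 g (\<integral>t. \<bar>g t\<bar> \<partial>PP w)"
    using assms by (auto simp: Lp_bound_def nn_integral_eq_integral)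
  then have "Lp_bound (PP u) 1 (marg w u g) (m ^ card (w - u) * (\<integral>t. \<bar>g t\<bar> \<partial>PP w))"
    using assms by (intro Lp_bound_marg) auto
  then show ?thesis by (rule U.Lp_bound_integrable[rotated]) simp
qed

text \<open>Fubini for the splitting of \<open>w\<close> into \<open>u\<close> and
  \<open>w - u\<close>: the factors \<open>\<kappa>\<close> read only coordinates in
  \<open>u\<close> and leave the inner integral.\<close>

lemma TK_marg:
  assumes "u \<subseteq> w" "finite w" "integrable (PP w) g"
  shows "(\<integral>t. g t * ((\<Prod>j\<in>u. \<kappa> (x j) (t j)) * (\<Prod>j\<in>w - u. \<phi> (t j))) \<partial>PP w) = TK u (marg w u g) x"
    and "integrable (PP w) (\<lambda>t. g t * ((\<Prod>j\<in>u. \<kappa> (x j) (t j)) * (\<Prod>j\<in>w - u. \<phi> (t j))))"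
proof -
  let ?f = "\<lambda>t. g t * ((\<Prod>j\<in>u. \<kappa> (x j) (t j)) * (\<Prod>j\<in>w - u. \<phi> (t j)))"
  have eq: "u \<union> (w - u) = w" using assms by auto
  obtain B where B: "\<And>t. \<bar>\<Prod>j\<in>u. \<kappa> (x j) (t j)\<bar> \<le> B" using prod_\<kappa>_bounded[where v = u and x = x] by blast
  then have B0: "0 \<le> B" using order_trans[OF abs_ge_zero] by blast
  show int: "integrable (PP w) ?f"
  proof (rule integrable_mult_bounded[OF assms(3), where B = "B * m ^ card (w - u)"])
    show "(\<lambda>t. (\<Prod>j\<in>u. \<kappa> (x j) (t j)) * (\<Prod>j\<in>w - u. \<phi> (t j))) \<in> borel_measurable (PP w)"
      using assms(1) by (intro borel_measurable_times measurable_prod_subset) auto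
    show "\<bar>(\<Prod>j\<in>u. \<kappa> (x j) (t j)) * (\<Prod>j\<in>w - u. \<phi> (t j))\<bar> \<le> B * m ^ card (w - u)" for t
      unfolding abs_mult using B prod_\<phi>_bound[where v = "w - u" and t = t] B0 by (intro mult_mono) auto
  qed
  have "integral\<^sup>L (PP w) ?f = (\<integral>s. (\<integral>t. ?f (merge u (w - u) (s, t)) \<partial>PP (w - u)) \<partial>PP u)"
    using PP.product_integral_fold[of u "w - u" ?f] int assms finite_subset[OF assms(1)] unfolding eq by auto
  also have "\<dots> = TK u (marg w u g) x"
    unfolding TK_def marg_def
  proof (rule Bochner_Integration.integral_cong[OF refl])
    fix s
    show "(\<integral>t. ?f (merge u (w - u) (s, t)) \<partial>PP (w - u)) =
      (\<integral>t. g (merge u (w - u) (s, t)) * (\<Prod>j\<in>w - u. \<phi> (t j)) \<partial>PP (w - u)) * (\<Prod>j\<in>u. \<kappa> (x j) (s j))"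
      unfolding integral_mult_left_zero[symmetric]
      by (intro Bochner_Integration.integral_cong refl) simp
  qed
  finally show "integral\<^sup>L (PP w) ?f = TK u (marg w u g) x" .
qed

lemma TA_expand:
  assumes "finite w" "integrable (PP w) g"
  shows "TA w g x = (\<Sum>u\<in>Pow w. (-1) ^ card (w - u) * TK u (marg w u g) x)"
proof -
  have "(\<Prod>j\<in>w. \<kappa> (x j) (t j) - \<phi> (t j))
      = (\<Sum>u\<in>Pow w. (-1) ^ card (w - u) * ((\<Prod>j\<in>u. \<kappa> (x j) (t j)) * (\<Prod>j\<in>w - u. \<phi> (t j))))" for t
    using prod_add[OF assms(1), of "\<lambda>j. \<kappa> (x j) (t j)" "\<lambda>j. - \<phi> (t j)"]
    by (simp add: prod_uminus mult_ac)
  then have "TA w g x = (\<integral>t. (\<Sum>u\<in>Pow w. (-1) ^ card (w - u) *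
      (g t * ((\<Prod>j\<in>u. \<kappa> (x j) (t j)) * (\<Prod>j\<in>w - u. \<phi> (t j))))) \<partial>PP w)"
    by (simp add: TA_def sum_distrib_left mult.left_commute)
  also have "\<dots> = (\<Sum>u\<in>Pow w. (-1) ^ card (w - u) * TK u (marg w u g) x)"
    using assms TK_marg by (subst Bochner_Integration.integral_sum) auto
  finally show ?thesis .
qed

text \<open>Injectivity of the anchored operator, splitting off one variable \<open>i\<close>. For
  fixed \<open>x\<close> on \<open>u\<close>, the value of \<open>TK u\<close> at \<open>x\<close>
  on the slice \<open>i := y\<close>, as a function of \<open>y\<close>, is orthogonal to every
  \<open>\<kappa> y0\<close> with \<open>y0\<close> in \<open>Q\<close>, hence null. There are only
  countably many such \<open>x\<close>, so for almost every \<open>y\<close> all these values vanish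
  at once and the induction hypothesis applies to the slice.\<close>

lemma AE_TK_zero:
  assumes "finite u" "integrable (PP u) h"
    and "\<And>x. x \<in> u \<rightarrow>\<^sub>E Q \<Longrightarrow> TK u h x = 0"
  shows "AE t in PP u. h t = 0"
  using assms
proof (induction u arbitrary: h)
  case empty
  have "TK {} h (\<lambda>_. undefined) = 0" by (rule empty.prems) simp
  then have "h (\<lambda>_. undefined) = 0"
    by (simp add: TK_def PiM_empty lebesgue_integral_count_space_finite)
  then show ?case unfolding PiM_empty AE_count_space by simp
next
  case (insert i u)
  let ?f = "\<lambda>(y, s). s(i := y)"
  interpret U: prob_space "PP u" by (rule prob_space_PP)
  interpret PU: pair_prob_space P "PP u"
    by (simp add: pair_prob_space_def pair_sigma_finite_def prob_space_PP prob_space_axioms prob_space_imp_sigma_finite)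
  have distr: "distr (P \<Otimes>\<^sub>M PP u) (PP (insert i u)) ?f = PP (insert i u)"
    by (rule distr_pair_PiM_eq_PiM) (auto intro: prob_space_axioms)
  have [measurable]: "?f \<in> P \<Otimes>\<^sub>M PP u \<rightarrow>\<^sub>M PP (insert i u)" by measurable
  note h [measurable] = borel_measurable_integrable[OF insert.prems(1)]
  have int: "integrable (P \<Otimes>\<^sub>M PP u) (\<lambda>z. h (?f z))"
    using insert.prems(1) integrable_distr[of ?f "P \<Otimes>\<^sub>M PP u" "PP (insert i u)" h] unfolding distr by simp
  have slice: "AE y in P. TK u (\<lambda>s. h (s(i := y))) x = 0" if x: "x \<in> u \<rightarrow>\<^sub>E Q" for x
  proof -
    obtain B where B: "\<And>t. \<bar>\<Prod>j\<in>u. \<kappa> (x j) (t j)\<bar> \<le> B" using prod_\<kappa>_bounded[where v = u and x = x] by blast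
    have intx: "integrable (P \<Otimes>\<^sub>M PP u) (\<lambda>z. h (?f z) * (\<Prod>j\<in>u. \<kappa> (x j) (snd z j)))"
      by (rule integrable_mult_bounded[OF int _ B]) measurable
    have F_int: "integrable P (\<lambda>y. TK u (\<lambda>s. h (s(i := y))) x)"
      using PU.integrable_fst'[OF intx] by (simp add: TK_def)
    show ?thesis
    proof (rule separating[OF F_int])
      fix y0 assume "y0 \<in> Q"
      then have xy: "x(i := y0) \<in> insert i u \<rightarrow>\<^sub>E Q" using x by (auto simp: PiE_iff extensional_def)
      have px: "(\<Prod>j\<in>insert i u. \<kappa> ((x(i := y0)) j) ((s(i := y)) j)) = (\<Prod>j\<in>u. \<kappa> (x j) (s j)) * \<kappa> y0 y" for s y
      proof -
        have "(\<Prod>j\<in>u. \<kappa> ((x(i := y0)) j) ((s(i := y)) j)) = (\<Prod>j\<in>u. \<kappa> (x j) (s j))"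
          using insert.hyps by (intro prod.cong) auto
        then show ?thesis using insert.hyps by simp
      qed
      have "0 = TK (insert i u) h (x(i := y0))" using insert.prems(2)[OF xy] by (rule sym)
      also have "\<dots> = (\<integral>z. h z * (\<Prod>j\<in>insert i u. \<kappa> ((x(i := y0)) j) (z j)) \<partial>distr (P \<Otimes>\<^sub>M PP u) (PP (insert i u)) ?f)"
        unfolding distr TK_def ..
      also have "\<dots> = (\<integral>z. h (?f z) * (\<Prod>j\<in>insert i u. \<kappa> ((x(i := y0)) j) (?f z j)) \<partial>(P \<Otimes>\<^sub>M PP u))"
        by (subst integral_distr) auto
      also have "\<dots> = (\<integral>z. h (?f z) * (\<Prod>j\<in>u. \<kappa> (x j) (snd z j)) * \<kappa> y0 (fst z) \<partial>(P \<Otimes>\<^sub>M PP u))"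
        by (intro Bochner_Integration.integral_cong refl) (auto simp: px simp del: prod.insert fun_upd_apply)
      also have "\<dots> = (\<integral>y. (\<integral>s. h (?f (y, s)) * (\<Prod>j\<in>u. \<kappa> (x j) (s j)) * \<kappa> y0 y \<partial>PP u) \<partial>P)"
      proof -
        obtain C where "\<And>t. \<bar>\<kappa> y0 t\<bar> \<le> C" using \<kappa>_bounded by blast
        then have "integrable (P \<Otimes>\<^sub>M PP u) (\<lambda>z. h (?f z) * (\<Prod>j\<in>u. \<kappa> (x j) (snd z j)) * \<kappa> y0 (fst z))"
          by (intro integrable_mult_bounded[OF intx]) auto
        from PU.integral_fst'[OF this] show ?thesis by simp
      qed
      also have "\<dots> = (\<integral>y. TK u (\<lambda>s. h (s(i := y))) x * \<kappa> y0 y \<partial>P)"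
        by (simp add: TK_def)
      finally show "(\<integral>y. TK u (\<lambda>s. h (s(i := y))) x * \<kappa> y0 y \<partial>P) = 0" by simp
    qed
  qed
  have "AE y in P. \<forall>x\<in>u \<rightarrow>\<^sub>E Q. TK u (\<lambda>s. h (s(i := y))) x = 0"
    using slice Q_countable insert.hyps by (subst AE_ball_countable) (auto intro: countable_PiE)
  moreover have "AE y in P. integrable (PP u) (\<lambda>s. h (s(i := y)))"
    using PU.AE_integrable_fst'[OF int] by simp
  ultimately have "AE y in P. AE s in PP u. h (s(i := y)) = 0"
    by eventually_elim (rule insert.IH; blast)
  then have "AE z in P \<Otimes>\<^sub>M PP u. h (?f z) = 0"
    by (intro PU.AE_pair_measure) (auto split: prod.split)
  then have "AE z in distr (P \<Otimes>\<^sub>M PP u) (PP (insert i u)) ?f. h z = 0"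
    by (subst AE_distr_iff) auto
  then show ?case unfolding distr .
qed

lemma sum_TK_unique:
  assumes A: "A \<subseteq> Pow {1..d}"
    and int: "\<And>u. u \<in> A \<Longrightarrow> integrable (PP u) (h u)"
    and eq: "\<And>x. x \<in> {1..d} \<rightarrow>\<^sub>E D \<Longrightarrow> (\<Sum>u\<in>A. TK u (h u) x) = 0"
    and "u \<in> A"
  shows "AE t in PP u. h u t = 0"
  using \<open>u \<in> A\<close>
proof (induction "card u" arbitrary: u rule: less_induct)
  case less
  have fin: "finite v" if "v \<in> A" for v using that A finite_subset by blast
  have finA: "finite A" by (rule finite_subset[OF A]) simp
  show ?case
  proof (rule AE_TK_zero)
    fix x assume x: "x \<in> u \<rightarrow>\<^sub>E Q"
    \<comment> \<open>Extending \<open>x\<close> by zeros kills every term whose index set is not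
      contained in \<open>u\<close>. Proper subsets of \<open>u\<close> carry null functions by
      induction on the cardinality, so only the term of \<open>u\<close> remains.\<close>
    define y where "y = (\<lambda>j\<in>{1..d}. if j \<in> u then x j else 0)"
    have y: "y \<in> {1..d} \<rightarrow>\<^sub>E D" using x Q_subset zero_in_D by (auto simp: y_def PiE_iff)
    have zero: "TK v (h v) y = 0" if "v \<in> A" "v \<noteq> u" for v
    proof (cases "v \<subseteq> u")
      case True
      then have "card v < card u" using that fin[OF less.prems] by (intro psubset_card_mono) auto
      then have "AE t in PP v. h v t = 0" using less.hyps that by blast
      then have "TK v (h v) y = TK v (\<lambda>_. 0) y"
        using int[OF \<open>v \<in> A\<close>] by (intro TK_cong_AE) auto
      then show ?thesis by (simp add: TK_def)
    next
      case False
      then obtain j where "j \<in> v" "j \<notin> u" by auto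
      moreover have "j \<in> {1..d}" using \<open>j \<in> v\<close> \<open>v \<in> A\<close> A by blast
      ultimately have "y j = 0" using \<open>v \<in> A\<close> A by (auto simp: y_def subset_eq)
      with TK_zero[of j v y] show ?thesis using fin[OF \<open>v \<in> A\<close>] \<open>j \<in> v\<close> by blast
    qed
    have "(\<Sum>v\<in>A. TK v (h v) y) = TK u (h u) y"
      using sum.remove[OF finA less.prems, of "\<lambda>v. TK v (h v) y"] zero by simp
    moreover have "TK u (h u) x = TK u (h u) y"
      using less.prems A by (intro TK_cong) (auto simp: y_def subset_eq)
    ultimately show "TK u (h u) x = 0" using eq[OF y] by simp
  qed (use fin int less.prems in auto)
qed

definition anova_to_anchored :: "nat set set \<Rightarrow> (nat set \<Rightarrow> (nat \<Rightarrow> real) \<Rightarrow> real) \<Rightarrow> nat set \<Rightarrow> (nat \<Rightarrow> real) \<Rightarrow> real" where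
  "anova_to_anchored A g u t = (\<Sum>w\<in>{w \<in> A. u \<subseteq> w}. (-1) ^ card (w - u) * marg w u (g w) t)"

lemma integrable_anova_to_anchored:
  assumes "A \<subseteq> Pow {1..d}" "\<And>w. w \<in> A \<Longrightarrow> integrable (PP w) (g w)"
  shows "integrable (PP u) (anova_to_anchored A g u)"
  unfolding anova_to_anchored_def using assms finite_subset
  by (intro Bochner_Integration.integrable_sum integrable_mult_right integrable_marg) blast+

lemma sum_TA_eq_sum_TK:
  assumes A: "A \<subseteq> Pow {1..d}" "\<And>u w. w \<in> A \<Longrightarrow> u \<subseteq> w \<Longrightarrow> u \<in> A"
    and int: "\<And>w. w \<in> A \<Longrightarrow> integrable (PP w) (g w)"
  shows "(\<Sum>w\<in>A. TA w (g w) x) = (\<Sum>u\<in>A. TK u (anova_to_anchored A g u) x)"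
proof -
  have fin: "finite v" if "v \<in> A" for v using that A(1) finite_subset by blast
  have finA: "finite A" by (rule finite_subset[OF A(1)]) simp
  have "(\<Sum>w\<in>A. TA w (g w) x) = (\<Sum>w\<in>A. \<Sum>u\<in>Pow w. (-1) ^ card (w - u) * TK u (marg w u (g w)) x)"
    using fin int by (intro sum.cong refl TA_expand) auto
  \<comment> \<open>Closure of \<open>A\<close> under subsets enters here: every
    \<open>u \<subseteq> w\<close> is again an index in \<open>A\<close>, so the anchored side uses
    the same index sets.\<close>
  also have "\<dots> = (\<Sum>w\<in>A. \<Sum>u\<in>{u \<in> A. u \<subseteq> w}. (-1) ^ card (w - u) * TK u (marg w u (g w)) x)"
    using A(2) by (intro sum.cong refl) auto
  also have "\<dots> = (\<Sum>u\<in>A. \<Sum>w\<in>{w \<in> A. u \<subseteq> w}. (-1) ^ card (w - u) * TK u (marg w u (g w)) x)"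
    by (rule sum.swap_restrict[OF finA finA])
  also have "\<dots> = (\<Sum>u\<in>A. TK u (anova_to_anchored A g u) x)"
  proof (rule sum.cong[OF refl])
    fix u
    show "(\<Sum>w\<in>{w \<in> A. u \<subseteq> w}. (-1) ^ card (w - u) * TK u (marg w u (g w)) x) = TK u (anova_to_anchored A g u) x"
      unfolding anova_to_anchored_def[abs_def] using fin int
      by (intro TK_sum[where c = "\<lambda>w. (-1) ^ card (w - u)" and g = "\<lambda>w. marg w u (g w)", symmetric]
          integrable_marg) auto
  qed
  finally show ?thesis .
qed

text \<open>The diagonal of the conversion is the identity. The point \<open>t\<close> must lie in
  the product space because \<open>merge\<close> returns \<open>undefined\<close> outside
  \<open>u\<close>.\<close>

lemma marg_self:
  assumes "t \<in> space (PP u)"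
  shows "marg u u g t = g t"
proof -
  have "merge u {} (t, s) = t" for s
    using assms by (auto simp: merge_def space_PiM PiE_def extensional_def)
  then show ?thesis
    by (simp add: marg_def PiM_empty lebesgue_integral_count_space_finite)
qed

text \<open>The norm estimate for marginals with p = \<infinity> and bound 0.\<close>

lemma marg_AE_zero:
  assumes "u \<subseteq> w" "finite w" "AE t in PP w. g t = 0" "g \<in> borel_measurable (PP w)"
  shows "AE t in PP u. marg w u g t = 0"
proof -
  have "Lp_bound (PP w) \<infinity> g 0" using assms by (auto simp: Lp_bound_def elim: AE_mp)
  then have "Lp_bound (PP u) \<infinity> (marg w u g) (m ^ card (w - u) * 0)"
    using assms by (intro Lp_bound_marg) auto
  then show ?thesis by (auto simp: Lp_bound_def)
qed

text \<open>The anchored component on \<open>u\<close> involves only supersets of \<open>u\<close>.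
  Induction downwards from the largest sets makes the strict supersets vanish, so that component is
  \<open>g u\<close> itself, and it is null by uniqueness for the anchored kernels.\<close>

lemma sum_TA_unique:
  assumes A: "A \<subseteq> Pow {1..d}" "\<And>u w. w \<in> A \<Longrightarrow> u \<subseteq> w \<Longrightarrow> u \<in> A"
    and int: "\<And>w. w \<in> A \<Longrightarrow> integrable (PP w) (g w)"
    and eq: "\<And>x. x \<in> {1..d} \<rightarrow>\<^sub>E D \<Longrightarrow> (\<Sum>w\<in>A. TA w (g w) x) = 0"
    and "u \<in> A"
  shows "AE t in PP u. g u t = 0"
  using \<open>u \<in> A\<close>
proof (induction "d - card u" arbitrary: u rule: less_induct)
  case less
  have fin: "finite v" if "v \<in> A" for v using that A(1) finite_subset by blast
  have finA: "finite A" by (rule finite_subset[OF A(1)]) simp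
  have "AE t in PP u. anova_to_anchored A g u t = 0"
  proof (rule sum_TK_unique[OF A(1) integrable_anova_to_anchored[OF A(1) int] _ less.prems])
    fix x assume "x \<in> {1..d} \<rightarrow>\<^sub>E D"
    from eq[OF this] show "(\<Sum>u\<in>A. TK u (anova_to_anchored A g u) x) = 0"
      using sum_TA_eq_sum_TK[of A d g x] A int by simp
  qed
  moreover have "AE t in PP u. \<forall>w\<in>{w \<in> A. u \<subset> w}. marg w u (g w) t = 0"
  proof (rule AE_finite_allI)
    fix w assume w: "w \<in> {w \<in> A. u \<subset> w}"
    then have "card u < card w" "card w \<le> d"
      using fin A(1) card_mono[of "{1..d}" w] by (auto intro: psubset_card_mono)
    then have "AE t in PP w. g w t = 0" using w by (intro less.hyps) auto
    then show "AE t in PP u. marg w u (g w) t = 0"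
      using w fin int by (intro marg_AE_zero) auto
  qed (use finA in auto)
  moreover have "AE t in PP u. t \<in> space (PP u)" by (rule AE_space)
  ultimately show ?case
  proof eventually_elim
    case (elim t)
    have "{w \<in> A. u \<subseteq> w} = insert u {w \<in> A. u \<subset> w}" using less.prems by auto
    then have "anova_to_anchored A g u t = marg u u (g u) t"
      unfolding anova_to_anchored_def using elim finA by (simp add: sum.neutral)
    then show ?case using elim marg_self by simp
  qed
qed

end

section \<open>Matrix bounds and product measures\<close>

text \<open>Jensen's inequality with equal weights \<open>1 / card S\<close>. The factor
  \<open>card S powr (q - 1)\<close> is what later turns row counts into the exponent 1 -
  1/q.\<close>

lemma sum_powr_le:
  fixes a :: "'i \<Rightarrow> real"
  assumes "finite S" "1 \<le> q" "\<And>i. i \<in> S \<Longrightarrow> 0 \<le> a i"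
  shows "(\<Sum>i\<in>S. a i) powr q \<le> real (card S) powr (q - 1) * (\<Sum>i\<in>S. a i powr q)"
proof (cases "S = {}")
  case False
  let ?n = "real (card S)"
  have n: "0 < ?n" using assms False by (simp add: card_gt_0_iff)
  have "\<bar>\<Sum>i\<in>S. (1 / ?n) *\<^sub>R a i\<bar> powr q \<le> (\<Sum>i\<in>S. (1 / ?n) * \<bar>a i\<bar> powr q)"
    by (rule convex_on_sum[OF assms(1) False convex_on_abs_powr[OF assms(2)]]) (use n in auto)
  then have "((\<Sum>i\<in>S. a i) / ?n) powr q \<le> (\<Sum>i\<in>S. a i powr q) / ?n"
    using assms by (simp add: sum_divide_distrib[symmetric] sum_nonneg)
  then have "?n powr q * ((\<Sum>i\<in>S. a i) / ?n) powr q \<le> ?n powr q * ((\<Sum>i\<in>S. a i powr q) / ?n)"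
    by (intro mult_left_mono) auto
  moreover have "?n powr q * ((\<Sum>i\<in>S. a i) / ?n) powr q = (\<Sum>i\<in>S. a i) powr q"
    using n by (simp add: powr_mult[symmetric])
  moreover have "?n powr q * ((\<Sum>i\<in>S. a i powr q) / ?n) = ?n powr (q - 1) * (\<Sum>i\<in>S. a i powr q)"
    using n by (simp add: powr_diff)
  ultimately show ?thesis by simp
qed simp

lemma enn2real_one_div: "1 \<le> q \<Longrightarrow> q \<noteq> \<infinity> \<Longrightarrow> enn2real (1 / q) = 1 / enn2real q"
  by (cases q) (auto simp: ennreal_1[symmetric] divide_ennreal ennreal_ge_1 simp del: ennreal_1)

lemma enn2real_one_div_bounds:
  assumes "1 \<le> q"
  shows "0 \<le> enn2real (1 / q)" "enn2real (1 / q) \<le> 1"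
proof -
  show "enn2real (1 / q) \<le> 1"
  proof (cases "q = \<infinity>")
    case False
    then show ?thesis using enn2real_ge_1[OF assms False] by (simp add: enn2real_one_div[OF assms False])
  qed simp
qed simp

lemma lq_norm_nonneg:
  assumes "finite A" "A \<noteq> {}"
  shows "0 \<le> lq_norm q A a"
proof (cases "q = \<infinity>")
  case True
  obtain i where "i \<in> A" using assms by auto
  then have "\<bar>a i\<bar> \<le> Max ((\<lambda>i. \<bar>a i\<bar>) ` A)" using assms by (intro Max_ge) auto
  then show ?thesis using True by (simp add: lq_norm_def)
qed (simp add: lq_norm_def)

lemma abs_le_lq_norm:
  assumes "finite A" "1 \<le> q" "i \<in> A"
  shows "\<bar>a i\<bar> \<le> lq_norm q A a"
proof (cases "q = \<infinity>")
  case True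
  then show ?thesis using assms by (auto simp: lq_norm_def intro!: Max_ge)
next
  case False
  let ?q = "enn2real q"
  have q: "1 \<le> ?q" using enn2real_ge_1[OF assms(2) False] .
  have "\<bar>a i\<bar> powr ?q \<le> (\<Sum>i\<in>A. \<bar>a i\<bar> powr ?q)"
    using assms by (intro member_le_sum) auto
  then have "(\<bar>a i\<bar> powr ?q) powr (1 / ?q) \<le> (\<Sum>i\<in>A. \<bar>a i\<bar> powr ?q) powr (1 / ?q)"
    using q by (intro powr_mono2) auto
  then show ?thesis using q False by (simp add: lq_norm_def powr_powr)
qed

text \<open>Interpolation between the column-sum bound for \<open>q = 1\<close> and the row-sum bound for \<open>q = \<infinity>\<close>.\<close>

lemma lq_norm_row_col_bound:
  fixes a b :: "'i \<Rightarrow> real"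
  assumes A: "finite A" "A \<noteq> {}" and q: "1 \<le> q" and c: "0 \<le> c" and C: "1 \<le> C" and R: "1 \<le> R"
    and a: "\<And>w. w \<in> A \<Longrightarrow> 0 \<le> a w" and b0: "\<And>u. u \<in> A \<Longrightarrow> 0 \<le> b u"
    and b: "\<And>u. u \<in> A \<Longrightarrow> b u \<le> c * (\<Sum>w\<in>{w \<in> A. E u w}. a w)"
    and row: "\<And>u. u \<in> A \<Longrightarrow> real (card {w \<in> A. E u w}) \<le> R"
    and col: "\<And>w. w \<in> A \<Longrightarrow> real (card {u \<in> A. E u w}) \<le> C"
  shows "lq_norm q A b \<le> c * C * R powr (1 - enn2real (1 / q)) * lq_norm q A a"
proof (cases "q = \<infinity>")
  case True
  let ?N = "Max ((\<lambda>i. \<bar>a i\<bar>) ` A)"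
  have N0: "0 \<le> ?N" using lq_norm_nonneg[OF A, of \<infinity> a] by (simp add: lq_norm_def)
  have "\<bar>b u\<bar> \<le> c * C * R * ?N" if u: "u \<in> A" for u
  proof -
    have "(\<Sum>w\<in>{w \<in> A. E u w}. a w) \<le> (\<Sum>w\<in>{w \<in> A. E u w}. ?N)"
    proof (rule sum_mono)
      fix w assume "w \<in> {w \<in> A. E u w}"
      then have "\<bar>a w\<bar> \<le> ?N" using A by (intro Max_ge) auto
      then show "a w \<le> ?N" by simp
    qed
    also have "\<dots> \<le> R * ?N" using row[OF u] N0 by (simp add: mult_right_mono)
    finally have "b u \<le> c * (R * ?N)" using b[OF u] c by (meson mult_left_mono order_trans)
    \<comment> \<open>For q = \<infinity> the row count alone gives the estimate; the factor
      \<open>C \<ge> 1\<close> is inserted to have one formula for all q.\<close>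
    also have "\<dots> \<le> C * (c * (R * ?N))"
      using C c R N0 mult_right_mono[of 1 C "c * (R * ?N)"] by simp
    finally show ?thesis using b0[OF u] by (simp add: mult_ac)
  qed
  then have "Max ((\<lambda>i. \<bar>b i\<bar>) ` A) \<le> c * C * R * ?N" using A by (intro Max.boundedI) auto
  then show ?thesis using True R by (simp add: lq_norm_def)
next
  case False
  define s where "s = enn2real q"
  have s: "1 \<le> s" unfolding s_def using enn2real_ge_1[OF q False] .
  let ?S = "\<lambda>a. \<Sum>i\<in>A. \<bar>a i\<bar> powr s"
  have "?S b \<le> (\<Sum>u\<in>A. c powr s * (R powr (s - 1) * (\<Sum>w\<in>{w \<in> A. E u w}. a w powr s)))"
  proof (rule sum_mono)
    fix u assume u: "u \<in> A"
    let ?Au = "{w \<in> A. E u w}"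
    have "\<bar>b u\<bar> powr s \<le> (c * (\<Sum>w\<in>?Au. a w)) powr s"
      using b[OF u] b0[OF u] s by (intro powr_mono2) auto
    also have "\<dots> = c powr s * (\<Sum>w\<in>?Au. a w) powr s"
      using c a by (simp add: powr_mult sum_nonneg)
    also have "(\<Sum>w\<in>?Au. a w) powr s \<le> real (card ?Au) powr (s - 1) * (\<Sum>w\<in>?Au. a w powr s)"
      using A a s by (intro sum_powr_le) auto
    also have "\<dots> \<le> R powr (s - 1) * (\<Sum>w\<in>?Au. a w powr s)"
      using row[OF u] s by (intro mult_right_mono powr_mono2 sum_nonneg) auto
    finally show "\<bar>b u\<bar> powr s \<le> c powr s * (R powr (s - 1) * (\<Sum>w\<in>?Au. a w powr s))"
      by (simp add: mult_left_mono)
  qed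
  also have "\<dots> = c powr s * R powr (s - 1) * (\<Sum>u\<in>A. \<Sum>w\<in>{w \<in> A. E u w}. a w powr s)"
    by (simp add: sum_distrib_left mult.assoc)
  \<comment> \<open>The row count has been spent in \<open>R powr (s - 1)\<close>; after exchanging
    the sums, what is left is a column count.\<close>
  also have "(\<Sum>u\<in>A. \<Sum>w\<in>{w \<in> A. E u w}. a w powr s) = (\<Sum>w\<in>A. \<Sum>u\<in>{u \<in> A. E u w}. a w powr s)"
    by (rule sum.swap_restrict) (use A in auto)
  also have "\<dots> \<le> (\<Sum>w\<in>A. C * \<bar>a w\<bar> powr s)"
    using a col by (intro sum_mono) (simp add: mult_right_mono)
  also have "\<dots> = C * ?S a" by (simp add: sum_distrib_left)
  finally have "?S b \<le> c powr s * R powr (s - 1) * (C * ?S a)"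
    by (simp add: mult_left_mono)
  then have "?S b powr (1 / s) \<le> (c powr s * R powr (s - 1) * (C * ?S a)) powr (1 / s)"
    using s by (intro powr_mono2 sum_nonneg) auto
  also have "\<dots> = c * R powr (1 - 1 / s) * (C powr (1 / s) * ?S a powr (1 / s))"
    using s c C R by (simp add: powr_mult powr_powr sum_nonneg diff_divide_distrib)
  also have "\<dots> \<le> c * R powr (1 - 1 / s) * (C * ?S a powr (1 / s))"
  proof -
    \<comment> \<open>As \<open>C \<ge> 1\<close>, the root of the column count may be replaced by
      \<open>C\<close>, so that this factor does not depend on q.\<close>
    have "C powr (1 / s) \<le> C powr 1" using C s by (intro powr_mono) auto
    then show ?thesis using C c by (intro mult_left_mono mult_right_mono) auto
  qed
  finally show ?thesis
    using False enn2real_one_div[OF q False] by (simp add: lq_norm_def s_def mult_ac)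
qed

section \<open>Index sets of bounded cardinality\<close>

definition small_subsets :: "nat \<Rightarrow> nat \<Rightarrow> nat set set" where
  "small_subsets d r = {u. u \<subseteq> {1..d} \<and> card u \<le> r}"

lemma finite_small_subsets: "finite (small_subsets d r)"
  unfolding small_subsets_def by (rule finite_subset[of _ "Pow {1..d}"]) auto

lemma empty_in_small_subsets: "{} \<in> small_subsets d r"
  by (simp add: small_subsets_def)

lemma small_subsets_subset: "w \<in> small_subsets d r \<Longrightarrow> u \<subseteq> w \<Longrightarrow> u \<in> small_subsets d r"
  unfolding small_subsets_def using card_mono[of w u] by (auto dest: finite_subset[OF _ finite_atLeastAtMost])

lemma card_small_subsets_le:
  assumes "1 \<le> d"
  shows "card (small_subsets d r) \<le> Suc r * d ^ r"
proof -
  have "small_subsets d r = (\<Union>k\<in>{..r}. {u. u \<subseteq> {1..d} \<and> card u = k})"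
    by (auto simp: small_subsets_def)
  then have "card (small_subsets d r) \<le> (\<Sum>k\<in>{..r}. card {u. u \<subseteq> {1..d} \<and> card u = k})"
    by (simp add: card_UN_le)
  also have "\<dots> = (\<Sum>k\<in>{..r}. d choose k)" by (simp add: n_subsets)
  also have "\<dots> \<le> (\<Sum>k\<in>{..r}. d ^ r)"
  proof (rule sum_mono)
    fix k assume "k \<in> {..r}"
    have "d choose k \<le> d ^ k" by (cases "k \<le> d") (auto simp: binomial_le_pow binomial_eq_0)
    also have "\<dots> \<le> d ^ r" using \<open>k \<in> {..r}\<close> assms by (intro power_increasing) auto
    finally show "d choose k \<le> d ^ r" .
  qed
  finally show ?thesis by simp
qed

lemma card_subsets_of_small_le:
  assumes "w \<in> small_subsets d r"
  shows "card {u \<in> small_subsets d r. u \<subseteq> w} \<le> 2 ^ r"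
proof -
  have "finite w" using assms finite_subset[OF _ finite_atLeastAtMost] by (auto simp: small_subsets_def)
  then have "card {u \<in> small_subsets d r. u \<subseteq> w} \<le> card (Pow w)" by (intro card_mono) auto
  also have "\<dots> = 2 ^ card w" using \<open>finite w\<close> by (rule card_Pow)
  also have "\<dots> \<le> 2 ^ r" using assms by (intro power_increasing) (auto simp: small_subsets_def)
  finally show ?thesis .
qed

text \<open>The vanishing integrals pass from rational to real half-lines and then to the rays
  \<open>{y<..}\<close>. On these the positive and negative parts of \<open>F\<close> have equal
  finite integrals, so the measures with these densities coincide, and densities are unique almost
  everywhere.\<close>

lemma AE_lborel_zero_if_integrals_lessThan_zero:
  fixes F :: "real \<Rightarrow> real"
  assumes F: "integrable lborel F" and zero: "\<And>y. y \<in> \<rat> \<Longrightarrow> (\<integral>t. F t * indicator {..<y} t \<partial>lborel) = 0"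
  shows "AE t in lborel. F t = 0"
proof -
  note [measurable] = borel_measurable_integrable[OF F]
  have Fint: "integrable lborel (\<lambda>t. F t * indicator S t)" if [measurable]: "S \<in> sets borel" for S
    using that by (intro integrable_mult_bounded[OF F, where B = 1]) (auto simp: indicator_def)
  have zero': "(\<integral>t. F t * indicator {..<y} t \<partial>lborel) = 0" for y
  proof -
    \<comment> \<open>The approximating points lie strictly below \<open>y\<close>; the indicators
      of \<open>{..<z n}\<close> then converge to that of \<open>{..<y}\<close> at every point,
      including \<open>y\<close> itself.\<close>
    have "\<exists>z\<in>\<rat>. y - 1 / real (Suc n) < z \<and> z < y" for n
      by (rule Rats_dense_in_real) simp
    then obtain z where z: "\<And>n. z n \<in> \<rat>" "\<And>n. y - 1 / real (Suc n) < z n" "\<And>n. z n < y" by metis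
    have lim: "z \<longlonglongrightarrow> y"
    proof (rule tendsto_sandwich)
      show "(\<lambda>n. y - 1 / real (Suc n)) \<longlonglongrightarrow> y"
        using tendsto_diff[OF tendsto_const LIMSEQ_Suc[OF lim_1_over_n], of y] by simp
      show "\<forall>\<^sub>F n in sequentially. y - 1 / real (Suc n) \<le> z n" "\<forall>\<^sub>F n in sequentially. z n \<le> y"
        using z(2,3) by (auto intro!: always_eventually less_imp_le simp del: of_nat_Suc)
    qed simp
    have "(\<lambda>n. \<integral>t. F t * indicator {..<z n} t \<partial>lborel) \<longlonglongrightarrow> (\<integral>t. F t * indicator {..<y} t \<partial>lborel)"
    proof (rule integral_dominated_convergence[where w = "\<lambda>t. \<bar>F t\<bar>"])
      show "AE t in lborel. (\<lambda>n. F t * indicator {..<z n} t) \<longlonglongrightarrow> F t * indicator {..<y} t"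
      proof (intro AE_I2 tendsto_mult tendsto_const)
        fix t
        have "eventually (\<lambda>n. (indicator {..<z n} t :: real) = indicator {..<y} t) sequentially"
        proof (cases "t < y")
          case True
          then have "eventually (\<lambda>n. t < z n) sequentially" using lim by (rule order_tendstoD(1)[rotated])
          then show ?thesis by eventually_elim (use True in auto)
        next
          case False
          then have "\<not> t < z n" for n using z(3)[of n] by simp
          then show ?thesis using False by (intro always_eventually) simp
        qed
        then show "(\<lambda>n. indicator {..<z n} t :: real) \<longlonglongrightarrow> indicator {..<y} t" by (rule tendsto_eventually)
      qed
    qed (use F in \<open>auto simp: indicator_def\<close>)
    then have "(\<lambda>n. 0) \<longlonglongrightarrow> (\<integral>t. F t * indicator {..<y} t \<partial>lborel)" using zero[OF z(1)] by simp
    then show ?thesis by (simp add: LIMSEQ_const_iff)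
  qed
  have total: "(\<integral>t. F t \<partial>lborel) = 0"
  proof -
    have "(\<lambda>n. \<integral>t. F t * indicator {..<real n} t \<partial>lborel) \<longlonglongrightarrow> (\<integral>t. F t \<partial>lborel)"
    proof (rule integral_dominated_convergence[where w = "\<lambda>t. \<bar>F t\<bar>"])
      show "AE t in lborel. (\<lambda>n. F t * indicator {..<real n} t) \<longlonglongrightarrow> F t"
      proof (intro AE_I2 tendsto_eventually)
        fix t
        obtain N where "t < real N" using reals_Archimedean2 by blast
        then show "eventually (\<lambda>n. F t * indicator {..<real n} t = F t) sequentially"
          by (auto simp: eventually_sequentially intro!: exI[of _ N])
      qed
    qed (use F in \<open>auto simp: indicator_def\<close>)
    then have "(\<lambda>n. 0) \<longlonglongrightarrow> (\<integral>t. F t \<partial>lborel)" using zero' by simp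
    then show ?thesis by (simp add: LIMSEQ_const_iff)
  qed
  have gt: "(\<integral>t. F t * indicator {y<..} t \<partial>lborel) = 0" for y
  proof -
    have "(\<integral>t. F t * indicator {y<..} t \<partial>lborel) = (\<integral>t. F t - F t * indicator {..<y} t \<partial>lborel)"
    proof (rule integral_cong_AE)
      \<comment> \<open>The two rays together miss only the null set \<open>{y}\<close>.\<close>
      have "AE t in lborel. t \<noteq> y" by (rule AE_lborel_singleton)
      then show "AE t in lborel. F t * indicator {y<..} t = F t - F t * indicator {..<y} t"
        by eventually_elim (auto simp: indicator_def)
    qed measurable
    also have "\<dots> = 0" using F Fint[of "{..<y}"] zero' total by simp
    finally show ?thesis .
  qed
  \<comment> \<open>Stated for a general \<open>G\<close> so that it serves both \<open>F\<close>
    and \<open>- F\<close>.\<close>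
  have em: "emeasure (density lborel (\<lambda>t. ennreal (max 0 (G t)))) {y<..}
      = ennreal (\<integral>t. max 0 (G t) * indicator {y<..} t \<partial>lborel)"
    and emint: "integrable lborel (\<lambda>t. max 0 (G t) * indicator {y<..} t)"
    if G: "integrable lborel G" for G :: "real \<Rightarrow> real" and y
  proof -
    note [measurable] = borel_measurable_integrable[OF G]
    have G': "integrable lborel (\<lambda>t. max 0 (G t))" using G by auto
    show int: "integrable lborel (\<lambda>t. max 0 (G t) * indicator {y<..} t)"
      by (intro integrable_mult_bounded[OF G', where B = 1]) (auto simp: indicator_def)
    have "emeasure (density lborel (\<lambda>t. ennreal (max 0 (G t)))) {y<..}
        = (\<integral>\<^sup>+t. ennreal (max 0 (G t) * indicator {y<..} t) \<partial>lborel)"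
      by (subst emeasure_density) (auto intro!: nn_integral_cong simp: indicator_def)
    also have "\<dots> = ennreal (\<integral>t. max 0 (G t) * indicator {y<..} t \<partial>lborel)"
      by (rule nn_integral_eq_integral[OF int]) (auto simp: indicator_def)
    finally show "emeasure (density lborel (\<lambda>t. ennreal (max 0 (G t)))) {y<..}
      = ennreal (\<integral>t. max 0 (G t) * indicator {y<..} t \<partial>lborel)" .
  qed
  have mF: "integrable lborel (\<lambda>t. - F t)" using F by simp
  have "density lborel (\<lambda>t. ennreal (max 0 (F t))) = density lborel (\<lambda>t. ennreal (max 0 (- F t)))"
  proof (rule measure_eqI_lessThan)
    fix y
    have "(\<integral>t. max 0 (F t) * indicator {y<..} t \<partial>lborel) - (\<integral>t. max 0 (- F t) * indicator {y<..} t \<partial>lborel)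
       = (\<integral>t. max 0 (F t) * indicator {y<..} t - max 0 (- F t) * indicator {y<..} t \<partial>lborel)"
      using emint[OF F] emint[OF mF] by simp
    also have "\<dots> = (\<integral>t. F t * indicator {y<..} t \<partial>lborel)"
      by (intro Bochner_Integration.integral_cong refl) (auto simp: max_def)
    finally show "emeasure (density lborel (\<lambda>t. ennreal (max 0 (F t)))) {y<..}
        = emeasure (density lborel (\<lambda>t. ennreal (max 0 (- F t)))) {y<..}"
      using gt em[OF F] em[OF mF] by simp
    show "emeasure (density lborel (\<lambda>t. ennreal (max 0 (F t)))) {y<..} < \<infinity>"
      using em[OF F] by simp
  qed auto
  then have "AE t in lborel. ennreal (max 0 (F t)) = ennreal (max 0 (- F t))"
    by (subst (asm) sigma_finite_measure.density_unique_iff[OF sigma_finite_lborel]) auto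
  then show ?thesis by eventually_elim (auto simp: max_def split: if_splits)
qed

text \<open>A Lebesgue measurable \<open>F\<close> agrees almost everywhere with a Borel function
  \<open>G\<close>, which has the same half-line integrals.\<close>

lemma AE_lebesgue_zero_if_integrals_lessThan_zero:
  fixes F :: "real \<Rightarrow> real"
  assumes F: "integrable lebesgue F" and zero: "\<And>y. y \<in> \<rat> \<Longrightarrow> (\<integral>t. F t * indicator {..<y} t \<partial>lebesgue) = 0"
  shows "AE t in lebesgue. F t = 0"
proof -
  obtain G where G [measurable]: "G \<in> borel_measurable lborel" and FG: "AE t in lborel. F t = G t"
    using completion_ex_borel_measurable_real[OF borel_measurable_integrable[OF F]] by blast
  have FG': "AE t in lebesgue. F t = G t" using AE_completion[OF FG] .
  have Gm: "G \<in> borel_measurable lebesgue" using measurable_completion[OF G] .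
  have "integrable lebesgue G"
    using F integrable_cong_AE[OF borel_measurable_integrable[OF F] Gm FG'] by simp
  then have Gint: "integrable lborel G" using integrable_completion[OF G] by simp
  have "AE t in lborel. G t = 0"
  proof (rule AE_lborel_zero_if_integrals_lessThan_zero[OF Gint])
    fix y :: real assume "y \<in> \<rat>"
    have [measurable]: "indicator {..<y} \<in> borel_measurable (lebesgue :: real measure)"
      by (intro borel_measurable_indicator) auto
    note [measurable] = borel_measurable_integrable[OF F] Gm
    have "(\<integral>t. G t * indicator {..<y} t \<partial>lborel) = (\<integral>t. G t * indicator {..<y} t \<partial>lebesgue)"
      by (rule integral_completion[symmetric]) measurable
    also have "\<dots> = (\<integral>t. F t * indicator {..<y} t \<partial>lebesgue)"
      by (rule integral_cong_AE) (use FG' in auto)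
    finally show "(\<integral>t. G t * indicator {..<y} t \<partial>lborel) = 0" using zero[OF \<open>y \<in> \<rat>\<close>] by simp
  qed
  then have "AE t in lebesgue. G t = 0" by (rule AE_completion)
  with FG' show ?thesis by eventually_elim simp
qed

section \<open>Null sets and densities of product measures\<close>

lemma (in product_sigma_finite) AE_PiM_component:
  assumes "finite J" "i \<in> J" "AE x in M i. R x"
  shows "AE x in PiM J M. R (x i)"
proof -
  obtain N where N: "{x \<in> space (M i). \<not> R x} \<subseteq> N" "N \<in> sets (M i)" "emeasure (M i) N = 0"
    using assms(3) by (rule AE_E)
  \<comment> \<open>The sides of a box that contains the exceptional set and has one null
    side.\<close>
  let ?S = "\<lambda>j. if j = i then N else space (M j)"
  have S: "?S j \<in> sets (M j)" if "j \<in> J" for j using N by auto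
  have "emeasure (PiM J M) (Pi\<^sub>E J ?S) = (\<Prod>j\<in>J. emeasure (M j) (?S j))"
    by (rule emeasure_PiM) (use assms S in auto)
  also have "\<dots> = 0" using assms N by (intro prod_zero bexI[of _ i]) auto
  finally have "emeasure (PiM J M) (Pi\<^sub>E J ?S) = 0" .
  moreover have "Pi\<^sub>E J ?S \<in> sets (PiM J M)" using assms S by (intro sets_PiM_I_finite) auto
  moreover have "{x \<in> space (PiM J M). \<not> R (x i)} \<subseteq> Pi\<^sub>E J ?S"
    using N(1) assms by (auto simp: space_PiM PiE_iff extensional_def)
  ultimately show ?thesis by (intro AE_I)
qed

text \<open>Both measures agree on boxes, where the integral of the product density factorizes, and
  a product measure is determined by its values on boxes.\<close>

lemma PiM_density:
  fixes w :: "'a \<Rightarrow> real"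
  assumes "sigma_finite_measure M" "prob_space (density M (\<lambda>x. ennreal (w x)))"
    and w [measurable]: "w \<in> borel_measurable M" and nonneg: "\<And>x. x \<in> space M \<Longrightarrow> 0 \<le> w x" and "finite J"
  shows "PiM J (\<lambda>_. density M (\<lambda>x. ennreal (w x))) = density (PiM J (\<lambda>_. M)) (\<lambda>x. ennreal (\<Prod>j\<in>J. w (x j)))"
proof -
  let ?N = "density M (\<lambda>x. ennreal (w x))"
  interpret M: product_sigma_finite "\<lambda>_. M" using assms by (simp add: product_sigma_finite_def)
  interpret N: product_sigma_finite "\<lambda>_. ?N"
    using assms by (simp add: product_sigma_finite_def prob_space_imp_sigma_finite)
  show ?thesis
  proof (rule N.PiM_eqI[OF \<open>finite J\<close>, symmetric])
    show "sets (density (PiM J (\<lambda>_. M)) (\<lambda>x. ennreal (\<Prod>j\<in>J. w (x j)))) = sets (PiM J (\<lambda>_. ?N))"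
      by (auto intro!: sets_PiM_cong)
    fix A assume A: "\<And>i. i \<in> J \<Longrightarrow> A i \<in> sets ?N"
    then have A' [measurable]: "\<And>i. i \<in> J \<Longrightarrow> A i \<in> sets M" by simp
    have PA: "Pi\<^sub>E J A \<in> sets (PiM J (\<lambda>_. M))" using A' \<open>finite J\<close> by (intro sets_PiM_I_finite) auto
    have "emeasure (density (PiM J (\<lambda>_. M)) (\<lambda>x. ennreal (\<Prod>j\<in>J. w (x j)))) (Pi\<^sub>E J A)
        = (\<integral>\<^sup>+x. ennreal (\<Prod>j\<in>J. w (x j)) * indicator (Pi\<^sub>E J A) x \<partial>PiM J (\<lambda>_. M))"
      by (rule emeasure_density) (use PA in \<open>auto intro!: borel_measurable_prod measurable_compose[OF measurable_component_singleton]\<close>)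
    also have "\<dots> = (\<integral>\<^sup>+x. (\<Prod>j\<in>J. ennreal (w (x j)) * indicator (A j) (x j)) \<partial>PiM J (\<lambda>_. M))"
    proof (rule nn_integral_cong)
      fix x assume x: "x \<in> space (PiM J (\<lambda>_. M))"
      then have "(indicator (Pi\<^sub>E J A) x :: ennreal) = (\<Prod>j\<in>J. indicator (A j) (x j))"
        using \<open>finite J\<close> by (auto simp: indicator_def space_PiM PiE_iff prod_zero_iff)
      moreover have "ennreal (\<Prod>j\<in>J. w (x j)) = (\<Prod>j\<in>J. ennreal (w (x j)))"
        using x nonneg by (intro prod_ennreal[symmetric]) (auto simp: space_PiM PiE_iff)
      ultimately show "ennreal (\<Prod>j\<in>J. w (x j)) * indicator (Pi\<^sub>E J A) x
          = (\<Prod>j\<in>J. ennreal (w (x j)) * indicator (A j) (x j))"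
        by (simp add: prod.distrib)
    qed
    also have "\<dots> = (\<Prod>j\<in>J. (\<integral>\<^sup>+y. ennreal (w y) * indicator (A j) y \<partial>M))"
      by (rule M.product_nn_integral_prod[OF \<open>finite J\<close>]) auto
    also have "\<dots> = (\<Prod>j\<in>J. emeasure ?N (A j))"
      by (intro prod.cong refl emeasure_density[symmetric]) auto
    finally show "emeasure (density (PiM J (\<lambda>_. M)) (\<lambda>x. ennreal (\<Prod>j\<in>J. w (x j)))) (Pi\<^sub>E J A)
      = (\<Prod>j\<in>J. emeasure ?N (A j))" .
  qed
qed

section \<open>The kernels of a density on an interval\<close>

lemma conj_index_1: "conj_index 1 = \<infinity>"
  by (simp add: conj_index_def)

lemma conj_index_gt_1:
  assumes "1 < p" "p < \<infinity>"
  shows "conj_index p = ennreal (1 / (1 - 1 / enn2real p))"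
proof -
  obtain r where r: "p = ennreal r" "0 \<le> r" using assms(2) by (cases p) auto
  then have r1: "1 < r" using assms(1) by (simp add: ennreal_1[symmetric] ennreal_less_iff del: ennreal_1)
  have "1 / p = ennreal (1 / r)"
    using r r1 divide_ennreal[of 1 r] by simp
  then have "1 - 1 / p = ennreal (1 - 1 / r)"
    using r1 ennreal_minus[of "1 / r" 1] by simp
  then have "conj_index p = ennreal 1 / ennreal (1 - 1 / r)" by (simp add: conj_index_def)
  also have "\<dots> = ennreal (1 / (1 - 1 / r))"
    using r1 by (intro divide_ennreal) auto
  finally show ?thesis using r by simp
qed

lemma sigma_finite_lebesgue_on:
  fixes S :: "real set"
  assumes "S \<in> sets lebesgue"
  shows "sigma_finite_measure (lebesgue_on S)"
proof (rule sigma_finite_measure_restrict_space[OF _ assms])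
  show "sigma_finite_measure (lebesgue :: real measure)"
  proof
    have "x \<in> (\<Union>n. {- real n..real n})" for x
    proof -
      obtain n where "\<bar>x\<bar> \<le> real n" using real_arch_simple by blast
      then show ?thesis by (auto intro!: exI[of _ n])
    qed
    then show "\<exists>A::real set set. countable A \<and> A \<subseteq> sets lebesgue \<and> \<Union> A = space lebesgue \<and>
        (\<forall>a\<in>A. emeasure lebesgue a \<noteq> \<infinity>)"
      by (intro exI[of _ "range (\<lambda>n. {- real n..real n})"]) auto
  qed
qed

lemma AE_le_enn2real_esssup:
  assumes "esssup M (\<lambda>t. ennreal \<bar>g t\<bar>) < \<infinity>"
  shows "AE t in M. \<bar>g t\<bar> \<le> enn2real (esssup M (\<lambda>t. ennreal \<bar>g t\<bar>))"
proof -
  have "AE t in M. ennreal \<bar>g t\<bar> \<le> esssup M (\<lambda>t. ennreal \<bar>g t\<bar>)" by (rule esssup_AE)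
  then show ?thesis
    by eventually_elim (use assms in \<open>auto dest: enn2real_mono\<close>)
qed

locale anova_domain =
  fixes D :: "real set" and \<psi> :: "real \<Rightarrow> real"
  assumes dom: "domain_interval D" and pdf: "positive_pdf D \<psi>" and cond_1: "integrability_cond D \<psi> 1"
begin

abbreviation \<Lambda> :: "real measure" where "\<Lambda> \<equiv> lebesgue_on D"
abbreviation P :: "real measure" where "P \<equiv> density \<Lambda> (\<lambda>t. ennreal (\<psi> t))"

lemma D_cases:
  obtains (open_right) T :: ereal where "0 < T" "D = {x. 0 \<le> x \<and> ereal x < T}"
  | (closed) T :: real where "0 < T" "D = {0..T}"
  using dom unfolding domain_interval_def by blast

lemma zero_in_D: "0 \<in> D"
  by (cases rule: D_cases) (auto simp: zero_ereal_def)

lemma D_nonneg: "x \<in> D \<Longrightarrow> 0 \<le> x"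
  by (cases rule: D_cases) auto

lemma D_downward: "x \<in> D \<Longrightarrow> 0 \<le> y \<Longrightarrow> y \<le> x \<Longrightarrow> y \<in> D"
  by (cases rule: D_cases) (auto intro: le_less_trans[of "ereal y" "ereal x"])

lemma Ico_subset_D: "x \<in> D \<Longrightarrow> {0..<x} \<subseteq> D"
  using D_downward by auto

lemma D_lebesgue: "D \<in> sets lebesgue"
proof (cases rule: D_cases)
  case (open_right T)
  have "{x. 0 \<le> x \<and> ereal x < T} \<in> sets borel" by measurable
  then show ?thesis using open_right by simp
qed auto

lemma pos_in_D: "\<exists>z\<in>D. 0 < z"
proof (cases rule: D_cases)
  case (open_right T)
  then obtain z where "0 < ereal z" "ereal z < T" using ereal_dense2[of 0 T] by (auto simp: zero_ereal_def)
  then show ?thesis using open_right by (intro bexI[of _ z]) auto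
qed auto

lemma space_\<Lambda>: "space \<Lambda> = D"
  by simp

text \<open>A kernel with endpoint \<open>x\<close> tests a function only on [0,x), so these
  intervals with rational \<open>x\<close> in \<open>D\<close> have to exhaust \<open>D\<close>. If
  \<open>D\<close> is closed, its right endpoint is missed, but that is a null set.\<close>

lemma AE_rational_above: "AE t in \<Lambda>. \<exists>x\<in>D \<inter> \<rat>. t < x"
proof (cases rule: D_cases)
  case (open_right T)
  have "\<exists>x\<in>D \<inter> \<rat>. t < x" if t: "t \<in> D" for t
  proof -
    have "ereal t < T" using t open_right by auto
    then obtain z where z: "ereal t < ereal z" "ereal z < T" using ereal_dense2 by blast
    then obtain x where x: "x \<in> \<rat>" "t < x" "x < z" using Rats_dense_in_real[of t z] by auto
    have "ereal x < T" using x z by (meson ereal_less_eq(3) le_less_trans less_imp_le)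
    then show ?thesis using x D_nonneg[OF t] open_right by (intro bexI[of _ x]) auto
  qed
  then show ?thesis by (intro AE_I2) (simp only: space_\<Lambda>)
next
  case (closed T)
  have "AE t in lebesgue. t \<noteq> T" by (rule AE_completion) (rule AE_lborel_singleton)
  then have "AE t in \<Lambda>. t \<noteq> T"
    using D_lebesgue by (subst AE_restrict_space_iff) auto
  then show ?thesis
  proof (rule AE_mp, intro AE_I2 impI)
    fix t assume "t \<in> space \<Lambda>" "t \<noteq> T"
    then have t: "0 \<le> t" "t < T" using closed by auto
    then obtain x where "x \<in> \<rat>" "t < x" "x < T" using Rats_dense_in_real[of t T] by auto
    then show "\<exists>x\<in>D \<inter> \<rat>. t < x" using t closed by (intro bexI[of _ x]) auto
  qed
qed

lemma \<psi>_measurable [measurable]: "\<psi> \<in> borel_measurable \<Lambda>"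
  and \<psi>_nonneg: "t \<in> D \<Longrightarrow> 0 \<le> \<psi> t"
  and \<psi>_pos: "AE t in \<Lambda>. 0 < \<psi> t"
  and \<psi>_total: "(\<integral>\<^sup>+t. ennreal (\<psi> t) \<partial>\<Lambda>) = 1"
  using pdf by (auto simp: positive_pdf_def)

lemma \<psi>_integrable: "integrable \<Lambda> \<psi>"
  using \<psi>_total \<psi>_nonneg by (intro integrableI_nonneg) (auto intro!: AE_I2)

lemma prob_space_P: "prob_space P"
proof (rule prob_spaceI)
  have "emeasure P D = (\<integral>\<^sup>+t. ennreal (\<psi> t) * indicator D t \<partial>\<Lambda>)"
    using sets.top[of \<Lambda>] by (intro emeasure_density) auto
  also have "\<dots> = (\<integral>\<^sup>+t. ennreal (\<psi> t) \<partial>\<Lambda>)" by (intro nn_integral_cong) auto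
  finally show "emeasure P (space P) = 1" using \<psi>_total by simp
qed

lemma AE_P_iff: "(AE t in P. R t) \<longleftrightarrow> (AE t in \<Lambda>. R t)"
proof -
  have "(AE t in P. R t) \<longleftrightarrow> (AE t in \<Lambda>. 0 < \<psi> t \<longrightarrow> R t)"
    by (subst AE_density) auto
  also have "\<dots> \<longleftrightarrow> (AE t in \<Lambda>. R t)"
    using \<psi>_pos by (auto elim: AE_mp)
  finally show ?thesis .
qed

lemma psi_bar_nonneg: "0 \<le> psi_bar D \<psi> t"
  unfolding psi_bar_def set_lebesgue_integral_def
  using \<psi>_nonneg by (intro Bochner_Integration.integral_nonneg) auto

lemma set_integrable_\<psi>: "integrable \<Lambda> (\<lambda>y. indicat_real {t..} y *\<^sub>R \<psi> y)"
proof -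
  have ind: "indicat_real {t..} \<in> borel_measurable \<Lambda>"
    by (intro measurable_restrict_space1 borel_measurable_indicator) auto
  have "integrable \<Lambda> (\<lambda>y. \<psi> y * indicat_real {t..} y)"
    by (rule integrable_mult_bounded[OF \<psi>_integrable ind, where B = 1]) (simp add: indicator_def)
  then show ?thesis by (simp add: mult.commute)
qed

lemma psi_bar_antimono: "s \<le> t \<Longrightarrow> psi_bar D \<psi> t \<le> psi_bar D \<psi> s"
  unfolding psi_bar_def set_lebesgue_integral_def
  using set_integrable_\<psi> \<psi>_nonneg by (intro integral_mono) (auto simp: indicator_def)

lemma psi_bar_measurable [measurable]: "psi_bar D \<psi> \<in> borel_measurable \<Lambda>"
proof -
  have "mono (\<lambda>t. - psi_bar D \<psi> t)" using psi_bar_antimono by (intro monoI) simp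
  then have "(\<lambda>t. - psi_bar D \<psi> t) \<in> borel_measurable borel" by (rule borel_measurable_mono)
  then have "(\<lambda>t. - (- psi_bar D \<psi> t)) \<in> borel_measurable borel" by (rule borel_measurable_uminus)
  then have "psi_bar D \<psi> \<in> borel_measurable lborel" by simp
  then show ?thesis by (intro measurable_restrict_space1 measurable_completion)
qed

text \<open>The conjugate index of 1 is \<infinity>, so condition (I) for p = 1 makes psi_bar / psi
  essentially bounded. The bound is raised to at least 1 so that its powers increase with the number
  of integrated variables.\<close>

definition m :: real where
  "m = max 1 (enn2real (esssup \<Lambda> (\<lambda>t. ennreal \<bar>psi_bar D \<psi> t * \<psi> t powr - 1\<bar>)))"

lemma m_ge_1: "1 \<le> m" by (simp add: m_def)

lemma psi_bar_le: "AE t in \<Lambda>. psi_bar D \<psi> t * \<psi> t powr - 1 \<le> m"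
proof -
  have "esssup \<Lambda> (\<lambda>t. ennreal \<bar>psi_bar D \<psi> t * \<psi> t powr - 1\<bar>) < \<infinity>"
    using cond_1 by (simp add: integrability_cond_def conj_index_1 Lp_space_def)
  from AE_le_enn2real_esssup[OF this] show ?thesis
    unfolding m_def by eventually_elim (meson abs_ge_self max.cobounded2 order_trans)
qed

text \<open>The cut-off at \<open>m\<close> changes psi_bar / psi only on a null set of
  \<open>D\<close> and makes the bound hold for every real \<open>t\<close>.\<close>

definition \<phi> :: "real \<Rightarrow> real" where
  "\<phi> t = min m (psi_bar D \<psi> t * \<psi> t powr - 1)"

lemma \<phi>_measurable [measurable]: "\<phi> \<in> borel_measurable \<Lambda>"
  unfolding \<phi>_def[abs_def] by measurable

lemma \<phi>_bounds: "0 \<le> \<phi> t" "\<phi> t \<le> m"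
  using m_ge_1 psi_bar_nonneg by (auto simp: \<phi>_def)

lemma \<psi>_\<phi>: "AE t in \<Lambda>. \<psi> t * \<phi> t = psi_bar D \<psi> t"
  using psi_bar_le \<psi>_pos
  by eventually_elim (auto simp: \<phi>_def min_def powr_minus powr_one field_simps)

text \<open>For \<open>x\<close> in \<open>D\<close> the local part of condition (I) makes 1 / psi
  essentially bounded on [0,x); the bound may depend on \<open>x\<close>.\<close>

definition M :: "real \<Rightarrow> real" where
  "M x = enn2real (esssup (lebesgue_on {0..<x}) (\<lambda>t. ennreal \<bar>\<psi> t powr - 1\<bar>))"

lemma inverse_\<psi>_le:
  assumes "x \<in> D"
  shows "AE t in lebesgue_on {0..<x}. \<psi> t powr - 1 \<le> M x"
proof -
  have "esssup (lebesgue_on {0..<x}) (\<lambda>t. ennreal \<bar>\<psi> t powr - 1\<bar>) < \<infinity>"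
    using cond_1 assms by (simp add: integrability_cond_def conj_index_1 Lp_loc_def Lp_space_def)
  from AE_le_enn2real_esssup[OF this] show ?thesis
    by eventually_elim (auto simp: M_def)
qed

lemma AE_lebesgue_on_Ico:
  assumes "x \<in> D"
  shows "(AE t in lebesgue_on {0..<x}. R t) \<longleftrightarrow> (AE t in \<Lambda>. t < x \<longrightarrow> R t)"
proof -
  have "(AE t in lebesgue_on {0..<x}. R t) \<longleftrightarrow> (AE t in lebesgue. t \<in> {0..<x} \<longrightarrow> R t)"
    by (rule AE_restrict_space_iff) auto
  also have "\<dots> \<longleftrightarrow> (AE t in lebesgue. t \<in> D \<longrightarrow> t < x \<longrightarrow> R t)"
    using Ico_subset_D[OF assms] D_nonneg by (intro AE_cong) auto
  also have "\<dots> \<longleftrightarrow> (AE t in \<Lambda>. t < x \<longrightarrow> R t)"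
    using D_lebesgue by (intro AE_restrict_space_iff[symmetric]) auto
  finally show ?thesis .
qed

definition \<kappa> :: "real \<Rightarrow> real \<Rightarrow> real" where
  "\<kappa> x t = (if x \<in> D then indicat_real {0..<x} t * min (M x) (\<psi> t powr - 1) else 0)"

lemma \<kappa>_measurable: "\<kappa> x \<in> borel_measurable \<Lambda>"
proof -
  have [measurable]: "indicat_real {0..<x} \<in> borel_measurable \<Lambda>"
    by (intro measurable_restrict_space1 borel_measurable_indicator) auto
  show ?thesis unfolding \<kappa>_def[abs_def] by measurable
qed

lemma \<kappa>_abs_le: "\<bar>\<kappa> x t\<bar> \<le> M x"
  by (auto simp: \<kappa>_def indicator_def M_def min_def)

lemma \<psi>_\<kappa>:
  assumes "x \<in> D"
  shows "AE t in \<Lambda>. \<psi> t * \<kappa> x t = indicat_real {0..<x} t"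
  using inverse_\<psi>_le[OF assms, unfolded AE_lebesgue_on_Ico[OF assms]] \<psi>_pos
  by eventually_elim (auto simp: \<kappa>_def assms indicator_def min_def powr_minus field_simps)

text \<open>The density cancels: integrating against \<open>\<kappa> x\<close> over \<open>P\<close>
  is Lebesgue integration over [0,x). Integrability is part of the claim because a
  \<open>P\<close>-integrable \<open>h\<close> need not be Lebesgue integrable on all of
  \<open>D\<close>.\<close>

lemma integral_\<kappa>:
  assumes h: "integrable P h" and x: "x \<in> D"
  shows "integrable lebesgue (\<lambda>t. indicat_real {0..<x} t * h t)"
    and "(\<integral>t. h t * \<kappa> x t \<partial>P) = (\<integral>t. indicat_real {0..<x} t * h t \<partial>lebesgue)"
proof -
  note \<kappa>_measurable[measurable]
  have [measurable]: "h \<in> borel_measurable \<Lambda>" using borel_measurable_integrable[OF h] by simp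
  have [measurable]: "indicat_real {0..<x} \<in> borel_measurable \<Lambda>"
    by (intro measurable_restrict_space1 borel_measurable_indicator) auto
  have nn: "AE t in \<Lambda>. 0 \<le> \<psi> t" using \<psi>_nonneg by (intro AE_I2) auto
  have ae: "AE t in \<Lambda>. \<psi> t *\<^sub>R (h t * \<kappa> x t) = indicat_real {0..<x} t * h t"
    using \<psi>_\<kappa>[OF x] by eventually_elim (simp add: mult_ac)
  have sub: "indicat_real D t *\<^sub>R (indicat_real {0..<x} t * h t) = indicat_real {0..<x} t * h t" for t
    using Ico_subset_D[OF x] by (auto simp: indicator_def)
  have "integrable P (\<lambda>t. h t * \<kappa> x t)"
    by (rule integrable_mult_bounded[OF h _ \<kappa>_abs_le]) simp
  then have "integrable \<Lambda> (\<lambda>t. \<psi> t *\<^sub>R (h t * \<kappa> x t))"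
    using nn by (subst (asm) integrable_density) auto
  then have "integrable \<Lambda> (\<lambda>t. indicat_real {0..<x} t * h t)"
    by (subst (asm) integrable_cong_AE[OF _ _ ae]) auto
  then show "integrable lebesgue (\<lambda>t. indicat_real {0..<x} t * h t)"
    using D_lebesgue by (subst (asm) integrable_restrict_space) (auto simp: sub[unfolded real_scaleR_def])
  have "(\<integral>t. h t * \<kappa> x t \<partial>P) = (\<integral>t. \<psi> t *\<^sub>R (h t * \<kappa> x t) \<partial>\<Lambda>)"
    using nn by (subst integral_density) auto
  also have "\<dots> = (\<integral>t. indicat_real {0..<x} t * h t \<partial>\<Lambda>)"
    by (rule integral_cong_AE[OF _ _ ae]) auto
  also have "\<dots> = (\<integral>t. indicat_real D t *\<^sub>R (indicat_real {0..<x} t * h t) \<partial>lebesgue)"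
    using D_lebesgue by (intro integral_restrict_space) auto
  also have "\<dots> = (\<integral>t. indicat_real {0..<x} t * h t \<partial>lebesgue)"
    unfolding sub ..
  finally show "(\<integral>t. h t * \<kappa> x t \<partial>P) = (\<integral>t. indicat_real {0..<x} t * h t \<partial>lebesgue)" .
qed

text \<open>For fixed rational \<open>x\<close> in \<open>D\<close>, \<open>h\<close> restricted to
  [0,x) is Lebesgue integrable and all its integrals over rational half-lines vanish, so
  \<open>h\<close> is null on [0,x). Countably many such intervals cover almost all of
  \<open>D\<close>.\<close>

lemma \<kappa>_separating:
  assumes h: "integrable P h" and zero: "\<And>x. x \<in> D \<inter> \<rat> \<Longrightarrow> (\<integral>t. h t * \<kappa> x t \<partial>P) = 0"
  shows "AE t in P. h t = 0"
proof -
  have "AE t in \<Lambda>. t < x \<longrightarrow> h t = 0" if x: "x \<in> D \<inter> \<rat>" for x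
  proof -
    have "AE t in lebesgue. indicat_real {0..<x} t * h t = 0"
    proof (rule AE_lebesgue_zero_if_integrals_lessThan_zero)
      show "integrable lebesgue (\<lambda>t. indicat_real {0..<x} t * h t)"
        using integral_\<kappa>(1)[OF h] x by auto
      fix y :: real assume y: "y \<in> \<rat>"
      \<comment> \<open>Cutting [0,x) at \<open>y\<close> gives [0,z), and \<open>z\<close> is again
        a rational point of \<open>D\<close>, also for negative \<open>y\<close>.\<close>
      define z where "z = max 0 (min x y)"
      have z: "z \<in> D \<inter> \<rat>" using x y zero_in_D by (auto simp: z_def max_def min_def not_le intro: D_downward)
      have eq: "indicat_real {0..<x} t * h t * indicat_real {..<y} t = indicat_real {0..<z} t * h t" for t
        using D_nonneg x by (auto simp: z_def indicator_def)
      then show "(\<integral>t. indicat_real {0..<x} t * h t * indicat_real {..<y} t \<partial>lebesgue) = 0"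
        unfolding eq using integral_\<kappa>(2)[OF h, of z] zero[OF z] z by simp
    qed
    then have "AE t in lebesgue. t \<in> D \<longrightarrow> t < x \<longrightarrow> h t = 0"
      by eventually_elim (auto simp: indicator_def dest: D_nonneg)
    then show ?thesis
      using D_lebesgue by (subst AE_restrict_space_iff) auto
  qed
  then have "AE t in \<Lambda>. \<forall>x\<in>D \<inter> \<rat>. t < x \<longrightarrow> h t = 0"
    by (subst AE_ball_countable) (auto intro: countable_rat countable_Int2)
  with AE_rational_above have "AE t in \<Lambda>. h t = 0" by eventually_elim auto
  then show ?thesis by (simp add: AE_P_iff)
qed

sublocale K: kernel_setting P \<phi> m \<kappa> D "D \<inter> \<rat>"
proof (intro kernel_setting.intro kernel_setting_axioms.intro)
  show "prob_space P" by (rule prob_space_P)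
  show "\<exists>B. \<forall>t. \<bar>\<kappa> x t\<bar> \<le> B" for x using \<kappa>_abs_le by blast
  show "countable (D \<inter> \<rat>)" by (intro countable_Int2 countable_rat)
qed (use \<phi>_bounds m_ge_1 \<kappa>_measurable zero_in_D \<kappa>_separating in \<open>auto simp: \<kappa>_def\<close>)

text \<open>Supplies the positive constant of the lower bound. If the mean were 0, psi_bar would
  vanish at some \<open>t\<close> below a point \<open>z\<close> of \<open>D\<close>, and psi would
  vanish almost everywhere on [t,z], against its positivity.\<close>

lemma expectation_\<phi>_pos: "0 < (\<integral>t. \<phi> t \<partial>P)"
proof -
  have int: "integrable P \<phi>" using \<phi>_bounds by (intro K.integrable_const_bound[of _ m]) auto
  have "(\<integral>t. \<phi> t \<partial>P) \<noteq> 0"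
  proof
    assume "(\<integral>t. \<phi> t \<partial>P) = 0"
    then have "AE t in P. \<phi> t = 0"
      using integral_nonneg_eq_0_iff_AE[OF int] \<phi>_bounds by auto
    then have "AE t in \<Lambda>. \<phi> t = 0" by (simp add: AE_P_iff)
    with \<psi>_\<phi> have "AE t in \<Lambda>. psi_bar D \<psi> t = 0" by eventually_elim auto
    then have ae: "AE t in lebesgue. t \<in> D \<longrightarrow> psi_bar D \<psi> t = 0"
      using D_lebesgue by (subst (asm) AE_restrict_space_iff) auto
    obtain z where z: "z \<in> D" "0 < z" using pos_in_D by blast
    have not_null: "\<not> (AE t in lebesgue. t \<notin> {a..b})" if "a < b" for a b :: real
    proof
      assume "AE t in lebesgue. t \<notin> {a..b}"
      then have "{a..b} \<in> null_sets lebesgue" by (subst AE_iff_null_sets) auto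
      then show False using that by (auto simp: null_sets_def)
    qed
    obtain t where t: "0 \<le> t" "t < z" "psi_bar D \<psi> t = 0"
    proof (rule ccontr)
      assume "\<not> thesis"
      then have no: "\<And>t. 0 \<le> t \<Longrightarrow> t < z \<Longrightarrow> psi_bar D \<psi> t \<noteq> 0" using that by blast
      have "AE t in lebesgue. t \<notin> {0..z / 2}"
        using ae
      proof eventually_elim
        case (elim t)
        then show ?case using no[of t] z D_downward[OF z(1), of t] by auto
      qed
      then show False using not_null[of 0 "z / 2"] z by simp
    qed
    have "AE y in \<Lambda>. indicat_real {t..} y *\<^sub>R \<psi> y = 0"
      using t(3) set_integrable_\<psi> \<psi>_nonneg unfolding psi_bar_def set_lebesgue_integral_def
      by (subst (asm) integral_nonneg_eq_0_iff_AE) (auto intro!: AE_I2)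
    with \<psi>_pos have "AE y in \<Lambda>. y < t"
      by eventually_elim (auto simp: indicator_def split: if_splits)
    then have "AE y in lebesgue. y \<in> D \<longrightarrow> y < t"
      using D_lebesgue by (subst (asm) AE_restrict_space_iff) auto
    then have "AE y in lebesgue. y \<notin> {t..z}"
      by eventually_elim (use t D_downward[OF z(1)] in force)
    then show False using not_null t(2) by blast
  qed
  moreover have "0 \<le> (\<integral>t. \<phi> t \<partial>P)" using \<phi>_bounds by (intro integral_nonneg_AE) auto
  ultimately show ?thesis by simp
qed

text \<open>The essential bounds from p = 1 suffice. On [0,x) powers of 1 / psi stay bounded and the
  length is finite. On \<open>D\<close>, psi_bar * psi^(-1/p) is at most m * psi^(1 - 1/p), and
  raising this to the conjugate exponent \<open>s\<close> gives a multiple of the integrable psi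
  because \<open>s * (1 - 1 / r) = 1\<close>.\<close>

lemma integrability_cond_ge_1:
  assumes "1 \<le> p"
  shows "integrability_cond D \<psi> p"
proof -
  have psi_bar_int: "integrable \<Lambda> (psi_bar D \<psi>)"
  proof -
    have "integrable \<Lambda> (\<lambda>t. \<psi> t * \<phi> t)"
      using \<phi>_bounds by (intro integrable_mult_bounded[OF \<psi>_integrable, where B = m]) auto
    then show ?thesis by (subst (asm) integrable_cong_AE[OF _ _ \<psi>_\<phi>]) auto
  qed
  consider "p = \<infinity>" | "p = 1" | "1 < p" "p < \<infinity>" 
    using assms by (metis infinity_ennreal_def order_le_less top.not_eq_extremum)
  then show ?thesis
  proof cases
    case 1
    then show ?thesis
      using psi_bar_int by (simp add: integrability_cond_def Lp_space_def)
  next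
    case 2
    then show ?thesis using cond_1 by simp
  next
    case 3
    define r where "r = enn2real p"
    have r: "1 < r"
      using 3 by (cases p) (auto simp: r_def ennreal_1[symmetric] ennreal_less_iff simp del: ennreal_1)
    define s where "s = 1 / (1 - 1 / r)"
    have s: "0 < s" "s * (1 - 1 / r) = 1" using r by (auto simp: s_def)
    have ci: "conj_index p = ennreal s" using conj_index_gt_1[OF 3] by (simp add: s_def r_def)
    have cs: "enn2real (conj_index p) = s" "conj_index p \<noteq> \<infinity>" using s by (auto simp: ci)
    have "(\<lambda>t. \<psi> t powr (- 1 / r)) \<in> Lp_space (lebesgue_on {0..<x}) (\<lambda>_. 1) (conj_index p)" if x: "x \<in> D" for x
    proof -
      have sub: "lebesgue_on {0..<x} = restrict_space \<Lambda> {0..<x}"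
        using Ico_subset_D[OF x] by (simp add: restrict_restrict_space D_lebesgue Int_absorb1)
      have [measurable]: "\<psi> \<in> borel_measurable (lebesgue_on {0..<x})"
        unfolding sub by (rule measurable_restrict_space1) simp
      interpret finite_measure "lebesgue_on {0..<x}"
        using D_nonneg[OF x] by (intro finite_measureI) (simp add: emeasure_restrict_space)
      have pos: "AE t in lebesgue_on {0..<x}. 0 < \<psi> t"
        unfolding AE_lebesgue_on_Ico[OF x] using \<psi>_pos by eventually_elim simp
      have "integrable (lebesgue_on {0..<x}) (\<lambda>t. \<bar>\<psi> t powr (- 1 / r)\<bar> powr s * 1)"
      proof (rule integrable_const_bound)
        show "AE t in lebesgue_on {0..<x}. norm (\<bar>\<psi> t powr (- 1 / r)\<bar> powr s * 1) \<le> M x powr (s / r)"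
          using inverse_\<psi>_le[OF x] pos
        proof eventually_elim
          case (elim t)
          have "\<bar>\<psi> t powr (- 1 / r)\<bar> powr s = \<psi> t powr (- 1 * (s / r))"
            by (simp add: powr_powr)
          also have "\<dots> = (\<psi> t powr - 1) powr (s / r)"
            by (simp only: powr_powr)
          also have "\<dots> \<le> M x powr (s / r)"
            using elim s r by (intro powr_mono2) auto
          finally show ?case by simp
        qed
      qed measurable
      then show ?thesis using cs by (simp add: Lp_space_def)
    qed
    moreover have "(\<lambda>t. psi_bar D \<psi> t * \<psi> t powr (- 1 / r)) \<in> Lp_space \<Lambda> (\<lambda>_. 1) (conj_index p)"
    proof -
      have "integrable \<Lambda> (\<lambda>t. \<bar>psi_bar D \<psi> t * \<psi> t powr (- 1 / r)\<bar> powr s * 1)"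
      proof (rule Bochner_Integration.integrable_bound)
        show "integrable \<Lambda> (\<lambda>t. m powr s * \<psi> t)" using \<psi>_integrable by simp
        show "AE t in \<Lambda>. norm (\<bar>psi_bar D \<psi> t * \<psi> t powr (- 1 / r)\<bar> powr s * 1) \<le> norm (m powr s * \<psi> t)"
          using psi_bar_le \<psi>_pos
        proof eventually_elim
          case (elim t)
          have "\<bar>psi_bar D \<psi> t * \<psi> t powr (- 1 / r)\<bar> = (psi_bar D \<psi> t * \<psi> t powr - 1) * \<psi> t powr (1 - 1 / r)"
          proof -
            have "\<psi> t powr - 1 * \<psi> t powr (1 - 1 / r) = \<psi> t powr (- 1 / r)"
              by (simp only: powr_add[symmetric]) simp
            then show ?thesis using psi_bar_nonneg[of t] by (simp only: mult.assoc) (simp add: abs_mult)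
          qed
          also have "\<dots> \<le> m * \<psi> t powr (1 - 1 / r)"
            using elim by (intro mult_right_mono) auto
          finally have "\<bar>psi_bar D \<psi> t * \<psi> t powr (- 1 / r)\<bar> powr s \<le> (m * \<psi> t powr (1 - 1 / r)) powr s"
            using s by (intro powr_mono2) auto
          also have "\<dots> = m powr s * \<psi> t"
            using elim m_ge_1 s by (simp add: powr_mult powr_powr mult.commute)
          finally show ?case using elim by simp
        qed
      qed measurable
      then show ?thesis using cs by (simp add: Lp_space_def)
    qed
    ultimately show ?thesis
      using 3 by (simp add: integrability_cond_def Lp_loc_def r_def)
  qed
qed

end

section \<open>Norms on the direct sums\<close>

lemma lq_norm_cong: "(\<And>i. i \<in> A \<Longrightarrow> a i = b i) \<Longrightarrow> lq_norm q A a = lq_norm q A b"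
  by (simp add: lq_norm_def cong: image_cong)

context anova_domain
begin

lemma PP_eq:
  assumes "finite u"
  shows "K.PP u = density (leb_pow D u) (\<lambda>t. ennreal (\<Prod>j\<in>u. \<psi> (t j)))"
  unfolding leb_pow_def using \<psi>_nonneg assms
  by (intro PiM_density sigma_finite_lebesgue_on D_lebesgue prob_space_P) auto

lemma product_sigma_finite_\<Lambda>: "product_sigma_finite (\<lambda>_::nat. \<Lambda>)"
  by (simp add: product_sigma_finite_def sigma_finite_lebesgue_on D_lebesgue)

lemma AE_leb_pow:
  assumes "finite u" "\<And>j. j \<in> u \<Longrightarrow> AE y in \<Lambda>. R j y"
  shows "AE t in leb_pow D u. \<forall>j\<in>u. R j (t j)"
proof (rule AE_finite_allI[OF assms(1)])
  interpret product_sigma_finite "\<lambda>_::nat. \<Lambda>" by (rule product_sigma_finite_\<Lambda>)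
  fix j assume "j \<in> u"
  then show "AE t in leb_pow D u. R j (t j)"
    unfolding leb_pow_def using assms by (intro AE_PiM_component) auto
qed

lemma measurable_leb_pow_prod:
  assumes "\<And>j. j \<in> u \<Longrightarrow> k j \<in> borel_measurable \<Lambda>"
  shows "(\<lambda>t. \<Prod>j\<in>u. k j (t j) :: real) \<in> borel_measurable (leb_pow D u)"
  unfolding leb_pow_def using assms
  by (intro borel_measurable_prod measurable_compose[OF measurable_component_singleton])

lemma prod_\<psi>_measurable: "(\<lambda>t. \<Prod>j\<in>u. \<psi> (t j)) \<in> borel_measurable (leb_pow D u)"
  by (rule measurable_leb_pow_prod) simp

lemma prod_\<psi>_nonneg: "t \<in> space (leb_pow D u) \<Longrightarrow> 0 \<le> (\<Prod>j\<in>u. \<psi> (t j))"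
  using \<psi>_nonneg by (intro prod_nonneg) (auto simp: leb_pow_def space_PiM PiE_iff)

lemma prod_\<psi>_pos:
  assumes "finite u"
  shows "AE t in leb_pow D u. 0 < (\<Prod>j\<in>u. \<psi> (t j))"
proof -
  have "AE t in leb_pow D u. \<forall>j\<in>u. 0 < \<psi> (t j)"
    by (rule AE_leb_pow[OF assms \<psi>_pos])
  then show ?thesis by eventually_elim (simp add: prod_pos)
qed

text \<open>The assumptions of the context on weighted norms, in their order, with
  \<open>leb_pow D u\<close> as \<open>M\<close> and \<open>K.PP u\<close> as
  \<open>N\<close>.\<close>

lemmas L_psi_density = prod_\<psi>_measurable prod_\<psi>_nonneg prod_\<psi>_pos PP_eq

lemma L_psi_imp_Lp_bound:
  "finite u \<Longrightarrow> 1 \<le> p \<Longrightarrow> g \<in> L_psi D \<psi> p u \<Longrightarrow> Lp_bound (K.PP u) p g (L_psi_norm D \<psi> p u g)"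
  unfolding L_psi_def L_psi_norm_def by (rule Lp_bound_Lp_norm[OF L_psi_density])

lemma Lp_bound_imp_L_psi:
  "finite u \<Longrightarrow> 1 \<le> p \<Longrightarrow> Lp_bound (K.PP u) p g b \<Longrightarrow> g \<in> L_psi D \<psi> p u"
  unfolding L_psi_def by (rule Lp_bound_imp_Lp_space[OF L_psi_density])

lemma L_psi_norm_le:
  "finite u \<Longrightarrow> 1 \<le> p \<Longrightarrow> Lp_bound (K.PP u) p g b \<Longrightarrow> 0 \<le> b \<Longrightarrow> L_psi_norm D \<psi> p u g \<le> b"
  unfolding L_psi_norm_def by (rule Lp_norm_le[OF L_psi_density])

lemma L_psi_norm_cong_AE:
  "finite u \<Longrightarrow> 1 \<le> p \<Longrightarrow> AE t in K.PP u. g t = h t \<Longrightarrow> g \<in> L_psi D \<psi> p u \<Longrightarrow> h \<in> L_psi D \<psi> p u \<Longrightarrow>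
    L_psi_norm D \<psi> p u g = L_psi_norm D \<psi> p u h"
  unfolding L_psi_norm_def L_psi_def by (rule Lp_norm_cong_AE[OF L_psi_density])

lemma L_psi_norm_nonneg: "0 \<le> L_psi_norm D \<psi> p u g"
  by (simp add: L_psi_norm_def Lp_norm_def)

lemma L_psi_integrable:
  "finite u \<Longrightarrow> 1 \<le> p \<Longrightarrow> g \<in> L_psi D \<psi> p u \<Longrightarrow> integrable (K.PP u) g"
  using prob_space.Lp_bound_integrable[OF K.prob_space_PP] L_psi_imp_Lp_bound by blast

text \<open>Moves the density between measure and kernel in each variable. The relation between
  \<open>k\<close> and \<open>l\<close> is asked for only almost everywhere, which is all that the
  truncated kernels satisfy.\<close>

lemma integral_PP_eq_integral_leb_pow:
  fixes k l :: "nat \<Rightarrow> real \<Rightarrow> real"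
  assumes u: "finite u" and g: "integrable (K.PP u) g"
    and k: "\<And>j. j \<in> u \<Longrightarrow> k j \<in> borel_measurable \<Lambda>" and l: "\<And>j. j \<in> u \<Longrightarrow> l j \<in> borel_measurable \<Lambda>"
    and eq: "\<And>j. j \<in> u \<Longrightarrow> AE y in \<Lambda>. \<psi> y * k j y = l j y"
  shows "(\<integral>t. g t * (\<Prod>j\<in>u. l j (t j)) \<partial>leb_pow D u) = (\<integral>t. g t * (\<Prod>j\<in>u. k j (t j)) \<partial>K.PP u)"
proof -
  have [measurable]: "g \<in> borel_measurable (leb_pow D u)"
    using borel_measurable_integrable[OF g] unfolding PP_eq[OF u] by simp
  note [measurable] = prod_\<psi>_measurable[of u] measurable_leb_pow_prod[of u k, OF k] measurable_leb_pow_prod[of u l, OF l]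
  have "(\<integral>t. g t * (\<Prod>j\<in>u. k j (t j)) \<partial>K.PP u)
      = (\<integral>t. (\<Prod>j\<in>u. \<psi> (t j)) *\<^sub>R (g t * (\<Prod>j\<in>u. k j (t j))) \<partial>leb_pow D u)"
    unfolding PP_eq[OF u] by (rule integral_density) (auto intro!: AE_I2 prod_\<psi>_nonneg)
  also have "\<dots> = (\<integral>t. g t * (\<Prod>j\<in>u. l j (t j)) \<partial>leb_pow D u)"
  proof (rule integral_cong_AE)
    have "AE t in leb_pow D u. \<forall>j\<in>u. \<psi> (t j) * k j (t j) = l j (t j)"
      by (rule AE_leb_pow[OF u eq])
    then show "AE t in leb_pow D u. (\<Prod>j\<in>u. \<psi> (t j)) *\<^sub>R (g t * (\<Prod>j\<in>u. k j (t j))) = g t * (\<Prod>j\<in>u. l j (t j))"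
    proof eventually_elim
      case (elim t)
      then have "(\<Prod>j\<in>u. l j (t j)) = (\<Prod>j\<in>u. \<psi> (t j) * k j (t j))" by simp
      then show ?case by (simp add: prod.distrib)
    qed
  qed measurable
  finally show ?thesis ..
qed

definition T_kind :: "kind \<Rightarrow> nat set \<Rightarrow> ((nat \<Rightarrow> real) \<Rightarrow> real) \<Rightarrow> (nat \<Rightarrow> real) \<Rightarrow> real" where
  "T_kind k = (case k of Anchored \<Rightarrow> K.TK | ANOVA \<Rightarrow> K.TA)"

lemma T_op_eq:
  assumes u: "u \<subseteq> {1..d}" and g: "integrable (K.PP u) g" and x: "x \<in> cube D d"
  shows "T_op D \<psi> k d u g x = T_kind k u g x"
proof -
  have fin: "finite u" using u finite_subset by auto
  have xD: "x j \<in> D" if "j \<in> u" for j using x u that by (auto simp: cube_def PiE_iff)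
  have ind [measurable]: "indicat_real {0..<y} \<in> borel_measurable \<Lambda>" for y
    by (intro measurable_restrict_space1 borel_measurable_indicator) auto
  note [measurable] = \<kappa>_measurable
  show ?thesis
  proof (cases k)
    case Anchored
    have "(\<integral>t. g t * (\<Prod>j\<in>u. indicat_real {0..<x j} (t j)) \<partial>leb_pow D u) = K.TK u g x"
      unfolding K.TK_def using \<psi>_\<kappa>[OF xD] by (intro integral_PP_eq_integral_leb_pow fin g) auto
    then show ?thesis using x by (simp add: Anchored T_op_def kernel_prod_def T_kind_def)
  next
    case ANOVA
    have "(\<integral>t. g t * (\<Prod>j\<in>u. indicat_real {0..<x j} (t j) - psi_bar D \<psi> (t j)) \<partial>leb_pow D u) = K.TA u g x"
      unfolding K.TA_def
    proof (intro integral_PP_eq_integral_leb_pow[where k = "\<lambda>j y. \<kappa> (x j) y - \<phi> y"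
          and l = "\<lambda>j y. indicat_real {0..<x j} y - psi_bar D \<psi> y"] fin g)
      fix j assume j: "j \<in> u"
      show "AE y in \<Lambda>. \<psi> y * (\<kappa> (x j) y - \<phi> y) = indicat_real {0..<x j} y - psi_bar D \<psi> y"
        using \<psi>_\<kappa>[OF xD[OF j]] \<psi>_\<phi> by eventually_elim (simp add: right_diff_distrib)
    qed measurable
    then show ?thesis using x by (simp add: ANOVA T_op_def kernel_prod_def T_kind_def)
  qed
qed

text \<open>By linearity the difference of two representations represents 0, and the uniqueness
  results for vanishing sums apply.\<close>

lemma T_kind_unique:
  assumes A: "A \<subseteq> Pow {1..d}" "\<And>u w. w \<in> A \<Longrightarrow> u \<subseteq> w \<Longrightarrow> u \<in> A"
    and g: "\<And>u. u \<in> A \<Longrightarrow> integrable (K.PP u) (g u)" and h: "\<And>u. u \<in> A \<Longrightarrow> integrable (K.PP u) (h u)"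
    and eq: "\<And>x. x \<in> cube D d \<Longrightarrow> (\<Sum>u\<in>A. T_kind k u (g u) x) = (\<Sum>u\<in>A. T_kind k u (h u) x)"
    and "u \<in> A"
  shows "AE t in K.PP u. g u t = h u t"
proof -
  have int: "\<And>u. u \<in> A \<Longrightarrow> integrable (K.PP u) (\<lambda>t. g u t - h u t)" using g h by auto
  have "AE t in K.PP u. g u t - h u t = 0"
  proof (cases k)
    case Anchored
    show ?thesis
    proof (rule K.sum_TK_unique[OF A(1) int _ \<open>u \<in> A\<close>])
      fix x assume "x \<in> {1..d} \<rightarrow>\<^sub>E D"
      then show "(\<Sum>u\<in>A. K.TK u (\<lambda>t. g u t - h u t) x) = 0"
        using eq[of x] g h by (simp add: Anchored T_kind_def cube_def K.TK_diff sum_subtractf)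
    qed
  next
    case ANOVA
    show ?thesis
    proof (rule K.sum_TA_unique[OF A int _ \<open>u \<in> A\<close>])
      fix x assume "x \<in> {1..d} \<rightarrow>\<^sub>E D"
      then show "(\<Sum>u\<in>A. K.TA u (\<lambda>t. g u t - h u t) x) = 0"
        using eq[of x] g h by (simp add: ANOVA T_kind_def cube_def K.TA_diff sum_subtractf)
    qed
  qed
  then show ?thesis by eventually_elim simp
qed

definition represented :: "kind \<Rightarrow> nat \<Rightarrow> nat set set \<Rightarrow> (nat set \<Rightarrow> (nat \<Rightarrow> real) \<Rightarrow> real) \<Rightarrow> (nat \<Rightarrow> real) \<Rightarrow> real" where
  "represented k d A g = (\<lambda>x\<in>cube D d. \<Sum>u\<in>A. T_op D \<psi> k d u (g u) x)"

lemma W_space_iff: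
  "f \<in> W_space D \<psi> k p d \<gamma> \<longleftrightarrow> (\<exists>g. (\<forall>u\<in>active d \<gamma>. g u \<in> L_psi D \<psi> p u) \<and> f = represented k d (active d \<gamma>) g)"
proof
  assume "f \<in> W_space D \<psi> k p d \<gamma>"
  then obtain h where h: "\<forall>u\<in>active d \<gamma>. h u \<in> T_op D \<psi> k d u ` L_psi D \<psi> p u"
    and f: "f = (\<lambda>x\<in>cube D d. \<Sum>u\<in>active d \<gamma>. h u x)"
    unfolding W_space_def F_space_def by blast
  from h have "\<forall>u\<in>active d \<gamma>. \<exists>g. g \<in> L_psi D \<psi> p u \<and> h u = T_op D \<psi> k d u g" by blast
  then obtain g where g: "\<forall>u\<in>active d \<gamma>. g u \<in> L_psi D \<psi> p u \<and> h u = T_op D \<psi> k d u (g u)" by metis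
  then have "f = represented k d (active d \<gamma>) g" by (auto simp: f represented_def intro!: restrict_ext)
  with g show "\<exists>g. (\<forall>u\<in>active d \<gamma>. g u \<in> L_psi D \<psi> p u) \<and> f = represented k d (active d \<gamma>) g" by blast
next
  assume "\<exists>g. (\<forall>u\<in>active d \<gamma>. g u \<in> L_psi D \<psi> p u) \<and> f = represented k d (active d \<gamma>) g"
  then obtain g where "\<forall>u\<in>active d \<gamma>. g u \<in> L_psi D \<psi> p u" "f = represented k d (active d \<gamma>) g" by blast
  then show "f \<in> W_space D \<psi> k p d \<gamma>"
    unfolding W_space_def F_space_def represented_def
    by (intro CollectI exI[of _ "\<lambda>u. T_op D \<psi> k d u (g u)"]) auto
qed

text \<open>Gives the definite description in \<open>W_norm\<close> its value: two families
  representing the same function agree almost everywhere in each component and so have equal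
  component norms.\<close>

lemma W_norm_represented:
  assumes p: "1 \<le> p" and down: "\<And>u w. w \<in> active d \<gamma> \<Longrightarrow> u \<subseteq> w \<Longrightarrow> u \<in> active d \<gamma>"
    and g: "\<And>u. u \<in> active d \<gamma> \<Longrightarrow> g u \<in> L_psi D \<psi> p u"
  shows "W_norm D \<psi> k p q d \<gamma> (represented k d (active d \<gamma>) g)
    = lq_norm q (active d \<gamma>) (\<lambda>u. L_psi_norm D \<psi> p u (g u) / \<gamma> u)"
  unfolding W_norm_def
proof (rule the_equality)
  let ?A = "active d \<gamma>"
  have A: "?A \<subseteq> Pow {1..d}" by (auto simp: active_def)
  have fin: "\<And>u. u \<in> ?A \<Longrightarrow> finite u" using A finite_subset[OF _ finite_atLeastAtMost] by blast
  show "\<exists>ga. (\<forall>u\<in>?A. ga u \<in> L_psi D \<psi> p u) \<and>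
      represented k d ?A g = (\<lambda>x\<in>cube D d. \<Sum>u\<in>?A. T_op D \<psi> k d u (ga u) x) \<and>
      lq_norm q ?A (\<lambda>u. L_psi_norm D \<psi> p u (g u) / \<gamma> u) = lq_norm q ?A (\<lambda>u. L_psi_norm D \<psi> p u (ga u) / \<gamma> u)"
    using g by (intro exI[of _ g]) (simp add: represented_def)
  fix n assume "\<exists>ga. (\<forall>u\<in>?A. ga u \<in> L_psi D \<psi> p u) \<and>
      represented k d ?A g = (\<lambda>x\<in>cube D d. \<Sum>u\<in>?A. T_op D \<psi> k d u (ga u) x) \<and>
      n = lq_norm q ?A (\<lambda>u. L_psi_norm D \<psi> p u (ga u) / \<gamma> u)"
  then obtain h where h: "\<And>u. u \<in> ?A \<Longrightarrow> h u \<in> L_psi D \<psi> p u"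
    and rep: "represented k d ?A g = represented k d ?A h"
    and n: "n = lq_norm q ?A (\<lambda>u. L_psi_norm D \<psi> p u (h u) / \<gamma> u)"
    unfolding represented_def by blast
  have gi: "\<And>u. u \<in> ?A \<Longrightarrow> integrable (K.PP u) (g u)" using L_psi_integrable fin p g by blast
  have hi: "\<And>u. u \<in> ?A \<Longrightarrow> integrable (K.PP u) (h u)" using L_psi_integrable fin p h by blast
  have "(\<Sum>u\<in>?A. T_kind k u (g u) x) = (\<Sum>u\<in>?A. T_kind k u (h u) x)" if x: "x \<in> cube D d" for x
  proof -
    have "(\<Sum>u\<in>?A. T_kind k u (g u) x) = (\<Sum>u\<in>?A. T_op D \<psi> k d u (g u) x)"
      using A gi x by (intro sum.cong refl T_op_eq[symmetric]) auto
    also have "\<dots> = (\<Sum>u\<in>?A. T_op D \<psi> k d u (h u) x)"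
      using fun_cong[OF rep, of x] x by (simp add: represented_def)
    also have "\<dots> = (\<Sum>u\<in>?A. T_kind k u (h u) x)"
      using A hi x by (intro sum.cong refl T_op_eq) auto
    finally show ?thesis .
  qed
  then have "AE t in K.PP u. g u t = h u t" if "u \<in> ?A" for u
    using that A down gi hi by (intro T_kind_unique[where A = ?A and d = d and k = k]) auto
  then have "L_psi_norm D \<psi> p u (g u) = L_psi_norm D \<psi> p u (h u)" if "u \<in> ?A" for u
    using L_psi_norm_cong_AE[OF fin[OF that] p _ g[OF that] h[OF that]] that by blast
  then show "n = lq_norm q ?A (\<lambda>u. L_psi_norm D \<psi> p u (g u) / \<gamma> u)"
    unfolding n by (intro lq_norm_cong) simp
qed

lemma anova_to_anchored_represented:
  assumes A: "A \<subseteq> Pow {1..d}" "\<And>u w. w \<in> A \<Longrightarrow> u \<subseteq> w \<Longrightarrow> u \<in> A"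
    and g: "\<And>u. u \<in> A \<Longrightarrow> integrable (K.PP u) (g u)"
  shows "represented ANOVA d A g = represented Anchored d A (K.anova_to_anchored A g)"
  unfolding represented_def
proof (rule restrict_ext)
  fix x assume x: "x \<in> cube D d"
  have "(\<Sum>u\<in>A. T_op D \<psi> ANOVA d u (g u) x) = (\<Sum>u\<in>A. K.TA u (g u) x)"
    using A g x by (intro sum.cong refl) (subst T_op_eq; auto simp: T_kind_def)
  also have "\<dots> = (\<Sum>u\<in>A. K.TK u (K.anova_to_anchored A g u) x)"
    by (rule K.sum_TA_eq_sum_TK[OF A g])
  also have "\<dots> = (\<Sum>u\<in>A. T_op D \<psi> Anchored d u (K.anova_to_anchored A g u) x)"
    using A(1) K.integrable_anova_to_anchored[OF A(1) g] x
    by (intro sum.cong refl) (subst T_op_eq; auto simp: T_kind_def)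
  finally show "(\<Sum>u\<in>A. T_op D \<psi> ANOVA d u (g u) x) = (\<Sum>u\<in>A. T_op D \<psi> Anchored d u (K.anova_to_anchored A g u) x)" .
qed

text \<open>Triangle inequality over the supersets of \<open>u\<close>; the alternating signs
  disappear in the norm.\<close>

lemma Lp_bound_anova_to_anchored:
  assumes p: "1 \<le> p" and A: "A \<subseteq> Pow {1..d}" and g: "\<And>u. u \<in> A \<Longrightarrow> g u \<in> L_psi D \<psi> p u"
  shows "Lp_bound (K.PP u) p (K.anova_to_anchored A g u)
    (\<Sum>w\<in>{w \<in> A. u \<subseteq> w}. m ^ card (w - u) * L_psi_norm D \<psi> p w (g w))"
  unfolding K.anova_to_anchored_def[abs_def]
proof (rule Lp_bound_sum[OF p])
  have finA: "finite A" by (rule finite_subset[OF A]) simp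
  then show "finite {w \<in> A. u \<subseteq> w}" by simp
  fix w assume w: "w \<in> {w \<in> A. u \<subseteq> w}"
  then have fin: "finite w" using A finite_subset[OF _ finite_atLeastAtMost] by blast
  have nn: "0 \<le> m ^ card (w - u) * L_psi_norm D \<psi> p w (g w)"
    using L_psi_norm_nonneg K.m_nonneg by simp
  show "0 \<le> m ^ card (w - u) * L_psi_norm D \<psi> p w (g w)" by (rule nn)
  have "Lp_bound (K.PP u) p (K.marg w u (g w)) (m ^ card (w - u) * L_psi_norm D \<psi> p w (g w))"
    using w g fin p by (intro K.Lp_bound_marg L_psi_imp_Lp_bound L_psi_norm_nonneg) auto
  from Lp_bound_cmult[OF this nn, of "(-1) ^ card (w - u)"]
  show "Lp_bound (K.PP u) p (\<lambda>t. (-1) ^ card (w - u) * K.marg w u (g w) t) (m ^ card (w - u) * L_psi_norm D \<psi> p w (g w))"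
    by (simp add: power_abs)
qed

end

section \<open>Finite order weights\<close>

text \<open>For \<open>b = 0\<close> the quotient is 0 by convention, which matches the contribution
  of the zero vector to \<open>op_norm\<close>.\<close>

lemma ennreal_divide_le_if_le_mult:
  fixes a b c :: real
  assumes "a \<le> c * b" "0 \<le> b" "0 \<le> c"
  shows "ennreal (a / b) \<le> ennreal c"
proof (cases "b = 0")
  case False
  then have "a / b \<le> c" using assms by (simp add: divide_le_eq)
  then show ?thesis by (rule ennreal_leI)
qed (use assms in simp)

locale finite_order_weights = anova_domain +
  fixes r :: nat and \<omega> :: real and d :: nat and \<gamma> :: "nat set \<Rightarrow> real" and p q :: ennreal
  assumes \<omega>_pos: "0 < \<omega>" and d_ge_1: "1 \<le> d" and p_ge_1: "1 \<le> p" and q_ge_1: "1 \<le> q"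
    and \<gamma>_eq: "\<And>u. u \<subseteq> {1..d} \<Longrightarrow> \<gamma> u = (if card u \<le> r then \<omega> ^ card u else 0)"
begin

abbreviation A :: "nat set set" where "A \<equiv> small_subsets d r"
abbreviation \<theta> :: real where "\<theta> \<equiv> 1 - enn2real (1 / q)"
abbreviation W :: "kind \<Rightarrow> ((nat \<Rightarrow> real) \<Rightarrow> real) set" where "W k \<equiv> W_space D \<psi> k p d \<gamma>"
abbreviation W_nrm :: "kind \<Rightarrow> ((nat \<Rightarrow> real) \<Rightarrow> real) \<Rightarrow> real" where "W_nrm k \<equiv> W_norm D \<psi> k p q d \<gamma>"

lemma \<gamma>_A: "u \<in> A \<Longrightarrow> \<gamma> u = \<omega> ^ card u"
  by (simp add: small_subsets_def \<gamma>_eq)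

lemma active_eq: "active d \<gamma> = A"
  using \<omega>_pos by (auto simp: active_def small_subsets_def \<gamma>_eq split: if_splits)

lemma A_facts: "A \<subseteq> Pow {1..d}" "finite A" "A \<noteq> {}" "u \<in> A \<Longrightarrow> finite u"
  using finite_small_subsets empty_in_small_subsets
  by (auto simp: small_subsets_def intro: finite_subset[OF _ finite_atLeastAtMost])

lemma W_norm_A:
  assumes "\<And>u. u \<in> A \<Longrightarrow> g u \<in> L_psi D \<psi> p u"
  shows "W_nrm k (represented k d A g) = lq_norm q A (\<lambda>u. L_psi_norm D \<psi> p u (g u) / \<omega> ^ card u)"
proof -
  have "W_nrm k (represented k d (active d \<gamma>) g) = lq_norm q (active d \<gamma>) (\<lambda>u. L_psi_norm D \<psi> p u (g u) / \<gamma> u)"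
    using assms by (intro W_norm_represented p_ge_1) (auto simp: active_eq intro: small_subsets_subset)
  also have "\<dots> = lq_norm q A (\<lambda>u. L_psi_norm D \<psi> p u (g u) / \<omega> ^ card u)"
    unfolding active_eq by (intro lq_norm_cong) (simp add: \<gamma>_A)
  finally show ?thesis by (simp add: active_eq)
qed

text \<open>The factors bound the weighted matrix entries, the number of subsets of a set of size at
  most \<open>r\<close>, and the \<open>\<theta>\<close>-th power of the number of index
  sets.\<close>

definition upper_const :: real where
  "upper_const = (m * max 1 \<omega>) ^ r * 2 ^ r * (real (Suc r) * real d ^ r) powr \<theta>"

lemma upper_const_nonneg: "0 \<le> upper_const"
  using K.m_nonneg by (simp add: upper_const_def)

lemma converted:
  assumes g: "\<And>u. u \<in> A \<Longrightarrow> g u \<in> L_psi D \<psi> p u"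
  defines "h \<equiv> K.anova_to_anchored A g"
  shows "represented ANOVA d A g = represented Anchored d A h"
    and "u \<in> A \<Longrightarrow> h u \<in> L_psi D \<psi> p u"
    and "W_nrm Anchored (represented Anchored d A h) \<le> upper_const * W_nrm ANOVA (represented ANOVA d A g)"
proof -
  note A = A_facts
  have gi: "\<And>u. u \<in> A \<Longrightarrow> integrable (K.PP u) (g u)" using L_psi_integrable[OF A(4) p_ge_1] g by blast
  show "represented ANOVA d A g = represented Anchored d A h"
    unfolding h_def using small_subsets_subset gi by (intro anova_to_anchored_represented A) auto
  note bound = Lp_bound_anova_to_anchored[OF p_ge_1 A(1) g]
  have nn: "0 \<le> (\<Sum>w\<in>{w \<in> A. u \<subseteq> w}. m ^ card (w - u) * L_psi_norm D \<psi> p w (g w))" for u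
    using L_psi_norm_nonneg K.m_nonneg by (intro sum_nonneg) simp
  show h: "h u \<in> L_psi D \<psi> p u" if "u \<in> A" for u
    unfolding h_def by (rule Lp_bound_imp_L_psi[OF A(4)[OF that] p_ge_1 bound])
  let ?a = "\<lambda>u. L_psi_norm D \<psi> p u (g u) / \<omega> ^ card u"
  let ?b = "\<lambda>u. L_psi_norm D \<psi> p u (h u) / \<omega> ^ card u"
  let ?c = "(m * max 1 \<omega>) ^ r"
  have c1: "1 \<le> m * max 1 \<omega>"
    using mult_mono[of 1 m 1 "max 1 \<omega>"] m_ge_1 by simp
  have "lq_norm q A ?b \<le> ?c * 2 ^ r * (real (Suc r) * real d ^ r) powr \<theta> * lq_norm q A ?a"
  proof (rule lq_norm_row_col_bound[where E = "(\<subseteq>)"])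
    show "1 \<le> real (Suc r) * real d ^ r"
    proof -
      have "1 \<le> real d ^ r" using d_ge_1 by (intro one_le_power) simp
      then show ?thesis using mult_mono[of 1 "real (Suc r)" 1 "real d ^ r"] by simp
    qed
    show "real (card {w \<in> A. u \<subseteq> w}) \<le> real (Suc r) * real d ^ r" for u
    proof -
      have "card {w \<in> A. u \<subseteq> w} \<le> card A" using A by (intro card_mono) auto
      also have "\<dots> \<le> Suc r * d ^ r" by (rule card_small_subsets_le[OF d_ge_1])
      finally have "real (card {w \<in> A. u \<subseteq> w}) \<le> real (Suc r * d ^ r)" by (rule of_nat_mono)
      then show ?thesis by (simp only: of_nat_mult of_nat_power)
    qed
    show "real (card {u \<in> A. u \<subseteq> w}) \<le> 2 ^ r" if "w \<in> A" for w
      using of_nat_mono[OF card_subsets_of_small_le[OF that], where 'a = real] by simp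
    show "?b u \<le> ?c * (\<Sum>w\<in>{w \<in> A. u \<subseteq> w}. ?a w)" if u: "u \<in> A" for u
    proof -
      have "?b u \<le> (\<Sum>w\<in>{w \<in> A. u \<subseteq> w}. m ^ card (w - u) * L_psi_norm D \<psi> p w (g w)) / \<omega> ^ card u"
        unfolding h_def using \<omega>_pos
        by (intro divide_right_mono L_psi_norm_le[OF A(4)[OF u] p_ge_1 bound nn]) auto
      \<comment> \<open>The ratio of the weights of \<open>w\<close> and \<open>u\<close> is
        \<open>\<omega> ^ card (w - u)\<close>, which merges with the factor \<open>m\<close> per
        integrated variable.\<close>
      also have "\<dots> = (\<Sum>w\<in>{w \<in> A. u \<subseteq> w}. (m * \<omega>) ^ card (w - u) * ?a w)"
        unfolding sum_divide_distrib
      proof (rule sum.cong[OF refl])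
        fix w assume w: "w \<in> {w \<in> A. u \<subseteq> w}"
        then have "card w = card u + card (w - u)"
          using A(4) by (metis (no_types, lifting) card_Diff_subset card_mono finite_subset le_add_diff_inverse mem_Collect_eq)
        then show "m ^ card (w - u) * L_psi_norm D \<psi> p w (g w) / \<omega> ^ card u = (m * \<omega>) ^ card (w - u) * ?a w"
          using \<omega>_pos by (simp add: power_add power_mult_distrib field_simps)
      qed
      also have "\<dots> \<le> (\<Sum>w\<in>{w \<in> A. u \<subseteq> w}. ?c * ?a w)"
      proof (rule sum_mono)
        fix w assume w: "w \<in> {w \<in> A. u \<subseteq> w}"
        have "card (w - u) \<le> card w" using A(4) w by (intro card_mono) auto
        then have "card (w - u) \<le> r" using w by (simp add: small_subsets_def)
        \<comment> \<open>As \<open>m * \<omega>\<close> may be below 1, it is replaced by a base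
          that is at least 1 before the exponent is raised to \<open>r\<close>.\<close>
        have "(m * \<omega>) ^ card (w - u) \<le> (m * max 1 \<omega>) ^ card (w - u)"
          using K.m_nonneg \<omega>_pos by (intro power_mono mult_left_mono) auto
        also have "\<dots> \<le> ?c" using c1 \<open>card (w - u) \<le> r\<close> by (intro power_increasing) auto
        finally show "(m * \<omega>) ^ card (w - u) * ?a w \<le> ?c * ?a w"
          using \<omega>_pos L_psi_norm_nonneg by (intro mult_right_mono) auto
      qed
      finally show ?thesis by (simp add: sum_distrib_left)
    qed
  qed (use A q_ge_1 \<omega>_pos L_psi_norm_nonneg c1 in auto)
  then show "W_nrm Anchored (represented Anchored d A h) \<le> upper_const * W_nrm ANOVA (represented ANOVA d A g)"
    using g h by (simp add: W_norm_A upper_const_def)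
qed

text \<open>\<open>op_norm\<close> would be \<infinity> if some ANOVA function were not in the
  anchored space; the conversion excludes this.\<close>

lemma iota_norm_eq:
  "iota_norm D \<psi> p q d \<gamma> = (SUP f\<in>W ANOVA. ennreal (W_nrm Anchored f / W_nrm ANOVA f))"
proof -
  have "f \<in> W Anchored" if f_W: "f \<in> W ANOVA" for f
  proof -
    obtain g where g: "\<And>u. u \<in> A \<Longrightarrow> g u \<in> L_psi D \<psi> p u" and f: "f = represented ANOVA d A g"
      using f_W unfolding W_space_iff active_eq by blast
    show ?thesis unfolding W_space_iff active_eq f
      using converted(1,2)[of g] g by blast
  qed
  then have "id ` W ANOVA \<subseteq> W Anchored" by auto
  then show ?thesis by (simp add: iota_norm_def op_norm_def)
qed

lemma iota_norm_le: "iota_norm D \<psi> p q d \<gamma> \<le> ennreal upper_const"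
  unfolding iota_norm_eq
proof (rule SUP_least)
  fix f assume "f \<in> W ANOVA"
  then obtain g where g: "\<And>u. u \<in> A \<Longrightarrow> g u \<in> L_psi D \<psi> p u" and f: "f = represented ANOVA d A g"
    unfolding W_space_iff active_eq by blast
  have "W_nrm Anchored f \<le> upper_const * W_nrm ANOVA f"
    using converted(1,3)[of g, OF g] unfolding f by simp
  moreover have "0 \<le> W_nrm ANOVA f"
    unfolding f using g A_facts by (simp add: W_norm_A lq_norm_nonneg)
  ultimately show "ennreal (W_nrm Anchored f / W_nrm ANOVA f) \<le> ennreal upper_const"
    using upper_const_nonneg by (rule ennreal_divide_le_if_le_mult)
qed

section \<open>Lower bound from a test function\<close>

lemma card_top_order: "card {w \<in> A. card w = r} = d choose r"
proof -
  have "{w \<in> A. card w = r} = {w. w \<subseteq> {1..d} \<and> card w = r}" by (auto simp: small_subsets_def)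
  then show ?thesis by (simp add: n_subsets)
qed

text \<open>With \<open>N\<close> sets of size \<open>r\<close>, the test function has ANOVA norm at
  most N^(1/q) / \<omega>^r. Its anchored component on the empty set, whose weight is 1, is
  \<open>N * s ^ r\<close> up to sign and bounds the anchored norm from below. The quotient of the
  two is the claimed bound.\<close>

lemma iota_norm_ge:
  assumes "r \<le> d"
  shows "ennreal (real (d choose r) powr \<theta> * (\<omega> * (\<integral>t. \<phi> t \<partial>P)) ^ r) \<le> iota_norm D \<psi> p q d \<gamma>"
proof -
  define s where "s = (\<integral>t. \<phi> t \<partial>P)"
  have s: "0 < s" unfolding s_def by (rule expectation_\<phi>_pos)
  define N where "N = real (d choose r)"
  have N: "1 \<le> N" using assms by (simp add: N_def Suc_le_eq)
  define g :: "nat set \<Rightarrow> (nat \<Rightarrow> real) \<Rightarrow> real" where "g w = (\<lambda>_. if card w = r then 1 else 0)" for w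
  have bound: "Lp_bound (K.PP w) p (g w) (if card w = r then 1 else 0)" for w
  proof -
    interpret prob_space "K.PP w" by (rule K.prob_space_PP)
    show ?thesis using p_ge_1 enn2real_ge_1[of p] by (auto simp: Lp_bound_def g_def emeasure_space_1)
  qed
  have g: "g u \<in> L_psi D \<psi> p u" if "u \<in> A" for u
    by (rule Lp_bound_imp_L_psi[OF A_facts(4)[OF that] p_ge_1 bound])
  define h where "h = K.anova_to_anchored A g"
  have conv: "represented ANOVA d A g = represented Anchored d A h"
    "\<And>u. u \<in> A \<Longrightarrow> h u \<in> L_psi D \<psi> p u"
    "W_nrm Anchored (represented Anchored d A h) \<le> upper_const * W_nrm ANOVA (represented ANOVA d A g)"
    unfolding h_def using converted[of g] g by auto
  define f where "f = represented ANOVA d A g"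
  have f_W: "f \<in> W ANOVA" unfolding W_space_iff active_eq f_def using g by blast
  let ?a = "\<lambda>u. L_psi_norm D \<psi> p u (g u) / \<omega> ^ card u"
  have a: "0 \<le> ?a u" "?a u \<le> (if card u = r then 1 / \<omega> ^ r else 0)" if "u \<in> A" for u
    using L_psi_norm_nonneg \<omega>_pos L_psi_norm_le[OF A_facts(4)[OF that] p_ge_1 bound]
    by (auto simp: divide_right_mono divide_le_0_iff intro: antisym)
  have fA: "W_nrm ANOVA f = lq_norm q A ?a" unfolding f_def by (rule W_norm_A[OF g])
  have fA_nonneg: "0 \<le> W_nrm ANOVA f" unfolding fA using A_facts by (intro lq_norm_nonneg) auto
  have fA_le: "W_nrm ANOVA f \<le> N powr (enn2real (1 / q)) / \<omega> ^ r"
  proof (cases "q = \<infinity>")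
    case True
    have "\<bar>?a u\<bar> \<le> 1 / \<omega> ^ r" if "u \<in> A" for u
      using a[OF that] \<omega>_pos by (auto split: if_splits intro: order_trans)
    then have "Max ((\<lambda>u. \<bar>?a u\<bar>) ` A) \<le> 1 / \<omega> ^ r" using A_facts by (intro Max.boundedI) auto
    then show ?thesis unfolding fA using True N by (simp add: lq_norm_def)
  next
    case False
    define q' where "q' = enn2real q"
    have q': "1 \<le> q'" unfolding q'_def using enn2real_ge_1[OF q_ge_1 False] .
    have "(\<Sum>u\<in>A. \<bar>?a u\<bar> powr q') \<le> (\<Sum>u\<in>A. if card u = r then (1 / \<omega> ^ r) powr q' else 0)"
    proof (rule sum_mono)
      fix u assume u: "u \<in> A"
      show "\<bar>?a u\<bar> powr q' \<le> (if card u = r then (1 / \<omega> ^ r) powr q' else 0)"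
        using a[OF u] q' \<omega>_pos by (auto intro!: powr_mono2)
    qed
    also have "\<dots> = N * (1 / \<omega> ^ r) powr q'"
      using A_facts(2) by (simp add: sum.If_cases Int_def card_top_order N_def)
    finally have "(\<Sum>u\<in>A. \<bar>?a u\<bar> powr q') powr (1 / q') \<le> (N * (1 / \<omega> ^ r) powr q') powr (1 / q')"
      using q' by (intro powr_mono2 sum_nonneg) auto
    also have "\<dots> = N powr (1 / q') * (1 / \<omega> ^ r)"
      using q' N \<omega>_pos by (simp add: powr_mult powr_powr)
    finally show ?thesis unfolding fA using False enn2real_one_div[OF q_ge_1 False]
      by (simp add: lq_norm_def q'_def)
  qed
  have h_empty: "h {} (\<lambda>_. undefined) = (-1) ^ r * (N * s ^ r)"
  proof -
    have marg: "K.marg w {} (g w) (\<lambda>_. undefined) = (if card w = r then s ^ r else 0)" if "w \<in> A" for w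
    proof -
      have "(\<integral>t. (\<Prod>j\<in>w. \<phi> (t j)) \<partial>K.PP w) = (\<Prod>j\<in>w. s)"
        unfolding s_def using \<phi>_bounds
        by (intro K.PP.product_integral_prod A_facts(4)[OF that] K.integrable_const_bound[of _ m]) auto
      then show ?thesis by (simp add: K.marg_def g_def)
    qed
    have "h {} (\<lambda>_. undefined) = (\<Sum>w\<in>A. (-1) ^ card w * (if card w = r then s ^ r else 0))"
      unfolding h_def K.anova_to_anchored_def using marg by (intro sum.cong) auto
    also have "\<dots> = (\<Sum>w\<in>A. if card w = r then (-1) ^ r * s ^ r else 0)"
      by (intro sum.cong) auto
    also have "\<dots> = (-1) ^ r * (N * s ^ r)"
      using A_facts(2) by (simp add: sum.If_cases Int_def card_top_order N_def)
    finally show ?thesis .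
  qed
  have "N * s ^ r = \<bar>L_psi_norm D \<psi> p {} (h {}) / \<omega> ^ card ({} :: nat set)\<bar>"
    using h_empty s N L_psi_norm_empty[OF p_ge_1, of D \<psi> "h {}"] by (simp add: abs_mult power_abs)
  also have "\<dots> \<le> lq_norm q A (\<lambda>u. L_psi_norm D \<psi> p u (h u) / \<omega> ^ card u)"
    using A_facts q_ge_1 empty_in_small_subsets by (intro abs_le_lq_norm[where i = "{}"]) auto
  also have "\<dots> = W_nrm Anchored f"
    unfolding f_def conv(1) by (rule W_norm_A[symmetric]) (rule conv(2))
  finally have ge: "N * s ^ r \<le> W_nrm Anchored f" .
  have pos: "0 < N * s ^ r" using N s by simp
  have "W_nrm Anchored f \<le> upper_const * W_nrm ANOVA f"
    using conv(1,3) by (simp add: f_def)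
  \<comment> \<open>A vanishing ANOVA norm would make the quotient 0 by convention. The upper bound
    excludes it, because the anchored norm is positive.\<close>
  then have fA_pos: "0 < W_nrm ANOVA f"
    using ge pos fA_nonneg by (cases "W_nrm ANOVA f = 0") auto
  have "N powr \<theta> * (\<omega> * s) ^ r = N * s ^ r / (N powr (enn2real (1 / q)) / \<omega> ^ r)"
    using N by (simp add: powr_diff power_mult_distrib field_simps)
  also have "\<dots> \<le> W_nrm Anchored f / W_nrm ANOVA f"
    using ge fA_le fA_pos pos by (intro frac_le) auto
  finally have "ennreal (N powr \<theta> * (\<omega> * s) ^ r) \<le> ennreal (W_nrm Anchored f / W_nrm ANOVA f)"
    by (rule ennreal_leI)
  also have "\<dots> \<le> iota_norm D \<psi> p q d \<gamma>"
    unfolding iota_norm_eq using f_W by (rule SUP_upper)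
  finally show ?thesis by (simp add: N_def s_def)
qed

text \<open>As \<theta> lies between 0 and 1, the \<theta>-th power of r + 1 is at most r + 1, which
  leaves a constant independent of \<open>d\<close> and \<open>q\<close>.\<close>

lemma upper_const_le:
  "upper_const \<le> (m * max 1 \<omega>) ^ r * 2 ^ r * real (Suc r) * real d powr (real r * \<theta>)"
proof -
  have th: "0 \<le> \<theta>" "\<theta> \<le> 1" using enn2real_one_div_bounds[OF q_ge_1] by auto
  have "(real (Suc r) * real d ^ r) powr \<theta> = real (Suc r) powr \<theta> * real d powr (real r * \<theta>)"
    using d_ge_1 by (simp add: powr_mult powr_powr powr_realpow[symmetric] del: of_nat_Suc)
  also have "\<dots> \<le> real (Suc r) powr 1 * real d powr (real r * \<theta>)"
    using th by (intro mult_right_mono powr_mono) auto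
  finally have "(real (Suc r) * real d ^ r) powr \<theta> \<le> real (Suc r) * real d powr (real r * \<theta>)"
    by simp
  then show ?thesis
    unfolding upper_const_def mult.assoc using K.m_nonneg by (intro mult_left_mono) auto
qed

text \<open>Rests on the bound (d / r)^r for the binomial coefficient d choose r.\<close>

lemma lower_const_ge:
  assumes "r \<le> d" "1 \<le> r"
  shows "(1 / real r) powr (real r * \<theta>) * (\<omega> * (\<integral>t. \<phi> t \<partial>P)) ^ r * real d powr (real r * \<theta>)
    \<le> real (d choose r) powr \<theta> * (\<omega> * (\<integral>t. \<phi> t \<partial>P)) ^ r"
proof -
  have th: "0 \<le> \<theta>" using enn2real_one_div_bounds[OF q_ge_1] by auto
  have "(1 / real r) powr (real r * \<theta>) * real d powr (real r * \<theta>) = ((real d / real r) ^ r) powr \<theta>"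
    using d_ge_1 assms by (simp add: powr_mult[symmetric] powr_powr powr_realpow[symmetric])
  also have "\<dots> \<le> real (d choose r) powr \<theta>"
    using binomial_ge_n_over_k_pow_k[OF assms(1), where 'a = real] th by (intro powr_mono2) auto
  finally have "((1 / real r) powr (real r * \<theta>) * real d powr (real r * \<theta>)) * (\<omega> * (\<integral>t. \<phi> t \<partial>P)) ^ r
      \<le> real (d choose r) powr \<theta> * (\<omega> * (\<integral>t. \<phi> t \<partial>P)) ^ r"
    using \<omega>_pos expectation_\<phi>_pos by (intro mult_right_mono) auto
  then show ?thesis by (simp add: mult_ac)
qed

end

section \<open>Growth exponents in the dimension\<close>

lemma Inf_positive_ge:
  fixes e :: real
  assumes "0 \<le> e"
  shows "Inf {\<tau>. 0 < \<tau> \<and> e \<le> \<tau>} = e"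
proof (rule cInf_eq_non_empty)
  \<comment> \<open>For \<open>e = 0\<close>, which occurs for q = 1, \<open>e\<close> itself is not
    in the set because exponents are required to be positive; hence the witness
    \<open>e + 1\<close>. In that case the infimum is not attained.\<close>
  show "{\<tau>. 0 < \<tau> \<and> e \<le> \<tau>} \<noteq> {}" using assms by (auto intro!: exI[of _ "e + 1"])
  fix y assume y: "\<And>x. x \<in> {\<tau>. 0 < \<tau> \<and> e \<le> \<tau>} \<Longrightarrow> y \<le> x"
  show "y \<le> e"
  proof (rule field_le_epsilon)
    fix c :: real assume "0 < c"
    then show "y \<le> e + c" using assms y[of "e + c"] by simp
  qed
qed auto

lemma real_powr_bigo_iff: "(\<lambda>d. real d powr a) \<in> O(\<lambda>d. real d powr b) \<longleftrightarrow> a \<le> b"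
  by (rule powr_bigo_iff) (auto intro: filterlim_real_sequentially)

theorem mainTheorem6:
  fixes D :: "real set" and \<psi> :: "real \<Rightarrow> real" and r :: nat and \<omega> :: real
    and \<gamma> :: "nat \<Rightarrow> nat set \<Rightarrow> real"
  assumes "domain_interval D"
    and "positive_pdf D \<psi>"
    and "integrability_cond D \<psi> 1"
    and "1 \<le> r" and "0 < \<omega>"
    and "\<And>d u. 1 \<le> d \<Longrightarrow> u \<subseteq> {1..d} \<Longrightarrow> \<gamma> d u = (if card u \<le> r then \<omega> ^ card u else 0)"
  shows "\<forall>p q :: ennreal. 1 \<le> p \<longrightarrow> 1 \<le> q \<longrightarrow>
    integrability_cond D \<psi> p \<and>
    (\<forall>d\<ge>1. iota_norm D \<psi> p q d (\<gamma> d) < \<infinity>) \<and>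
    (\<lambda>d. enn2real (iota_norm D \<psi> p q d (\<gamma> d))) \<in> O(\<lambda>d. real d powr (real r * (1 - enn2real (1 / q)))) \<and>
    (\<lambda>d. enn2real (iota_norm D \<psi> p q d (\<gamma> d))) \<in> \<Omega>(\<lambda>d. real d powr (real r * (1 - enn2real (1 / q)))) \<and>
    polynomially_equivalent D \<psi> p q \<gamma> \<and>
    poly_equiv_exponent D \<psi> p q \<gamma> = real r * (1 - enn2real (1 / q)) \<and>
    (q = 1 \<longrightarrow> uniformly_equivalent D \<psi> p q \<gamma>)"
proof (intro allI impI)
  fix p q :: ennreal assume p: "1 \<le> p" and q: "1 \<le> q"
  interpret anova_domain D \<psi> using assms by unfold_locales
  have fow: "finite_order_weights D \<psi> r \<omega> d (\<gamma> d) p q" if "1 \<le> d" for d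
    using assms p q that by unfold_locales auto
  define e where "e = real r * (1 - enn2real (1 / q))"
  have e: "0 \<le> e" using enn2real_one_div_bounds[OF q] by (simp add: e_def)
  define L where "L d = iota_norm D \<psi> p q d (\<gamma> d)" for d
  define C where "C = (m * max 1 \<omega>) ^ r * 2 ^ r * real (Suc r)"
  define c where "c = (1 / real r) powr e * (\<omega> * (\<integral>t. \<phi> t \<partial>P)) ^ r"
  have C: "0 \<le> C" using K.m_nonneg by (simp add: C_def)
  have c: "0 < c" using assms expectation_\<phi>_pos by (simp add: c_def)
  have le: "L d \<le> ennreal (C * real d powr e)" if "1 \<le> d" for d
    using finite_order_weights.iota_norm_le[OF fow[OF that]] finite_order_weights.upper_const_le[OF fow[OF that]]
    unfolding L_def C_def e_def by (meson ennreal_leI order_trans)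
  \<comment> \<open>For \<open>d < r\<close> there is no set of size \<open>r\<close> among the
    coordinates and the test function is 0, so the bound concerns only
    \<open>r \<le> d\<close>.\<close>
  have ge: "ennreal (c * real d powr e) \<le> L d" if "1 \<le> d" "r \<le> d" for d
    using finite_order_weights.iota_norm_ge[OF fow[OF that(1)] that(2)]
      finite_order_weights.lower_const_ge[OF fow[OF that(1)] that(2) assms(4)]
    unfolding L_def c_def e_def by (meson ennreal_leI order_trans)
  have fin: "L d < \<infinity>" if "1 \<le> d" for d
    using le[OF that] by (auto intro: le_less_trans)
  have O: "(\<lambda>d. enn2real (L d)) \<in> O(\<lambda>d. real d powr e)"
  proof (rule bigoI[where c = C])
    show "\<forall>\<^sub>F d in sequentially. norm (enn2real (L d)) \<le> C * norm (real d powr e)"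
      using eventually_ge_at_top[of 1]
    proof eventually_elim
      case (elim d)
      have "enn2real (L d) \<le> C * real d powr e"
        using C by (intro enn2real_leI le[OF elim]) auto
      then show ?case by simp
    qed
  qed
  have Om: "(\<lambda>d. enn2real (L d)) \<in> \<Omega>(\<lambda>d. real d powr e)"
  proof (rule landau_omega.bigI[where c = c])
    show "\<forall>\<^sub>F d in sequentially. norm (enn2real (L d)) \<ge> c * norm (real d powr e)"
      using eventually_ge_at_top[of 1] eventually_ge_at_top[of r]
    proof eventually_elim
      case (elim d)
      have "enn2real (ennreal (c * real d powr e)) \<le> enn2real (L d)"
        using ge[OF elim] fin[OF elim(1)] by (intro enn2real_mono) auto
      then show ?case using c by simp
    qed
  qed (rule c)
  \<comment> \<open>The lower bound excludes exponents below \<open>e\<close>, and the upper bound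
    admits all others; \<open>fin\<close> provides the finiteness that \<open>iota_norm_bigo\<close>
    also asks for.\<close>
  have bigo_iff: "iota_norm_bigo D \<psi> p q \<gamma> \<tau> \<longleftrightarrow> e \<le> \<tau>" for \<tau>
  proof
    assume "iota_norm_bigo D \<psi> p q \<gamma> \<tau>"
    then have "(\<lambda>d. enn2real (L d)) \<in> O(\<lambda>d. real d powr \<tau>)" by (simp add: iota_norm_bigo_def L_def)
    moreover have "(\<lambda>d. real d powr e) \<in> O(\<lambda>d. enn2real (L d))" using Om by (simp add: bigomega_iff_bigo)
    ultimately have "(\<lambda>d. real d powr e) \<in> O(\<lambda>d. real d powr \<tau>)" by (rule landau_o.big_trans[rotated])
    then show "e \<le> \<tau>" by (simp add: real_powr_bigo_iff)
  next
    assume "e \<le> \<tau>"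
    then have "(\<lambda>d. real d powr e) \<in> O(\<lambda>d. real d powr \<tau>)" by (simp add: real_powr_bigo_iff)
    then show "iota_norm_bigo D \<psi> p q \<gamma> \<tau>"
      using fin landau_o.big_trans[OF O] by (simp add: iota_norm_bigo_def L_def)
  qed
  have "polynomially_equivalent D \<psi> p q \<gamma>"
    unfolding polynomially_equivalent_def bigo_iff using e by (intro exI[of _ "e + 1"]) auto
  moreover have "poly_equiv_exponent D \<psi> p q \<gamma> = e"
    unfolding poly_equiv_exponent_def bigo_iff using e by (rule Inf_positive_ge)
  moreover have "uniformly_equivalent D \<psi> p q \<gamma>" if "q = 1"
  proof -
    \<comment> \<open>For \<open>e = 0\<close> the upper bound is the constant \<open>C\<close>, as
      \<open>real d powr 0 = 1\<close> for \<open>d \<ge> 1\<close>.\<close>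
    have "e = 0" using that by (simp add: e_def)
    then have "(SUP d\<in>{1..}. L d) \<le> ennreal C"
      using le by (intro SUP_least) force
    then show ?thesis unfolding uniformly_equivalent_def L_def by (auto intro: le_less_trans)
  qed
  ultimately show "integrability_cond D \<psi> p \<and>
    (\<forall>d\<ge>1. iota_norm D \<psi> p q d (\<gamma> d) < \<infinity>) \<and>
    (\<lambda>d. enn2real (iota_norm D \<psi> p q d (\<gamma> d))) \<in> O(\<lambda>d. real d powr (real r * (1 - enn2real (1 / q)))) \<and>
    (\<lambda>d. enn2real (iota_norm D \<psi> p q d (\<gamma> d))) \<in> \<Omega>(\<lambda>d. real d powr (real r * (1 - enn2real (1 / q)))) \<and>
    polynomially_equivalent D \<psi> p q \<gamma> \<and>
    poly_equiv_exponent D \<psi> p q \<gamma> = real r * (1 - enn2real (1 / q)) \<and>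
    (q = 1 \<longrightarrow> uniformly_equivalent D \<psi> p q \<gamma>)"
    using integrability_cond_ge_1[OF p] fin O Om unfolding L_def e_def by blast
qed

end
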